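(* Consider the hierarchical $g$-prior model with the hyper-$g$-prior $\pi_n(g)\propto(g+1)^{-c/2}$, $g>0$, and true parameters $\{(\beta_{0n},\sigma_0^2),n\ge1\}$, as described in the context. Posterior consistency under the $\ell_\infty$ norm occurs, i.e. $P_M(\|\beta_n-\beta_{0n}\|_\infty>\epsilon\mid\hat\beta_n,S_n)\to0$ almost surely under $P_0$ for every $\epsilon>0$, if and only if either $\alpha=0$ or there do not exist a subsequence $k_n$ of $n$ and a constant $A>0$ such that $\|\gamma_{k_n}-\beta_{0k_n}\|_2^2\to A$ and $\|\gamma_{k_n}-\beta_{0k_n}\|_\infty\nrightarrow0$.
   Context: Linear model: for each $n\ge1$, $Y_n=X_n\beta_n+e_n$, where $X_n$ is a nonrandom $n\times p_n$ matrix of full column rank, $\beta_n\in\mathbb{R}^{p_n}$, and $e_n\sim N_n(0,\sigma^2 I_n)$. The sequence $p_n$ is nondecreasing with $p_n<n$ and $p_n/n\to\alpha$, where $0\le\alpha<1$. The eigenvalues $\lambda_{n,1},\dots,\lambda_{n,p_n}$ of $n(X_n^TX_n)^{-1}$ satisfy $0<\lambda_{\min}\le\inf_{n,i}\lambda_{n,i}\le\sup_{n,i}\lambda_{n,i}\le\lambda_{\max}<\infty$ for some constants $\lambda_{\min},\lambda_{\max}$. Let $\hat\beta_n=(X_n^TX_n)^{-1}X_n^TY_n$ and $S_n=\|Y_n-X_n\hat\beta_n\|_2^2$; given $(\beta_n,\sigma^2)$ these are independent with $\hat\beta_n\sim N_{p_n}(\beta_n,\sigma^2(X_n^TX_n)^{-1})$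 and $S_n\sim\sigma^2\chi^2_{n-p_n}$. Norms: $\|x\|_\infty=\max_i|x_i|$, $\|x\|_2=(\sum_i x_i^2)^{1/2}$. Hierarchical $g$-prior model $P_M$ with the hyper-$g$-prior: given $(\beta_n,\sigma^2)$, the data $\hat\beta_n$ and $S_n$ are independent with $\hat\beta_n\sim N_{p_n}(\beta_n,\sigma^2(X_n^TX_n)^{-1})$ and $S_n\sim\sigma^2\chi^2_{n-p_n}$, with priors $\beta_n\mid\sigma^2,g\sim N_{p_n}(\gamma_n,g\sigma^2(X_n^TX_n)^{-1})$, $\sigma^2\sim\mathrm{InverseGamma}(a/2,b/2)$ (density proportional to $(\sigma^2)^{-a/2-1}e^{-b/(2\sigma^2)}$) independently of $g$, and $g$ having prior density $\pi_n(g)\propto(g+1)^{-c/2}$ on $(0,\infty)$. Here $a\ge-2$, $b\ge0$ and $c\in\mathbb{R}$ are constants and $\gamma_n\in\mathbb{R}^{p_n}$ is a known nonrandom sequence. Improper priors are allowed, the posterior being defined by Bayes' formula; it is understood that the posterior is proper for all sufficiently large $n$ (for which $p_n+c>2$ is required). True distribution $P_0$: $\beta_{0n}\in\mathbb{R}^{p_n}$ ($n\ge1$) and $\sigma_0^2>0$ are fixed, and $P_0$ is the distribution of $\{(\hat\beta_n,S_n),n\ge1\}$ under $Y_n=X_n\beta_{0n}+e_n$, $e_n\sim N_n(0,\sigma_0^2I_n)$, for each $n\ge1$. *)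

theory Defs
  imports
    "HOL-Probability.Probability"
    "Jordan_Normal_Form.Gauss_Jordan_Elimination"
    "Jordan_Normal_Form.Char_Poly"
    "Jordan_Normal_Form.DL_Rank"
begin

text \<open>
  The dimensions n and p(n) vary inside the statement, so vectors and matrices are those of
  Jordan_Normal_Form (explicit carriers, entries indexed from 0), not the finite Cartesian
  products of HOL-Analysis. Lebesgue measure on p-dimensional space is the product measure
  \<open>\<Pi>\<^sub>M i\<in>{..<p}. lborel\<close>; a point x of it corresponds to the vector \<open>vec p x\<close>.
\<close>

unbundle no vec_syntax

definition mat_inv :: "real mat \<Rightarrow> real mat" where
  "mat_inv A = the (mat_inverse A)"

text \<open>The inserted 0 only matters in dimension 0 (note that p(1) < 1 forces p(1) = 0).\<close>

definition linf_norm :: "real vec \<Rightarrow> real" where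
  "linf_norm x = Max (insert 0 ((\<lambda>i. \<bar>x $ i\<bar>) ` {..<dim_vec x}))"

definition l2_norm :: "real vec \<Rightarrow> real" where
  "l2_norm x = sqrt (\<Sum>i<dim_vec x. (x $ i)\<^sup>2)"

definition mvn_density :: "real vec \<Rightarrow> real mat \<Rightarrow> real vec \<Rightarrow> real" where
  "mvn_density m \<Sigma> x =
     exp (- ((x - m) \<bullet> (mat_inv \<Sigma> *\<^sub>v (x - m))) / 2)
       / sqrt ((2 * pi) ^ dim_vec m * Determinant.det \<Sigma>)"

definition mvn_distributed ::
  "'w measure \<Rightarrow> ('w \<Rightarrow> real vec) \<Rightarrow> real vec \<Rightarrow> real mat \<Rightarrow> bool" where
  "mvn_distributed M Z m \<Sigma> \<longleftrightarrow>
     (\<forall>\<omega>\<in>space M. Z \<omega> \<in> carrier_vec (dim_vec m)) \<and>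
     distributed M (\<Pi>\<^sub>M i\<in>{..<dim_vec m}. lborel)
       (\<lambda>\<omega>. \<lambda>i\<in>{..<dim_vec m}. Z \<omega> $ i)
       (\<lambda>x. ennreal (mvn_density m \<Sigma> (vec (dim_vec m) x)))"

definition chi_square_density :: "nat \<Rightarrow> real \<Rightarrow> real" where
  "chi_square_density k x =
     (if 0 < x
      then x powr (real k / 2 - 1) * exp (- x / 2) / (2 powr (real k / 2) * Gamma (real k / 2))
      else 0)"

definition scaled_chi_square_density :: "real \<Rightarrow> nat \<Rightarrow> real \<Rightarrow> real" where
  "scaled_chi_square_density v k s = chi_square_density k (s / v) / v"

definition ols :: "real mat \<Rightarrow> real vec \<Rightarrow> real vec" where
  "ols X y = mat_inv (X\<^sup>T * X) *\<^sub>v (X\<^sup>T *\<^sub>v y)"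

definition rss :: "real mat \<Rightarrow> real vec \<Rightarrow> real" where
  "rss X y = (l2_norm (y - X *\<^sub>v ols X y))\<^sup>2"

text \<open>
  The priors are unnormalized, since they may be improper; constants of proportionality cancel
  in the posterior. Here v stands for the error variance.
\<close>

definition inverse_gamma_kernel :: "real \<Rightarrow> real \<Rightarrow> real \<Rightarrow> real" where
  "inverse_gamma_kernel a b v = v powr (- a / 2 - 1) * exp (- b / (2 * v))"

definition hyper_g_kernel :: "real \<Rightarrow> real \<Rightarrow> real" where
  "hyper_g_kernel c g = (g + 1) powr (- c / 2)"

definition joint_kernel ::
  "real mat \<Rightarrow> real vec \<Rightarrow> real \<Rightarrow> real \<Rightarrow> real \<Rightarrow> real vec \<Rightarrow> real
     \<Rightarrow> real vec \<Rightarrow> real \<Rightarrow> real \<Rightarrow> real" where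
  "joint_kernel X \<gamma> a b c bhat s \<beta> v g =
     (if 0 < v \<and> 0 < g
      then mvn_density \<beta> (v \<cdot>\<^sub>m mat_inv (X\<^sup>T * X)) bhat
         * scaled_chi_square_density v (dim_row X - dim_col X) s
         * mvn_density \<gamma> ((g * v) \<cdot>\<^sub>m mat_inv (X\<^sup>T * X)) \<beta>
         * inverse_gamma_kernel a b v
         * hyper_g_kernel c g
      else 0)"

definition unnormalized_posterior ::
  "real mat \<Rightarrow> real vec \<Rightarrow> real \<Rightarrow> real \<Rightarrow> real \<Rightarrow> real vec \<Rightarrow> real
     \<Rightarrow> ((nat \<Rightarrow> real) \<times> real \<times> real) measure" where
  "unnormalized_posterior X \<gamma> a b c bhat s =
     density ((\<Pi>\<^sub>M i\<in>{..<dim_col X}. lborel) \<Otimes>\<^sub>M lborel \<Otimes>\<^sub>M lborel)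
       (\<lambda>(x, v, g). ennreal (joint_kernel X \<gamma> a b c bhat s (vec (dim_col X) x) v g))"

text \<open>
  Bayes' formula. The normalizing constant lies strictly between 0 and \<open>\<infinity>\<close>, i.e. the posterior
  is proper, exactly if this is a probability space; otherwise it is the null measure.
\<close>

definition posterior ::
  "real mat \<Rightarrow> real vec \<Rightarrow> real \<Rightarrow> real \<Rightarrow> real \<Rightarrow> real vec \<Rightarrow> real
     \<Rightarrow> ((nat \<Rightarrow> real) \<times> real \<times> real) measure" where
  "posterior X \<gamma> a b c bhat s =
     (let U = unnormalized_posterior X \<gamma> a b c bhat s
      in scale_measure (1 / emeasure U (space U)) U)"

definition posterior_linf_prob ::
  "real mat \<Rightarrow> real vec \<Rightarrow> real \<Rightarrow> real \<Rightarrow> real \<Rightarrow> real vec \<Rightarrow> real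
     \<Rightarrow> real vec \<Rightarrow> real \<Rightarrow> real" where
  "posterior_linf_prob X \<gamma> a b c bhat s \<beta>0 \<epsilon> =
     \<P>(w in posterior X \<gamma> a b c bhat s. linf_norm (vec (dim_col X) (fst w) - \<beta>0) > \<epsilon>)"

end

theory Submission
  imports Defs "HOL-Real_Asymp.Real_Asymp"
begin

text \<open>
  Write u = 1 / (g + 1) for the shrinkage weight, N = n + a, q = p + c - 2, B = b + S and
  \<open>T = \<parallel>X (bhat - \<gamma>)\<parallel>\<^sup>2\<close>. Given v and g, the posterior of \<open>\<beta>\<close> is normal with mean
  \<open>(1 - u) bhat + u \<gamma>\<close> and a covariance of size v / n, so its deviation from the mean vanishes in
  the maximum norm, as does \<open>bhat - \<beta>0\<close>; consistency means that \<open>u \<parallel>\<gamma> - \<beta>0\<parallel>\<^sub>\<infinity>\<close> tends to 0 in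
  posterior probability. Integrating \<open>\<beta>\<close> out leaves for (v, g) a density proportional to
  \<open>v powr (- N / 2 - 1) * u powr (q / 2 + 1) * exp (- (B + T u) / (2 v))\<close>, and integrating exact
  derivatives in v or in g gives the posterior moment bounds \<open>E v \<le> B / (N - q - 2)\<close>,
  \<open>E (T u) \<le> q B / (N - q - 2)\<close> and \<open>E (1 / u) \<le> (T N / B + q) / (q - 2)\<close>.

  Since T is at least a multiple of \<open>n \<parallel>\<gamma> - \<beta>0\<parallel>\<^sub>2\<^sup>2\<close> when that distance is bounded below, the second
  bound makes \<open>u \<parallel>\<gamma> - \<beta>0\<parallel>\<^sub>\<infinity>\<close> small if \<open>q / n \<rightarrow> 0\<close> or \<open>\<parallel>\<gamma> - \<beta>0\<parallel>\<^sub>2\<close> is large, whereas for \<open>\<alpha> > 0\<close> and bounded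
  \<open>\<parallel>\<gamma> - \<beta>0\<parallel>\<^sub>2\<close> the third keeps u away from 0. Almost surely, S, \<open>\<parallel>e\<parallel>\<^sup>2\<close> and the relevant linear forms
  in e are controlled by moment generating functions and the Borel-Cantelli lemma.
\<close>

text \<open>Write D for the Euclidean norm and \<delta> for the maximum norm of \<gamma> - \<beta>0,
  so \<delta> \<le> D. For D bounded away from 0, T is at least of order n D^2, so u is at most of
  order (q/n) / D^2 and the bias u \<delta> at most of order (q/n) / D. If D tends to 0, so does
  \<delta>. Hence inconsistency needs \<alpha> > 0 and a subsequence along which \<delta> stays away
  from 0 and D stays bounded; compactness then supplies the limit A, and \<delta> \<le> D makes it
  positive. Posterior probabilities are estimated by first moments and Markov's inequality alone.
  The bounds for v and T u are coupled: one derivative identity bounds v by T u, the other T u by v.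
  Solving the pair requires a subtraction, so both moments must first be known to be finite; this is
  drawn from the properness of the posterior. The errors for different n may depend on each other in
  any way. Each almost sure claim about them is therefore reduced to exponentially small
  probabilities, summed over n.\<close>

subsection \<open>Integration lemmas\<close>

text \<open>One-dimensional substitution in each coordinate, by induction over \<open>I\<close> with
  Fubini. A translation and a common scale suffice below, because the precision of every Gaussian is
  a scalar multiple of one fixed quadratic form.\<close>

lemma nn_integral_PiM_affine:
  fixes c :: "'i \<Rightarrow> real" and r :: real
  assumes "finite I" "r > 0" "f \<in> borel_measurable (\<Pi>\<^sub>M i\<in>I. lborel)"
  shows "(\<integral>\<^sup>+x. f x \<partial>(\<Pi>\<^sub>M i\<in>I. lborel)) =
    ennreal (r ^ card I) * (\<integral>\<^sup>+x. f (\<lambda>i\<in>I. c i + r * x i) \<partial>(\<Pi>\<^sub>M i\<in>I. lborel))"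
  using assms(1,3)
proof (induction I arbitrary: f)
  case empty
  show ?case by (simp add: space_PiM PiM_empty nn_integral_count_space_finite)
next
  case (insert i I)
  interpret product_sigma_finite "\<lambda>_::'i. lborel :: real measure" ..
  note [measurable] = insert.prems
  let ?P = "\<lambda>I. \<Pi>\<^sub>M i\<in>I. (lborel :: real measure)"
  let ?T = "\<lambda>I x. \<lambda>i\<in>I. c i + r * x i"
  have upd: "(\<lambda>(x, y). f (x(i := c i + r * y))) \<in> borel_measurable (?P I \<Otimes>\<^sub>M lborel)"
    by measurable
  have T: "(\<lambda>x. f (?T (insert i I) x)) \<in> borel_measurable (?P (insert i I))"
    by measurable
  have "(\<integral>\<^sup>+x. f x \<partial>?P (insert i I)) = (\<integral>\<^sup>+x. (\<integral>\<^sup>+y. f (x(i := y)) \<partial>lborel) \<partial>?P I)"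
    by (rule product_nn_integral_insert) (use insert in auto)
  also have "\<dots> = (\<integral>\<^sup>+x. ennreal r * (\<integral>\<^sup>+y. f (x(i := c i + r * y)) \<partial>lborel) \<partial>?P I)"
  proof (rule nn_integral_cong)
    fix x assume x: "x \<in> space (?P I)"
    have "(\<lambda>y. f (x(i := y))) \<in> borel_measurable borel"
      using measurable_comp[OF measurable_component_update insert.prems, OF x insert(2)]
      unfolding comp_def by simp
    from nn_integral_real_affine[OF this, of r "c i"] \<open>r > 0\<close>
    show "(\<integral>\<^sup>+y. f (x(i := y)) \<partial>lborel) = ennreal r * (\<integral>\<^sup>+y. f (x(i := c i + r * y)) \<partial>lborel)"
      by simp
  qed
  also have "\<dots> = ennreal r * (\<integral>\<^sup>+x. (\<integral>\<^sup>+y. f (x(i := c i + r * y)) \<partial>lborel) \<partial>?P I)"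
    by (rule nn_integral_cmult) measurable
  also have "(\<integral>\<^sup>+x. (\<integral>\<^sup>+y. f (x(i := c i + r * y)) \<partial>lborel) \<partial>?P I) =
      ennreal (r ^ card I) * (\<integral>\<^sup>+x. (\<integral>\<^sup>+y. f ((?T I x)(i := c i + r * y)) \<partial>lborel) \<partial>?P I)"
    by (rule insert.IH) measurable
  also have "(\<integral>\<^sup>+x. (\<integral>\<^sup>+y. f ((?T I x)(i := c i + r * y)) \<partial>lborel) \<partial>?P I) =
      (\<integral>\<^sup>+x. (\<integral>\<^sup>+y. f (?T (insert i I) (x(i := y))) \<partial>lborel) \<partial>?P I)"
    using insert(2) by (intro nn_integral_cong arg_cong[where f = f]) (auto simp: fun_eq_iff)
  also have "\<dots> = (\<integral>\<^sup>+x. f (?T (insert i I) x) \<partial>?P (insert i I))"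
    by (rule product_nn_integral_insert[symmetric]) (use insert T in auto)
  also have "ennreal r * (ennreal (r ^ card I) * S) = ennreal (r ^ card (insert i I)) * S" for S
    using insert(1,2) \<open>r > 0\<close> by (simp add: ennreal_mult' mult.assoc)
  finally show ?case .
qed

text \<open>The integral of \<open>h2 - h1\<close> is B - A \<ge> 0. The conclusion avoids
  subtraction, so either integral may be infinite: the fundamental theorem is applied on compact
  intervals exhausting the half-line, followed by monotone convergence.\<close>

lemma nn_integral_le_by_antiderivative:
  fixes F h1 h2 :: "real \<Rightarrow> real"
  assumes deriv: "\<And>x. x > 0 \<Longrightarrow> (F has_real_derivative (h2 x - h1 x)) (at x)"
    and cont: "continuous_on {0<..} h1" "continuous_on {0<..} h2"
    and nonneg: "\<And>x. x > 0 \<Longrightarrow> 0 \<le> h1 x" "\<And>x. x > 0 \<Longrightarrow> 0 \<le> h2 x"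
    and lim: "(F \<longlongrightarrow> A) (at_right 0)" "(F \<longlongrightarrow> B) at_top" and "A \<le> B"
  shows "(\<integral>\<^sup>+x. ennreal (h1 x) * indicator {0<..} x \<partial>lborel) \<le>
    (\<integral>\<^sup>+x. ennreal (h2 x) * indicator {0<..} x \<partial>lborel)" (is "?L \<le> ?R")
proof -
  define J where "J k = {1 / real (Suc k)..real (Suc k)}" for k
  have Jpos: "x > 0" if "x \<in> J k" for k x
    using that less_le_trans[of 0 "1 / real (Suc k)" x] by (auto simp: J_def)
  have le: "1 / real (Suc k) \<le> real (Suc k)" for k
    by (rule order_trans[of _ 1]) auto
  have m: "(\<lambda>x. h x * indicator {0<..} x) \<in> borel_measurable borel"
    if "continuous_on {0<..} h" for h :: "real \<Rightarrow> real"
    using borel_measurable_continuous_on_indicator[OF _ that] by (simp add: mult.commute)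
  have meq: "ennreal (h x) * indicator {0<..} x = ennreal (h x * indicator {0<..} x)" for h and x :: real
    by (auto simp: indicator_def)
  have int: "integrable lborel (\<lambda>x. h x * indicator (J k) x)" if "continuous_on {0<..} h" for h :: "real \<Rightarrow> real" and k
  proof -
    have "integrable lborel (\<lambda>x. indicator (J k) x *\<^sub>R h x)"
      by (rule borel_integrable_compact) (use that Jpos in \<open>auto simp: J_def intro: continuous_on_subset\<close>)
    then show ?thesis by (simp add: mult.commute)
  qed
  have iso: "isCont (\<lambda>x. h2 x - h1 x) x" if "x > 0" for x
    using cont that by (auto intro!: continuous_intros simp: continuous_on_eq_continuous_at)
  \<comment> \<open>The boundary term may be negative; \<open>ennreal\<close> then cuts it off at 0,
    which only weakens the bound. In the limit it becomes \<open>ennreal (A - B)\<close>, which is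
    0.\<close>
  have bd: "(\<integral>\<^sup>+x. ennreal (h1 x * indicator (J k) x) \<partial>lborel) \<le> ?R + ennreal (F (1 / real (Suc k)) - F (real (Suc k)))" for k
  proof -
    have "(\<integral>x. (h2 x - h1 x) * indicator (J k) x \<partial>lborel) = F (real (Suc k)) - F (1 / real (Suc k))"
      unfolding J_def using le Jpos[of _ k] deriv iso by (intro integral_FTC_Icc_real) (auto simp: J_def)
    moreover have "(\<integral>x. (h2 x - h1 x) * indicator (J k) x \<partial>lborel) =
        (\<integral>x. h2 x * indicator (J k) x \<partial>lborel) - (\<integral>x. h1 x * indicator (J k) x \<partial>lborel)"
      using int[OF cont(1)] int[OF cont(2)] by (simp add: left_diff_distrib)
    ultimately have eq: "(\<integral>x. h1 x * indicator (J k) x \<partial>lborel) = (\<integral>x. h2 x * indicator (J k) x \<partial>lborel)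
        + (F (1 / real (Suc k)) - F (real (Suc k)))" by simp
    have nn: "0 \<le> h1 x * indicator (J k) x" "0 \<le> h2 x * indicator (J k) x" for x
      using nonneg Jpos[of x k] by (auto simp: indicator_def)
    have "(\<integral>\<^sup>+x. ennreal (h1 x * indicator (J k) x) \<partial>lborel) = ennreal (\<integral>x. h1 x * indicator (J k) x \<partial>lborel)"
      using int[OF cont(1)] nn by (intro nn_integral_eq_integral) auto
    also have "\<dots> \<le> ennreal (\<integral>x. h2 x * indicator (J k) x \<partial>lborel) + ennreal (F (1 / real (Suc k)) - F (real (Suc k)))"
      unfolding eq by (cases "F (1 / real (Suc k)) - F (real (Suc k)) \<ge> 0")
        (auto simp: ennreal_plus ennreal_neg not_le nn intro!: ennreal_leI integral_nonneg)
    also have "ennreal (\<integral>x. h2 x * indicator (J k) x \<partial>lborel) = (\<integral>\<^sup>+x. ennreal (h2 x * indicator (J k) x) \<partial>lborel)"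
      using int[OF cont(2)] nn by (intro nn_integral_eq_integral[symmetric]) auto
    also have "\<dots> \<le> ?R"
      using nonneg Jpos[of _ k] by (intro nn_integral_mono) (auto simp: indicator_def)
    finally show ?thesis by (simp add: add_right_mono)
  qed
  have lim1: "(\<lambda>k. \<integral>\<^sup>+x. ennreal (h1 x * indicator (J k) x) \<partial>lborel) \<longlonglongrightarrow> ?L"
  proof (rule nn_integral_LIMSEQ)
    have "J k \<subseteq> J (Suc k)" for k
    proof -
      have "1 / real (Suc (Suc k)) \<le> 1 / real (Suc k)" by (simp add: field_simps)
      then show ?thesis by (auto simp: J_def)
    qed
    then have sub: "J k \<subseteq> J l" if "k \<le> l" for k l using lift_Suc_mono_le[of J, OF _ that] by simp
    show "incseq (\<lambda>k x. ennreal (h1 x * indicator (J k) x))"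
      unfolding incseq_def le_fun_def using sub nonneg Jpos
      by (force simp: indicator_def)
    show "(\<lambda>x. ennreal (h1 x * indicator (J k) x)) \<in> borel_measurable lborel" for k
      using int[OF cont(1)] by auto
    fix x :: real
    have "\<forall>\<^sub>F k in sequentially. ennreal (h1 x * indicator (J k) x) = ennreal (h1 x) * indicator {0<..} x"
    proof (cases "x > 0")
      case True
      have "\<forall>\<^sub>F k in sequentially. 1 / real (Suc k) \<le> x" using True by real_asymp
      moreover have "\<forall>\<^sub>F k in sequentially. real (Suc k) \<ge> x" by real_asymp
      ultimately show ?thesis by eventually_elim (use True in \<open>simp add: J_def\<close>)
    next
      case False
      then have "x \<notin> J k" for k using Jpos by blast
      with False show ?thesis by simp
    qed
    then show "(\<lambda>k. ennreal (h1 x * indicator (J k) x)) \<longlonglongrightarrow> ennreal (h1 x) * indicator {0<..} x"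
      by (rule tendsto_eventually)
  qed
  have "filterlim (\<lambda>k. 1 / real (Suc k)) (at_right 0) sequentially" by real_asymp
  from filterlim_compose[OF lim(1) this] have 1: "(\<lambda>k. F (1 / real (Suc k))) \<longlonglongrightarrow> A" .
  have "filterlim (\<lambda>k. real (Suc k)) at_top sequentially" by real_asymp
  from filterlim_compose[OF lim(2) this] have 2: "(\<lambda>k. F (real (Suc k))) \<longlonglongrightarrow> B" .
  have "(\<lambda>k. ?R + ennreal (F (1 / real (Suc k)) - F (real (Suc k)))) \<longlonglongrightarrow> ?R + ennreal (A - B)"
    by (intro tendsto_intros 1 2)
  from LIMSEQ_le[OF lim1 this] bd have "?L \<le> ?R + ennreal (A - B)" by blast
  then show ?thesis using \<open>A \<le> B\<close> by (simp add: ennreal_neg)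
qed

subsection \<open>Gaussian integrals for a design matrix\<close>

lemma nn_integral_exp_minus_square_finite:
  assumes "(k :: real) > 0"
  shows "(\<integral>\<^sup>+x. ennreal (exp (- k * x\<^sup>2 / 2)) \<partial>lborel) < \<infinity>"
proof -
  define \<sigma> where "\<sigma> = 1 / sqrt k"
  have \<sigma>: "\<sigma> > 0" "\<sigma>\<^sup>2 = 1 / k" using assms by (auto simp: \<sigma>_def power_divide)
  have "exp (- k * x\<^sup>2 / 2) = sqrt (2 * pi * \<sigma>\<^sup>2) * normal_density 0 \<sigma> x" for x
    unfolding normal_density_def using assms by (simp add: \<sigma>(2))
  moreover have "integrable lborel (\<lambda>x. sqrt (2 * pi * \<sigma>\<^sup>2) * normal_density 0 \<sigma> x)"
    using \<sigma> by auto
  ultimately have "integrable lborel (\<lambda>x. exp (- k * x\<^sup>2 / 2))" by simp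
  then have "(\<integral>\<^sup>+x. ennreal (norm (exp (- k * x\<^sup>2 / 2))) \<partial>lborel) < \<infinity>"
    unfolding integrable_iff_bounded by blast
  then show ?thesis by simp
qed

lemma nn_integral_PiM_lborel_pos:
  fixes f :: "('i \<Rightarrow> real) \<Rightarrow> ennreal"
  assumes I: "finite I" and f: "f \<in> borel_measurable (\<Pi>\<^sub>M i\<in>I. lborel)" "\<And>x. f x > 0"
  shows "(\<integral>\<^sup>+x. f x \<partial>(\<Pi>\<^sub>M i\<in>I. lborel)) \<noteq> 0"
proof
  interpret product_sigma_finite "\<lambda>_::'i. lborel :: real measure" ..
  let ?P = "\<Pi>\<^sub>M i\<in>I. (lborel :: real measure)"
  assume "(\<integral>\<^sup>+x. f x \<partial>?P) = 0"
  then have "AE x in ?P. f x = 0" using f(1) by (simp add: nn_integral_0_iff_AE)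
  then have "AE x in ?P. False" using f(2) by (simp add: less_le)
  then have "emeasure ?P (space ?P) = 0" by (simp add: AE_iff_null null_setsD1)
  moreover have "emeasure ?P (\<Pi>\<^sub>E i\<in>I. {0..1}) = 1"
    using I by (subst emeasure_PiM) auto
  moreover have "emeasure ?P (\<Pi>\<^sub>E i\<in>I. {0..1}) \<le> emeasure ?P (space ?P)"
    by (rule emeasure_space)
  ultimately show False by simp
qed

text \<open>Index functions replace matrices so that points of the product measure can serve
  directly as coefficient vectors. \<open>V\<close> is the inverse of the Gram matrix of
  \<open>X\<close>; the last two assumptions are the consequences of the upper eigenvalue bound
  \<open>L\<close> for n times that inverse.\<close>

locale design =
  fixes n p :: nat and X V :: "nat \<Rightarrow> nat \<Rightarrow> real" and L :: real
  assumes n_pos: "n > 0" and p_le: "p \<le> n" and L_pos: "L > 0"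
    and gram_inv: "i < p \<Longrightarrow> j < p \<Longrightarrow>
      (\<Sum>k<p. (\<Sum>l<n. X l i * X l k) * V k j) = (if i = j then 1 else 0)"
    and V_diag: "i < p \<Longrightarrow> V i i \<le> L / n"
    and norm_le: "real n * (\<Sum>j<p. (z j)\<^sup>2) \<le> L * (\<Sum>i<n. (\<Sum>j<p. X i j * z j)\<^sup>2)"
begin

definition lin :: "(nat \<Rightarrow> real) \<Rightarrow> nat \<Rightarrow> real" where
  "lin z i = (\<Sum>j<p. X i j * z j)"

definition qn :: "(nat \<Rightarrow> real) \<Rightarrow> real" where
  "qn z = (\<Sum>i<n. (lin z i)\<^sup>2)"

abbreviation qdist :: "(nat \<Rightarrow> real) \<Rightarrow> (nat \<Rightarrow> real) \<Rightarrow> real" where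
  "qdist x y \<equiv> qn (\<lambda>j. x j - y j)"

abbreviation P :: "(nat \<Rightarrow> real) measure" where
  "P \<equiv> \<Pi>\<^sub>M i\<in>{..<p}. lborel"

text \<open>This is (2 pi)^(p/2) divided by the square root of the Gram determinant. It cancels in
  the posterior, so what gets proved about it is that it is finite and nonzero.\<close>

definition C :: ennreal where
  "C = (\<integral>\<^sup>+x. ennreal (exp (- qn x / 2)) \<partial>P)"

lemma qn_nonneg: "qn z \<ge> 0"
  by (simp add: qn_def sum_nonneg)

lemma lin_cong: "(\<And>j. j < p \<Longrightarrow> y j = z j) \<Longrightarrow> lin y i = lin z i"
  by (simp add: lin_def)

lemma qn_cong: "(\<And>j. j < p \<Longrightarrow> y j = z j) \<Longrightarrow> qn y = qn z"
  unfolding qn_def using lin_cong[of y z] by simp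

lemma lin_diff: "lin (\<lambda>j. y j - z j) i = lin y i - lin z i"
  by (simp add: lin_def algebra_simps sum_subtractf)

lemma lin_scale: "lin (\<lambda>j. r * z j) i = r * lin z i"
  by (simp add: lin_def sum_distrib_left algebra_simps)

lemma qn_scale: "qn (\<lambda>j. r * z j) = r\<^sup>2 * qn z"
  by (simp add: qn_def lin_scale power_mult_distrib sum_distrib_left)

lemma measurable_qn [measurable]: 
  "(\<lambda>x. qdist x \<mu>) \<in> borel_measurable P" "qn \<in> borel_measurable P"
  unfolding qn_def[abs_def] lin_def by measurable

text \<open>Column i of \<open>V\<close> represents evaluation at coordinate i with respect to the
  inner product given by the Gram matrix. It supplies both the shift that completes the square in
  \<open>gaussian_mgf\<close> and the weights of the least squares estimator.\<close>

lemma inner_V_column: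
  assumes "i < p"
  shows "(\<Sum>l<n. lin y l * lin (\<lambda>j. V j i) l) = y i"
proof -
  have "(\<Sum>l<n. lin y l * lin (\<lambda>j. V j i) l) =
      (\<Sum>l<n. \<Sum>j<p. \<Sum>k<p. y j * (X l j * X l k * V k i))"
    by (simp add: lin_def sum_product algebra_simps)
  also have "\<dots> = (\<Sum>j<p. \<Sum>k<p. \<Sum>l<n. y j * (X l j * X l k * V k i))"
    by (subst sum.swap, rule sum.cong[OF refl], rule sum.swap)
  also have "\<dots> = (\<Sum>j<p. y j * (\<Sum>k<p. (\<Sum>l<n. X l j * X l k) * V k i))"
    by (simp add: sum_distrib_left sum_distrib_right mult.assoc)
  also have "\<dots> = (\<Sum>j<p. if j = i then y j else 0)"
    using assms by (intro sum.cong) (auto simp: gram_inv)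
  finally show ?thesis using assms by simp
qed

text \<open>By \<open>norm_le\<close> the integrand is dominated by a product of one-dimensional
  Gaussians of precision n / L.\<close>

lemma C_finite: "C < \<infinity>"
proof -
  interpret product_sigma_finite "\<lambda>_::nat. lborel :: real measure" ..
  define k where "k = real n / L"
  have k: "k > 0" using n_pos L_pos by (simp add: k_def)
  have "C \<le> (\<integral>\<^sup>+x. (\<Prod>i\<in>{..<p}. ennreal (exp (- k * (x i)\<^sup>2 / 2))) \<partial>P)"
    unfolding C_def
  proof (rule nn_integral_mono)
    fix x
    have "k * (\<Sum>j<p. (x j)\<^sup>2) \<le> qn x"
      using norm_le[of x] L_pos by (simp add: k_def qn_def lin_def field_simps)
    then have "exp (- qn x / 2) \<le> (\<Prod>i\<in>{..<p}. exp (- k * (x i)\<^sup>2 / 2))"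
      by (simp add: exp_sum[symmetric] sum_negf sum_divide_distrib[symmetric] sum_distrib_left)
    then show "ennreal (exp (- qn x / 2)) \<le> (\<Prod>i\<in>{..<p}. ennreal (exp (- k * (x i)\<^sup>2 / 2)))"
      by (subst prod_ennreal) (auto intro: ennreal_leI)
  qed
  also have "\<dots> = (\<Prod>i\<in>{..<p}. \<integral>\<^sup>+x. ennreal (exp (- k * x\<^sup>2 / 2)) \<partial>lborel)"
    by (rule product_nn_integral_prod) auto
  also have "\<dots> < \<infinity>"
    using nn_integral_exp_minus_square_finite[OF k] by (simp add: ennreal_prod_eq_top less_top prod_constant power_less_top_ennreal)
  finally show ?thesis .
qed

lemma C_nonzero: "C \<noteq> 0"
  unfolding C_def by (rule nn_integral_PiM_lborel_pos) auto

lemma gaussian_integral: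
  assumes "\<tau> > 0"
  shows "(\<integral>\<^sup>+x. ennreal (exp (- \<tau> * qdist x \<mu> / 2)) \<partial>P) = C * ennreal (\<tau> powr (- real p / 2))"
proof -
  define r where "r = 1 / sqrt \<tau>"
  have r: "r > 0" "\<tau> * r\<^sup>2 = 1" using assms by (auto simp: r_def power_divide)
  have *: "qn (\<lambda>j. (\<lambda>i\<in>{..<p}. \<mu> i + r * x i) j - \<mu> j) = r\<^sup>2 * qn x" for x
    unfolding qn_scale[symmetric] by (rule qn_cong) simp
  have "r = \<tau> powr (- 1 / 2)"
    using assms by (simp add: r_def powr_minus powr_half_sqrt field_simps)
  then have rp: "r ^ p = \<tau> powr (- real p / 2)"
    using r by (simp add: powr_realpow[symmetric] powr_powr)
  have "(\<integral>\<^sup>+x. ennreal (exp (- \<tau> * qdist x \<mu> / 2)) \<partial>P) =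
      ennreal (r ^ card {..<p}) * (\<integral>\<^sup>+x. ennreal (exp (- \<tau> * (r\<^sup>2 * qn x) / 2)) \<partial>P)"
    by (subst nn_integral_PiM_affine[of _ r _ \<mu>]) (use r in \<open>simp_all only: * finite_lessThan, measurable\<close>)
  also have "\<dots> = C * ennreal (\<tau> powr (- real p / 2))"
    using r by (simp add: C_def rp mult.assoc[symmetric] mult.commute)
  finally show ?thesis .
qed

lemma gaussian_mgf:
  assumes "\<tau> > 0" and i: "i < p"
  shows "(\<integral>\<^sup>+x. ennreal (exp (t * (x i - \<mu> i) - \<tau> * qdist x \<mu> / 2)) \<partial>P) =
    C * ennreal (\<tau> powr (- real p / 2)) * ennreal (exp (t\<^sup>2 * V i i / (2 * \<tau>)))"
proof -
  \<comment> \<open>The shift for which the cross term \<tau> <y, w> equals t times coordinate i of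
    y.\<close>
  define w where "w j = (t / \<tau>) * V j i" for j
  have sq: "t * y i - \<tau> * qn y / 2 = t\<^sup>2 * V i i / (2 * \<tau>) - \<tau> * qn (\<lambda>j. y j - w j) / 2" for y
  proof -
    have exp: "qn (\<lambda>j. y j - w j) = qn y - 2 * (\<Sum>l<n. lin y l * lin w l) + qn w"
      by (simp add: qn_def lin_diff power2_diff sum.distrib sum_subtractf sum_distrib_left algebra_simps)
    have inner: "(\<Sum>l<n. lin y l * lin w l) = (t / \<tau>) * y i" for y
      unfolding w_def lin_scale inner_V_column[OF i, of y, symmetric] sum_distrib_left
      by (simp add: mult_ac)
    from this[of w] have sqw: "qn w = (t / \<tau>)\<^sup>2 * V i i"
      by (simp add: qn_def power2_eq_square w_def)
    show ?thesis
      unfolding exp inner sqw using assms(1) by (simp add: field_simps power2_eq_square)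
  qed
  have "(\<integral>\<^sup>+x. ennreal (exp (t * (x i - \<mu> i) - \<tau> * qdist x \<mu> / 2)) \<partial>P) =
     (\<integral>\<^sup>+x. ennreal (exp (t\<^sup>2 * V i i / (2 * \<tau>))) * ennreal (exp (- \<tau> * qn (\<lambda>j. x j - (\<mu> j + w j)) / 2)) \<partial>P)"
  proof (rule nn_integral_cong)
    fix x
    show "ennreal (exp (t * (x i - \<mu> i) - \<tau> * qdist x \<mu> / 2)) =
        ennreal (exp (t\<^sup>2 * V i i / (2 * \<tau>))) * ennreal (exp (- \<tau> * qn (\<lambda>j. x j - (\<mu> j + w j)) / 2))"
      using sq[of "\<lambda>j. x j - \<mu> j"] by (simp add: ennreal_mult'[symmetric] mult_exp_exp diff_diff_eq)
  qed
  also have "\<dots> = ennreal (exp (t\<^sup>2 * V i i / (2 * \<tau>))) * (C * ennreal (\<tau> powr (- real p / 2)))"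
    by (subst nn_integral_cmult) (use gaussian_integral[OF assms(1), of "\<lambda>j. \<mu> j + w j"] in auto)
  finally show ?thesis by (simp add: mult.commute)
qed

text \<open>The exponential union bound is weakened by \<open>min 1 y \<le> sqrt y\<close> to a bound linear in v, because
  only the first posterior moment of v is controlled later.\<close>

lemma gaussian_sup_tail:
  assumes v: "v > 0" and \<tau>: "\<tau> \<ge> 1 / v" and \<epsilon>: "\<epsilon> > 0"
  shows "(\<integral>\<^sup>+x. indicator {x. \<exists>i<p. \<bar>x i - \<mu> i\<bar> > \<epsilon>} x * ennreal (exp (- \<tau> * qdist x \<mu> / 2)) \<partial>P) \<le>
    C * ennreal (\<tau> powr (- real p / 2)) * ennreal (8 * L / \<epsilon>\<^sup>2 * (v / sqrt n))" (is "?I \<le> _")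
proof -
  have \<tau>0: "\<tau> > 0" using v by (intro less_le_trans[OF _ \<tau>]) simp
  define G where "G = C * ennreal (\<tau> powr (- real p / 2))"
  \<comment> \<open>The minimizer of - t \<epsilon> + t^2 (L/n) / (2 \<tau>), the Chernoff exponent
    with \<open>V i i\<close> replaced by its bound L/n.\<close>
  define t where "t = \<epsilon> * \<tau> * n / L"
  have t: "t > 0" using \<epsilon> \<tau>0 n_pos L_pos by (simp add: t_def)
  let ?g = "\<lambda>t x i. exp (t * (x i - \<mu> i) - \<tau> * qdist x \<mu> / 2)"
  have triv: "?I \<le> G"
  proof -
    have "?I \<le> (\<integral>\<^sup>+x. ennreal (exp (- \<tau> * qdist x \<mu> / 2)) \<partial>P)"
      by (intro nn_integral_mono) (auto simp: indicator_def)
    then show ?thesis unfolding G_def gaussian_integral[OF \<tau>0] .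
  qed
  have mgf: "(\<integral>\<^sup>+x. ennreal (exp (- t * \<epsilon>)) * ennreal (?g s x i) \<partial>P) \<le>
      G * ennreal (exp (- \<epsilon>\<^sup>2 * n / (2 * L * v)))"
    if "i < p" "s\<^sup>2 = t\<^sup>2" for i s
  proof -
    have "(\<integral>\<^sup>+x. ennreal (exp (- t * \<epsilon>)) * ennreal (?g s x i) \<partial>P) =
        ennreal (exp (- t * \<epsilon>)) * (G * ennreal (exp (t\<^sup>2 * V i i / (2 * \<tau>))))"
      unfolding G_def that(2)[symmetric] gaussian_mgf[OF \<tau>0 \<open>i < p\<close>, of s \<mu>, symmetric]
      using \<open>i < p\<close> by (intro nn_integral_cmult) measurable
    also have "\<dots> = G * ennreal (exp (- t * \<epsilon> + t\<^sup>2 * V i i / (2 * \<tau>)))"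
      by (subst exp_add, subst ennreal_mult) (simp_all add: mult_ac)
    also have "\<dots> \<le> G * ennreal (exp (- \<epsilon>\<^sup>2 * n / (2 * L * v)))"
    proof (intro mult_left_mono ennreal_leI)
      have "t\<^sup>2 * V i i / (2 * \<tau>) \<le> t\<^sup>2 * (L / n) / (2 * \<tau>)"
        using V_diag[OF \<open>i < p\<close>] \<tau>0 by (intro divide_right_mono mult_left_mono) auto
      also have "\<dots> = t * \<epsilon> / 2"
        using \<tau>0 n_pos L_pos by (simp add: t_def power2_eq_square field_simps)
      finally have "- t * \<epsilon> + t\<^sup>2 * V i i / (2 * \<tau>) \<le> - (t * \<epsilon> / 2)" by simp
      also have "t * \<epsilon> / 2 = (\<epsilon>\<^sup>2 * n / (2 * L)) * \<tau>" by (simp add: t_def power2_eq_square field_simps)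
      also have "- \<dots> \<le> - ((\<epsilon>\<^sup>2 * n / (2 * L)) * (1 / v))"
        using \<tau> L_pos by (intro le_imp_neg_le mult_left_mono) auto
      finally show "exp (- t * \<epsilon> + t\<^sup>2 * V i i / (2 * \<tau>)) \<le> exp (- \<epsilon>\<^sup>2 * n / (2 * L * v))"
        by (simp add: field_simps)
    qed simp
    finally show ?thesis .
  qed
  define E where "E = exp (- \<epsilon>\<^sup>2 * n / (2 * L * v))"
  \<comment> \<open>On the event some coordinate exceeds \<epsilon> with one of the two signs, and
    the exponential tilted in that direction is at least the untilted Gaussian factor.\<close>
  have "?I \<le> (\<integral>\<^sup>+x. (\<Sum>i<p. ennreal (exp (- t * \<epsilon>)) * ennreal (?g t x i) + ennreal (exp (- t * \<epsilon>)) * ennreal (?g (- t) x i)) \<partial>P)"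
  proof (intro nn_integral_mono)
    fix x :: "nat \<Rightarrow> real"
    define Q where "Q = exp (- \<tau> * qdist x \<mu> / 2)"
    have split: "ennreal (exp (- t * \<epsilon>)) * ennreal (?g s x i) = ennreal (exp (s * (x i - \<mu> i) - t * \<epsilon>) * Q)" for s i
      unfolding Q_def by (subst ennreal_mult'[symmetric]) (auto simp: exp_add[symmetric] mult_exp_exp)
    show "indicator {x. \<exists>i<p. \<bar>x i - \<mu> i\<bar> > \<epsilon>} x * ennreal (exp (- \<tau> * qdist x \<mu> / 2)) \<le>
        (\<Sum>i<p. ennreal (exp (- t * \<epsilon>)) * ennreal (?g t x i) + ennreal (exp (- t * \<epsilon>)) * ennreal (?g (- t) x i))"
    proof (cases "\<exists>i<p. \<bar>x i - \<mu> i\<bar> > \<epsilon>")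
      case True
      then obtain i where i: "i < p" "\<bar>x i - \<mu> i\<bar> > \<epsilon>" by blast
      have Q: "Q > 0" by (simp add: Q_def)
      have "ennreal Q \<le> ennreal (exp (t * (x i - \<mu> i) - t * \<epsilon>) * Q) + ennreal (exp ((- t) * (x i - \<mu> i) - t * \<epsilon>) * Q)"
      proof (cases "x i - \<mu> i > \<epsilon>")
        case True
        then have "exp (t * (x i - \<mu> i) - t * \<epsilon>) \<ge> 1" using t by simp
        then have "ennreal Q \<le> ennreal (exp (t * (x i - \<mu> i) - t * \<epsilon>) * Q)" using Q by (intro ennreal_leI) simp
        then show ?thesis by (rule order_trans) simp
      next
        case False
        then have "- (x i - \<mu> i) > \<epsilon>" using i by linarith
        then have "t * (- (x i - \<mu> i)) \<ge> t * \<epsilon>" using t by (intro mult_left_mono) auto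
        then have "exp ((- t) * (x i - \<mu> i) - t * \<epsilon>) \<ge> 1" by (simp add: algebra_simps)
        then have "ennreal Q \<le> ennreal (exp ((- t) * (x i - \<mu> i) - t * \<epsilon>) * Q)" using Q by (intro ennreal_leI) simp
        then show ?thesis by (rule order_trans) simp
      qed
      also have "\<dots> \<le> (\<Sum>i<p. ennreal (exp (t * (x i - \<mu> i) - t * \<epsilon>) * Q) + ennreal (exp ((- t) * (x i - \<mu> i) - t * \<epsilon>) * Q))"
        using i(1) by (intro member_le_sum[of i "{..<p}"]) auto
      finally show ?thesis using True unfolding split by (simp add: Q_def)
    qed simp
  qed
  also have "\<dots> = (\<Sum>i<p. (\<integral>\<^sup>+x. ennreal (exp (- t * \<epsilon>)) * ennreal (?g t x i) \<partial>P)
      + (\<integral>\<^sup>+x. ennreal (exp (- t * \<epsilon>)) * ennreal (?g (- t) x i) \<partial>P))"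
    by (subst nn_integral_sum, measurable) (intro sum.cong refl nn_integral_add, measurable)
  also have "\<dots> \<le> (\<Sum>i<p. G * ennreal E + G * ennreal E)"
    unfolding E_def by (intro sum_mono add_mono mgf) auto
  also have "\<dots> = G * ennreal (2 * p * E)"
  proof -
    have "ennreal (2 * p * E) = of_nat p * (ennreal E + ennreal E)"
      by (simp add: E_def ennreal_mult' ennreal_of_nat_eq_real_of_nat[symmetric] mult_2[symmetric] mult_ac)
    then show ?thesis by (simp add: distrib_left mult_ac)
  qed
  finally have tail: "?I \<le> G * ennreal (2 * p * E)" .
  have "?I \<le> G * ennreal (min 1 (2 * p * E))"
    using triv tail by (cases "2 * p * E \<le> 1") (auto simp: min_def)
  also have "\<dots> \<le> G * ennreal (8 * L / \<epsilon>\<^sup>2 * (v / sqrt n))"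
  proof (intro mult_left_mono ennreal_leI)
    \<comment> \<open>Half the exponent of \<open>E\<close>, so that the square root of
      \<open>E\<close> is exp(-y), which is at most 1/y and hence linear in v.\<close>
    define y where "y = \<epsilon>\<^sup>2 * n / (4 * L * v)"
    have y: "y > 0" using \<epsilon> n_pos L_pos v by (simp add: y_def)
    have E: "E = (exp (- y))\<^sup>2" by (simp add: E_def y_def exp_of_nat_mult[symmetric] field_simps power2_eq_square mult_exp_exp)
    have "min 1 (2 * p * E) \<le> sqrt (2 * p * E)"
    proof -
      define z where "z = sqrt (2 * p * E)"
      have z: "z \<ge> 0" "2 * p * E = z\<^sup>2" by (auto simp: z_def E_def)
      show ?thesis unfolding z_def[symmetric] z(2) using z(1)
        by (cases "z \<le> 1") (auto simp: power2_eq_square intro: min.coboundedI1 min.coboundedI2 mult_left_le)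
    qed
    also have "\<dots> = sqrt (2 * p) * exp (- y)" by (simp add: E real_sqrt_mult)
    also have "\<dots> \<le> (2 * sqrt n) * (1 / y)"
    proof (intro mult_mono)
      have "sqrt (2 * p) \<le> sqrt (4 * n)" using p_le by simp
      then show "sqrt (2 * p) \<le> 2 * sqrt n" by (simp add: real_sqrt_mult)
      have "y \<le> exp y" using exp_ge_add_one_self[of y] by linarith
      then show "exp (- y) \<le> 1 / y" using y by (simp add: exp_minus field_simps)
    qed auto
    also have "\<dots> = 8 * L / \<epsilon>\<^sup>2 * (v / sqrt n)"
      using n_pos \<epsilon> L_pos v by (simp add: y_def field_simps)
    finally show "min 1 (2 * p * E) \<le> 8 * L / \<epsilon>\<^sup>2 * (v / sqrt n)" .
  qed simp
  finally show ?thesis unfolding G_def .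
qed

end

subsection \<open>Moments of the posterior of the variance and g\<close>

abbreviation VG :: "(real \<times> real) measure" where
  "VG \<equiv> lborel \<Otimes>\<^sub>M lborel"

locale variance_g =
  fixes N q B T :: real
  assumes N: "N > 2" and B: "B > 0" and T: "T \<ge> 0"
begin

text \<open>With q = p + c - 2 the exponent of g + 1 is -(p + c)/2: the prior contributes c/2 and
  the integration over \<beta> contributes p/2.\<close>

definition psi :: "real \<Rightarrow> real \<Rightarrow> real" where
  "psi v g = (if 0 < v \<and> 0 < g
     then v powr (- N / 2 - 1) * (g + 1) powr (- q / 2 - 1) * exp (- (B + T / (g + 1)) / (2 * v))
     else 0)"

text \<open>An unnormalized posterior mean. Keeping it in \<open>ennreal\<close> allows the moment
  inequalities to be stated before any of the integrals is known to be finite.\<close>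

definition integ :: "(real \<Rightarrow> real \<Rightarrow> real) \<Rightarrow> ennreal" where
  "integ \<phi> = (\<integral>\<^sup>+(v, g). ennreal (\<phi> v g * psi v g) \<partial>VG)"

lemma psi_nonneg: "psi v g \<ge> 0"
  by (simp add: psi_def)

lemma measurable_psi [measurable]: "(\<lambda>(v, g). psi v g) \<in> borel_measurable VG"
  unfolding psi_def by measurable

text \<open>Tonelli with g as the outer variable. It permits integration by parts in v with g
  frozen; the companion lemma exchanges the roles.\<close>

lemma integ_mono_slices_v:
  assumes [measurable]: "case_prod \<phi>1 \<in> borel_measurable VG"
    "case_prod \<phi>2 \<in> borel_measurable VG"
    and le: "\<And>g. g > 0 \<Longrightarrow> (\<integral>\<^sup>+v. ennreal (\<phi>1 v g * psi v g) * indicator {0<..} v \<partial>lborel) \<le>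
      (\<integral>\<^sup>+v. ennreal (\<phi>2 v g * psi v g) * indicator {0<..} v \<partial>lborel)"
  shows "integ \<phi>1 \<le> integ \<phi>2"
proof -
  have ind: "ennreal (\<phi> v g * psi v g) = ennreal (\<phi> v g * psi v g) * indicator {0<..} v" for \<phi> v g
    by (auto simp: psi_def indicator_def)
  have eq: "integ \<phi> = (\<integral>\<^sup>+g. (\<integral>\<^sup>+v. ennreal (\<phi> v g * psi v g) * indicator {0<..} v \<partial>lborel) \<partial>lborel)"
    if [measurable]: "case_prod \<phi> \<in> borel_measurable VG" for \<phi>
    unfolding integ_def ind[symmetric] by (subst lborel_pair.nn_integral_snd[symmetric]) auto
  show ?thesis
    unfolding eq[OF assms(1)] eq[OF assms(2)]
  proof (rule nn_integral_mono)
    fix g :: real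
    show "(\<integral>\<^sup>+v. ennreal (\<phi>1 v g * psi v g) * indicator {0<..} v \<partial>lborel) \<le>
      (\<integral>\<^sup>+v. ennreal (\<phi>2 v g * psi v g) * indicator {0<..} v \<partial>lborel)"
      using le[of g] by (cases "g > 0") (auto simp: psi_def)
  qed
qed

lemma integ_mono_slices_g:
  assumes [measurable]: "case_prod \<phi>1 \<in> borel_measurable VG"
    "case_prod \<phi>2 \<in> borel_measurable VG"
    and le: "\<And>v. v > 0 \<Longrightarrow> (\<integral>\<^sup>+g. ennreal (\<phi>1 v g * psi v g) * indicator {0<..} g \<partial>lborel) \<le>
      (\<integral>\<^sup>+g. ennreal (\<phi>2 v g * psi v g) * indicator {0<..} g \<partial>lborel)"
  shows "integ \<phi>1 \<le> integ \<phi>2"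
proof -
  have ind: "ennreal (\<phi> v g * psi v g) = ennreal (\<phi> v g * psi v g) * indicator {0<..} g" for \<phi> v g
    by (auto simp: psi_def indicator_def)
  have eq: "integ \<phi> = (\<integral>\<^sup>+v. (\<integral>\<^sup>+g. ennreal (\<phi> v g * psi v g) * indicator {0<..} g \<partial>lborel) \<partial>lborel)"
    if [measurable]: "case_prod \<phi> \<in> borel_measurable VG" for \<phi>
    unfolding integ_def ind[symmetric] by (subst lborel.nn_integral_fst[symmetric]) auto
  show ?thesis
    unfolding eq[OF assms(1)] eq[OF assms(2)]
  proof (rule nn_integral_mono)
    fix v :: real
    show "(\<integral>\<^sup>+g. ennreal (\<phi>1 v g * psi v g) * indicator {0<..} g \<partial>lborel) \<le>
      (\<integral>\<^sup>+g. ennreal (\<phi>2 v g * psi v g) * indicator {0<..} g \<partial>lborel)"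
      using le[of v] by (cases "v > 0") (auto simp: psi_def)
  qed
qed

lemma continuous_on_psi_v: "g > 0 \<Longrightarrow> continuous_on {0<..} (\<lambda>v. psi v g)"
  unfolding psi_def by (rule continuous_on_eq[of _ "\<lambda>v. v powr (- N / 2 - 1) * (g + 1) powr (- q / 2 - 1) * exp (- (B + T / (g + 1)) / (2 * v))"])
    (auto intro!: continuous_intros)

lemma continuous_on_psi_g: "v > 0 \<Longrightarrow> continuous_on {0<..} (\<lambda>g. psi v g)"
  unfolding psi_def by (rule continuous_on_eq[of _ "\<lambda>g. v powr (- N / 2 - 1) * (g + 1) powr (- q / 2 - 1) * exp (- (B + T / (g + 1)) / (2 * v))"])
    (auto intro!: continuous_intros)

lemma B_plus_pos: "g > 0 \<Longrightarrow> B + T / (g + 1) > 0"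
  using B T by (intro add_pos_nonneg) auto

lemma T_div_le: "g > 0 \<Longrightarrow> T / (g + 1) \<le> T"
  using mult_left_mono[of 1 "g + 1" T] T by (simp add: divide_le_eq)

lemma tendsto_powr_exp_inverse:
  assumes "s > 0" "y > 0"
  shows "((\<lambda>v::real. G * (v powr (- s) * exp (- y / (2 * v)))) \<longlongrightarrow> 0) (at_right 0)"
    and "((\<lambda>v::real. G * (v powr (- s) * exp (- y / (2 * v)))) \<longlongrightarrow> 0) at_top"
proof -
  have "((\<lambda>v::real. v powr (- s) * exp (- y / (2 * v))) \<longlongrightarrow> 0) (at_right 0)"
    "((\<lambda>v::real. v powr (- s) * exp (- y / (2 * v))) \<longlongrightarrow> 0) at_top"
    using assms by real_asymp+
  then show "((\<lambda>v::real. G * (v powr (- s) * exp (- y / (2 * v)))) \<longlongrightarrow> 0) (at_right 0)"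
    "((\<lambda>v::real. G * (v powr (- s) * exp (- y / (2 * v)))) \<longlongrightarrow> 0) at_top"
    by (auto intro: tendsto_mult_right_zero)
qed

lemma DERIV_powr_exp_inverse:
  fixes v :: real
  assumes "v > 0"
  shows "((\<lambda>v. G * (v powr (- s) * exp (- y / (2 * v)))) has_real_derivative
    G * (v powr (- s) * exp (- y / (2 * v))) * (y / (2 * v\<^sup>2) - s / v)) (at v)"
  by (rule derivative_eq_intros refl | use assms in \<open>simp; fail\<close>)+
    (use assms in \<open>simp add: powr_diff field_simps power2_eq_square\<close>)

text \<open>The integrated derivative is that of 2 v^2 psi, namely (B + T u - (N - 2) v) psi. It
  vanishes at both ends of the half-line since N > 2 and B > 0.\<close>

lemma moment_v: "integ (\<lambda>v g. (N - 2) * v) \<le> integ (\<lambda>v g. B + T / (g + 1))"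
proof (rule integ_mono_slices_v)
  fix g :: real assume g: "g > 0"
  define y where "y = B + T / (g + 1)"
  have y: "y > 0" unfolding y_def by (rule B_plus_pos[OF g])
  define G where "G = 2 * (g + 1) powr (- q / 2 - 1)"
  let ?F = "\<lambda>v. G * (v powr (- (N / 2 - 1)) * exp (- y / (2 * v)))"
  show "(\<integral>\<^sup>+v. ennreal ((N - 2) * v * psi v g) * indicator {0<..} v \<partial>lborel) \<le>
      (\<integral>\<^sup>+v. ennreal ((B + T / (g + 1)) * psi v g) * indicator {0<..} v \<partial>lborel)"
  proof (rule nn_integral_le_by_antiderivative[where F = ?F and A = 0 and B = 0])
    fix v :: real assume v: "v > 0"
    have p: "v powr (- (N / 2 - 1)) = v powr (- N / 2 - 1) * v\<^sup>2"
      using v powr_add[of v "- N / 2 - 1" 2] by simp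
    have psi: "psi v g = G / 2 * (v powr (- N / 2 - 1) * exp (- y / (2 * v)))"
      using v g by (simp add: psi_def G_def y_def)
    have "?F v * (y / (2 * v\<^sup>2) - (N / 2 - 1) / v) = y * psi v g - (N - 2) * v * psi v g"
      unfolding p psi using v by (simp add: field_simps power2_eq_square)
    then show "(?F has_real_derivative (B + T / (g + 1)) * psi v g - (N - 2) * v * psi v g) (at v)"
      using DERIV_powr_exp_inverse[OF v, of G "N / 2 - 1" y] by (simp add: y_def)
  next
    show "(?F \<longlongrightarrow> 0) (at_right 0)" "(?F \<longlongrightarrow> 0) at_top"
      by (rule tendsto_powr_exp_inverse; use N y in simp)+
  qed (use N g psi_nonneg B_plus_pos[OF g] in \<open>auto intro!: continuous_intros continuous_on_psi_v\<close>)
qed measurable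

text \<open>Same argument with -2 v psi, whose derivative in v is (N - (B + T u)/v) psi.\<close>

lemma moment_inverse_v: "integ (\<lambda>v g. (B + T / (g + 1)) / v) \<le> integ (\<lambda>v g. N)"
proof (rule integ_mono_slices_v)
  fix g :: real assume g: "g > 0"
  define y where "y = B + T / (g + 1)"
  have y: "y > 0" unfolding y_def by (rule B_plus_pos[OF g])
  define G where "G = - 2 * (g + 1) powr (- q / 2 - 1)"
  let ?F = "\<lambda>v. G * (v powr (- (N / 2)) * exp (- y / (2 * v)))"
  show "(\<integral>\<^sup>+v. ennreal ((B + T / (g + 1)) / v * psi v g) * indicator {0<..} v \<partial>lborel) \<le>
      (\<integral>\<^sup>+v. ennreal (N * psi v g) * indicator {0<..} v \<partial>lborel)"
  proof (rule nn_integral_le_by_antiderivative[where F = ?F and A = 0 and B = 0])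
    fix v :: real assume v: "v > 0"
    have p: "v powr (- (N / 2)) = v powr (- N / 2 - 1) * v"
      using v powr_add[of v "- N / 2 - 1" 1] by simp
    have psi: "psi v g = - G / 2 * (v powr (- N / 2 - 1) * exp (- y / (2 * v)))"
      using v g by (simp add: psi_def G_def y_def)
    have "?F v * (y / (2 * v\<^sup>2) - (N / 2) / v) = N * psi v g - y / v * psi v g"
      unfolding p psi using v by (simp add: field_simps power2_eq_square)
    then show "(?F has_real_derivative N * psi v g - (B + T / (g + 1)) / v * psi v g) (at v)"
      using DERIV_powr_exp_inverse[OF v, of G "N / 2" y] by (simp add: y_def)
  next
    show "(?F \<longlongrightarrow> 0) (at_right 0)" "(?F \<longlongrightarrow> 0) at_top"
      by (rule tendsto_powr_exp_inverse; use N y in simp)+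
  qed (use N g psi_nonneg B_plus_pos[OF g] in \<open>auto intro!: continuous_intros continuous_on_psi_v\<close>)
qed measurable

lemma tendsto_shifted_powr_exp:
  assumes "s > 0"
  shows "((\<lambda>g::real. G * ((g + 1) powr (- s) * exp (- t / (g + 1)))) \<longlongrightarrow> 0) at_top"
proof -
  have "((\<lambda>g::real. (g + 1) powr (- s) * exp (- t / (g + 1))) \<longlongrightarrow> 0) at_top"
    using assms by real_asymp
  then show ?thesis by (auto intro: tendsto_mult_right_zero)
qed

lemma tendsto_shifted_powr_exp_0:
  "((\<lambda>g::real. G * ((g + 1) powr (- s) * exp (- t / (g + 1)))) \<longlongrightarrow> G * exp (- t)) (at_right 0)"
proof -
  have "((\<lambda>g::real. G * ((g + 1) powr (- s) * exp (- t / (g + 1)))) \<longlongrightarrow> G * ((0 + 1) powr (- s) * exp (- t / (0 + 1)))) (at_right 0)"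
    by (intro tendsto_intros) auto
  then show ?thesis by simp
qed

lemma DERIV_shifted_powr_exp:
  fixes g :: real
  assumes "g > 0"
  shows "((\<lambda>g. G * ((g + 1) powr (- s) * exp (- t / (g + 1)))) has_real_derivative
    G * ((g + 1) powr (- s) * exp (- t / (g + 1))) * (t / (g + 1)\<^sup>2 - s / (g + 1))) (at g)"
  by (rule derivative_eq_intros refl | use assms in \<open>simp; fail\<close>)+
    (use assms in \<open>simp add: powr_diff field_simps power2_eq_square\<close>)

lemma psi_alt:
  assumes "v > 0" "g > 0"
  shows "psi v g = v powr (- N / 2 - 1) * exp (- B / (2 * v)) * ((g + 1) powr (- (q / 2)) * exp (- (T / (2 * v)) / (g + 1))) / (g + 1)"
proof -
  have "- (B + T / (g + 1)) / (2 * v) = - B / (2 * v) + - (T / (2 * v)) / (g + 1)"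
    by (simp add: add_divide_distrib diff_divide_distrib mult_ac)
  then show ?thesis using assms by (simp add: psi_def exp_add[symmetric] powr_diff)
qed

text \<open>The derivative in g of -2 v (g + 1) psi is (q v - T u) psi. The antiderivative is
  negative at g = 0 and tends to 0 at infinity because q > 0, so the boundary term has the
  favourable sign.\<close>

lemma moment_shrinkage:
  assumes q: "q > 0"
  shows "integ (\<lambda>v g. T / (g + 1)) \<le> integ (\<lambda>v g. q * v)"
proof (rule integ_mono_slices_g)
  fix v :: real assume v: "v > 0"
  define t where "t = T / (2 * v)"
  have t: "t \<ge> 0" using T v by (simp add: t_def)
  define G where "G = - 2 * v * (v powr (- N / 2 - 1) * exp (- B / (2 * v)))"
  let ?F = "\<lambda>g. G * ((g + 1) powr (- (q / 2)) * exp (- t / (g + 1)))"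
  show "(\<integral>\<^sup>+g. ennreal (T / (g + 1) * psi v g) * indicator {0<..} g \<partial>lborel) \<le>
      (\<integral>\<^sup>+g. ennreal (q * v * psi v g) * indicator {0<..} g \<partial>lborel)"
  proof (rule nn_integral_le_by_antiderivative[where F = ?F and A = "G * exp (- t)" and B = 0])
    fix g :: real assume g: "g > 0"
    have Tt: "T = t * (2 * v)" using v by (simp add: t_def)
    have "?F g * (t / (g + 1)\<^sup>2 - (q / 2) / (g + 1)) = q * v * psi v g - T / (g + 1) * psi v g"
      unfolding psi_alt[OF v g] t_def[symmetric] unfolding Tt
      using v g by (simp add: G_def field_simps power2_eq_square)
    then show "(?F has_real_derivative q * v * psi v g - T / (g + 1) * psi v g) (at g)"
      using DERIV_shifted_powr_exp[OF g, of G "q / 2" t] by simp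
  next
    show "G * exp (- t) \<le> 0" using v by (simp add: G_def)
    show "(?F \<longlongrightarrow> G * exp (- t)) (at_right 0)" by (rule tendsto_shifted_powr_exp_0)
    show "(?F \<longlongrightarrow> 0) at_top" by (rule tendsto_shifted_powr_exp) (use q in simp)
  qed (use q T v psi_nonneg in \<open>auto intro!: continuous_intros continuous_on_psi_g\<close>)
qed measurable

text \<open>The antiderivative is 2 g (g + 1) psi, split as \<open>?F1 - ?F2\<close>; subtracting
  \<open>?F2\<close> makes it vanish at g = 0. Decay at infinity needs q > 2. The term T u / v
  produced by \<open>?F2\<close> is nonnegative, so it can first be added on the left.\<close>

lemma moment_inverse_shrinkage:
  assumes q: "q > 2"
  shows "integ (\<lambda>v g. (q - 2) * (g + 1)) \<le> integ (\<lambda>v g. T / v + q)"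
proof (rule order_trans)
  show "integ (\<lambda>v g. (q - 2) * (g + 1)) \<le> integ (\<lambda>v g. (q - 2) * (g + 1) + T / v / (g + 1))"
    unfolding integ_def
  proof (intro nn_integral_mono, clarify)
    fix v g :: real
    show "ennreal ((q - 2) * (g + 1) * psi v g) \<le> ennreal (((q - 2) * (g + 1) + T / v / (g + 1)) * psi v g)"
    proof (cases "v > 0 \<and> g > 0")
      case True
      then show ?thesis using T by (intro ennreal_leI mult_right_mono psi_nonneg) simp
    qed (auto simp: psi_def)
  qed
  show "integ (\<lambda>v g. (q - 2) * (g + 1) + T / v / (g + 1)) \<le> integ (\<lambda>v g. T / v + q)"
  proof (rule integ_mono_slices_g)
    fix v :: real assume v: "v > 0"
    define t where "t = T / (2 * v)"
    have t: "t \<ge> 0" using T v by (simp add: t_def)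
    define G where "G = 2 * (v powr (- N / 2 - 1) * exp (- B / (2 * v)))"
    let ?F1 = "\<lambda>g. G * ((g + 1) powr (- (q / 2 - 1)) * exp (- t / (g + 1)))"
    let ?F2 = "\<lambda>g. G * ((g + 1) powr (- (q / 2)) * exp (- t / (g + 1)))"
    show "(\<integral>\<^sup>+g. ennreal (((q - 2) * (g + 1) + T / v / (g + 1)) * psi v g) * indicator {0<..} g \<partial>lborel) \<le>
        (\<integral>\<^sup>+g. ennreal ((T / v + q) * psi v g) * indicator {0<..} g \<partial>lborel)"
    proof (rule nn_integral_le_by_antiderivative[where F = "\<lambda>g. ?F1 g - ?F2 g" and A = "G * exp (- t) - G * exp (- t)" and B = "0 - 0"])
      fix g :: real assume g: "g > 0"
      have Tt: "T / v = t * 2" using v by (simp add: t_def)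
      have p: "(g + 1) powr (- (q / 2 - 1)) = (g + 1) powr (- (q / 2)) * (g + 1)"
        using g powr_add[of "g + 1" "- (q / 2)" 1] by simp
      have "?F1 g * (t / (g + 1)\<^sup>2 - (q / 2 - 1) / (g + 1)) - ?F2 g * (t / (g + 1)\<^sup>2 - (q / 2) / (g + 1)) =
          (T / v + q) * psi v g - ((q - 2) * (g + 1) + T / v / (g + 1)) * psi v g"
        unfolding psi_alt[OF v g] t_def[symmetric] unfolding Tt p
        using g by (simp add: G_def divide_simps power2_eq_square) (simp add: algebra_simps)
      then show "((\<lambda>g. ?F1 g - ?F2 g) has_real_derivative (T / v + q) * psi v g - ((q - 2) * (g + 1) + T / v / (g + 1)) * psi v g) (at g)"
        using DERIV_diff[OF DERIV_shifted_powr_exp[OF g, of G "q / 2 - 1" t] DERIV_shifted_powr_exp[OF g, of G "q / 2" t]] by simp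
    next
      show "((\<lambda>g. ?F1 g - ?F2 g) \<longlongrightarrow> G * exp (- t) - G * exp (- t)) (at_right 0)"
        by (intro tendsto_diff tendsto_shifted_powr_exp_0)
      show "((\<lambda>g. ?F1 g - ?F2 g) \<longlongrightarrow> 0 - 0) at_top"
        using q by (intro tendsto_diff tendsto_shifted_powr_exp) auto
    qed (use q T v psi_nonneg in \<open>auto intro!: continuous_intros continuous_on_psi_g\<close>)
  qed measurable
qed

lemma integ_add:
  assumes [measurable]: "case_prod \<phi>1 \<in> borel_measurable VG"
    "case_prod \<phi>2 \<in> borel_measurable VG"
    and nonneg: "\<And>v g. v > 0 \<Longrightarrow> g > 0 \<Longrightarrow> \<phi>1 v g \<ge> 0" "\<And>v g. v > 0 \<Longrightarrow> g > 0 \<Longrightarrow> \<phi>2 v g \<ge> 0"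
  shows "integ (\<lambda>v g. \<phi>1 v g + \<phi>2 v g) = integ \<phi>1 + integ \<phi>2"
proof -
  have "integ (\<lambda>v g. \<phi>1 v g + \<phi>2 v g) =
      (\<integral>\<^sup>+x. (case x of (v, g) \<Rightarrow> ennreal (\<phi>1 v g * psi v g)) + (case x of (v, g) \<Rightarrow> ennreal (\<phi>2 v g * psi v g)) \<partial>VG)"
    unfolding integ_def
  proof (rule nn_integral_cong, clarify)
    fix v g :: real
    show "ennreal ((\<phi>1 v g + \<phi>2 v g) * psi v g) = ennreal (\<phi>1 v g * psi v g) + ennreal (\<phi>2 v g * psi v g)"
    proof (cases "v > 0 \<and> g > 0")
      case True
      then show ?thesis
        using nonneg psi_nonneg by (simp add: distrib_right)
    qed (auto simp: psi_def)
  qed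
  also have "\<dots> = integ \<phi>1 + integ \<phi>2"
    unfolding integ_def by (rule nn_integral_add) measurable
  finally show ?thesis .
qed

lemma integ_cmult:
  assumes [measurable]: "case_prod \<phi> \<in> borel_measurable VG" and "c \<ge> 0"
  shows "integ (\<lambda>v g. c * \<phi> v g) = ennreal c * integ \<phi>"
  unfolding integ_def using \<open>c \<ge> 0\<close>
  by (subst nn_integral_cmult[symmetric]) (auto simp: ennreal_mult' mult.assoc intro!: nn_integral_cong)

abbreviation Z :: ennreal where
  "Z \<equiv> integ (\<lambda>v g. 1)"

lemma integ_const: "c \<ge> 0 \<Longrightarrow> integ (\<lambda>v g. c) = ennreal c * Z"
  using integ_cmult[of "\<lambda>v g. 1" c] by simp

lemma nn_integral_inverse_diverges: "(\<integral>\<^sup>+g. ennreal (1 / (g + 1)) * indicator {0<..} g \<partial>lborel) = \<infinity>"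
proof (rule ccontr)
  let ?I = "\<integral>\<^sup>+g. ennreal (1 / (g + 1)) * indicator {0<..} g \<partial>(lborel :: real measure)"
  assume "?I \<noteq> \<infinity>"
  then obtain r where r: "?I = ennreal r" "r \<ge> 0" by (cases ?I) auto
  have le: "ln (R + 1) \<le> r" if "R > 0" for R
  proof -
    have int: "has_bochner_integral lborel (\<lambda>g. 1 / (g + 1) * indicator {0..R} g) (ln (R + 1) - ln (0 + 1))"
    proof (rule has_bochner_integral_FTC_Icc_real)
      fix g :: real assume "0 \<le> g" "g \<le> R"
      then show "((\<lambda>g. ln (g + 1)) has_real_derivative 1 / (g + 1)) (at g)" "isCont (\<lambda>g. 1 / (g + 1)) g"
        by (auto intro!: derivative_eq_intros)
    qed (use that in simp)
    have "ennreal (ln (R + 1)) = (\<integral>\<^sup>+g. ennreal (1 / (g + 1) * indicator {0..R} g) \<partial>lborel)"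
      using int that by (subst nn_integral_eq_integral) (auto simp: has_bochner_integral_iff indicator_def)
    also have "\<dots> \<le> ?I"
    proof (rule nn_integral_mono_AE)
      show "AE g in lborel. ennreal (1 / (g + 1) * indicator {0..R} g) \<le> ennreal (1 / (g + 1)) * indicator {0<..} g"
        using AE_lborel_singleton[of 0] by eventually_elim (auto simp: indicator_def)
    qed
    finally show ?thesis using r by (simp add: ennreal_le_iff)
  qed
  from le[of "exp (r + 1)"] have "ln (exp (r + 1) + 1) \<le> r" by simp
  moreover have "ln (exp (r + 1)) \<le> ln (exp (r + 1) + 1)" by (subst ln_le_cancel_iff) (auto intro: add_pos_pos)
  ultimately show False by simp
qed

text \<open>For q \<le> 0 and any v > 0 the integrand in g dominates a positive multiple of 1/(g +
  1), whose integral diverges. Properness thus yields p + c > 2.\<close>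

lemma q_pos:
  assumes fin: "Z < \<infinity>"
  shows "q > 0"
proof (rule ccontr)
  assume "\<not> q > 0"
  have inf: "(\<integral>\<^sup>+g. ennreal (psi v g) \<partial>lborel) = \<infinity>" if v: "v > 0" for v
  proof -
    define K where "K = v powr (- N / 2 - 1) * exp (- (B + T) / (2 * v))"
    have K: "K > 0" using v by (simp add: K_def)
    have "\<infinity> = ennreal K * (\<integral>\<^sup>+g. ennreal (1 / (g + 1)) * indicator {0<..} g \<partial>lborel)"
      using K nn_integral_inverse_diverges by (simp add: ennreal_mult_top)
    also have "\<dots> = (\<integral>\<^sup>+g. ennreal K * (ennreal (1 / (g + 1)) * indicator {0<..} g) \<partial>lborel)"
      by (rule nn_integral_cmult[symmetric]) measurable
    also have "\<dots> \<le> (\<integral>\<^sup>+g. ennreal (psi v g) \<partial>lborel)"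
    proof (rule nn_integral_mono)
      fix g :: real
      show "ennreal K * (ennreal (1 / (g + 1)) * indicator {0<..} g) \<le> ennreal (psi v g)"
      proof (cases "g > 0")
        case True
        have "T / (g + 1) \<le> T" using True by (rule T_div_le)
        then have "K \<le> v powr (- N / 2 - 1) * exp (- (B + T / (g + 1)) / (2 * v))"
          unfolding K_def using v by (intro mult_left_mono) (auto intro!: divide_right_mono)
        moreover have "1 / (g + 1) \<le> (g + 1) powr (- q / 2 - 1)"
          using powr_mono[of "-1" "- q / 2 - 1" "g + 1"] powr_neg_one[of "g + 1"] True \<open>\<not> q > 0\<close> by simp
        ultimately have "K * (1 / (g + 1)) \<le> (v powr (- N / 2 - 1) * exp (- (B + T / (g + 1)) / (2 * v))) * (g + 1) powr (- q / 2 - 1)"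
          using True K by (intro mult_mono) auto
        also have "\<dots> = psi v g" using v True by (simp add: psi_def)
        finally show ?thesis using True K by (simp add: ennreal_mult'[symmetric] ennreal_leI)
      qed simp
    qed
    finally show ?thesis by (simp add: top_unique)
  qed
  have "\<infinity> = (\<integral>\<^sup>+v. \<infinity> * indicator {0<..(1::real)} v \<partial>lborel)"
    by (subst nn_integral_cmult_indicator) (auto simp: ennreal_top_mult)
  also have "\<dots> \<le> (\<integral>\<^sup>+v. (\<integral>\<^sup>+g. ennreal (psi v g) \<partial>lborel) \<partial>lborel)"
    using inf by (intro nn_integral_mono) (auto simp: indicator_def)
  also have "\<dots> = Z"
    unfolding integ_def by (subst lborel.nn_integral_fst[symmetric]) auto
  finally show False using fin by (simp add: top_unique)
qed

text \<open>In terms of means: (N - 2) E v \<le> B + E (T u) and E (T u) \<le> q E v. Substituting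
  the second into the first and absorbing q E v gives both claims. The absorption is legitimate
  because E (T u) \<le> T is finite, and then so is E v by the first inequality.\<close>

lemma
  assumes fin: "Z < \<infinity>" and gap: "N - q - 2 > 0"
  shows mean_v: "ennreal (N - q - 2) * integ (\<lambda>v g. v) \<le> ennreal B * Z"
    and mean_shrinkage: "ennreal (N - q - 2) * integ (\<lambda>v g. T / (g + 1)) \<le> ennreal (q * B) * Z"
proof -
  note q = q_pos[OF fin]
  have 1: "ennreal (N - 2) * integ (\<lambda>v g. v) \<le> ennreal B * Z + integ (\<lambda>v g. T / (g + 1))"
  proof -
    have "integ (\<lambda>v g. (N - 2) * v) = ennreal (N - 2) * integ (\<lambda>v g. v)"
      using N by (intro integ_cmult) auto
    moreover have "integ (\<lambda>v g. B + T / (g + 1)) = integ (\<lambda>v g. B) + integ (\<lambda>v g. T / (g + 1))"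
      using B T by (intro integ_add) auto
    ultimately show ?thesis using moment_v B by (simp add: integ_const[of B])
  qed
  have 2: "integ (\<lambda>v g. T / (g + 1)) \<le> ennreal q * integ (\<lambda>v g. v)"
    using moment_shrinkage[OF q] q integ_cmult[of "\<lambda>v g. v" q] by simp
  have "integ (\<lambda>v g. T / (g + 1)) \<le> integ (\<lambda>v g. T)"
    unfolding integ_def
  proof (intro nn_integral_mono, clarify)
    fix v g :: real
    show "ennreal (T / (g + 1) * psi v g) \<le> ennreal (T * psi v g)"
    proof (cases "v > 0 \<and> g > 0")
      case True
      then show ?thesis by (intro ennreal_leI mult_right_mono psi_nonneg T_div_le) simp
    qed (auto simp: psi_def)
  qed
  also have "\<dots> < \<infinity>" using fin T by (simp add: integ_const[of T] ennreal_mult_less_top)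
  finally have U: "integ (\<lambda>v g. T / (g + 1)) < \<infinity>" .
  have "integ (\<lambda>v g. v) \<noteq> \<infinity>"
  proof
    assume "integ (\<lambda>v g. v) = \<infinity>"
    then show False using 1 U fin N
      by (auto simp: ennreal_mult_top top_unique ennreal_mult_eq_top_iff)
  qed
  with U fin obtain z u e where
    z: "Z = ennreal z" "z \<ge> 0" and u: "integ (\<lambda>v g. T / (g + 1)) = ennreal u" "u \<ge> 0"
    and e: "integ (\<lambda>v g. v) = ennreal e" "e \<ge> 0"
    by (cases "Z"; cases "integ (\<lambda>v g. T / (g + 1))"; cases "integ (\<lambda>v g. v)") auto
  have r1: "(N - 2) * e \<le> B * z + u"
    using 1 B N z u e by (simp add: ennreal_mult'[symmetric] ennreal_plus[symmetric] ennreal_le_iff del: ennreal_plus)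
  have r2: "u \<le> q * e"
    using 2 q u e by (simp add: ennreal_mult'[symmetric] ennreal_le_iff)
  have r3: "(N - q - 2) * e \<le> B * z" using r1 r2 by (simp add: algebra_simps)
  then show "ennreal (N - q - 2) * integ (\<lambda>v g. v) \<le> ennreal B * Z"
    using gap B z e by (simp add: ennreal_mult'[symmetric] ennreal_leI)
  have "(N - q - 2) * u \<le> (N - q - 2) * (q * e)" using r2 gap by (intro mult_left_mono) auto
  also have "\<dots> = q * ((N - q - 2) * e)" by simp
  also have "\<dots> \<le> q * (B * z)" using r3 q by (intro mult_left_mono) auto
  finally show "ennreal (N - q - 2) * integ (\<lambda>v g. T / (g + 1)) \<le> ennreal (q * B) * Z"
    using gap q B z u by (simp add: ennreal_mult'[symmetric] ennreal_leI mult.assoc)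
qed

text \<open>Dropping the nonnegative T u / v in \<open>moment_inverse_v\<close> gives E (1/v) \<le>
  N / B, which is inserted into the bound of \<open>moment_inverse_shrinkage\<close>.\<close>

lemma mean_inverse_shrinkage:
  assumes q: "q > 2"
  shows "ennreal (q - 2) * integ (\<lambda>v g. g + 1) \<le> ennreal (T * N / B + q) * Z"
proof -
  have "integ (\<lambda>v g. B * (1 / v)) \<le> integ (\<lambda>v g. (B + T / (g + 1)) / v)"
    unfolding integ_def
  proof (intro nn_integral_mono, clarify)
    fix v g :: real
    show "ennreal (B * (1 / v) * psi v g) \<le> ennreal ((B + T / (g + 1)) / v * psi v g)"
    proof (cases "v > 0 \<and> g > 0")
      case True
      then show ?thesis using T psi_nonneg[of v g]
        by (intro ennreal_leI mult_right_mono) (auto simp: divide_right_mono)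
    qed (auto simp: psi_def)
  qed
  also have "\<dots> \<le> ennreal N * Z" using moment_inverse_v N by (simp add: integ_const[of N])
  finally have 1: "ennreal B * integ (\<lambda>v g. 1 / v) \<le> ennreal N * Z"
    using B integ_cmult[of "\<lambda>v g. 1 / v" B] by simp
  have "integ (\<lambda>v g. T / v + q) = integ (\<lambda>v g. T * (1 / v)) + integ (\<lambda>v g. q)"
    using integ_add[of "\<lambda>v g. T * (1 / v)" "\<lambda>v g. q"] T q by simp
  also have "\<dots> = ennreal T * integ (\<lambda>v g. 1 / v) + ennreal q * Z"
    using T q integ_cmult[of "\<lambda>v g. 1 / v" T] by (simp add: integ_const[of q])
  finally have eq: "integ (\<lambda>v g. T / v + q) = ennreal T * integ (\<lambda>v g. 1 / v) + ennreal q * Z" .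
  have "ennreal T * integ (\<lambda>v g. 1 / v) = ennreal (T / B) * (ennreal B * integ (\<lambda>v g. 1 / v))"
    using B T by (simp add: mult.assoc[symmetric] ennreal_mult'[symmetric])
  also have "\<dots> \<le> ennreal (T / B) * (ennreal N * Z)" by (intro mult_left_mono 1) simp
  also have "\<dots> = ennreal (T * N / B) * Z"
    using B T N by (simp add: mult.assoc[symmetric] ennreal_mult'[symmetric])
  finally have "integ (\<lambda>v g. T / v + q) \<le> ennreal (T * N / B) * Z + ennreal q * Z"
    unfolding eq by (rule add_right_mono)
  also have "\<dots> = ennreal (T * N / B + q) * Z"
    using B T N q by (simp add: distrib_right)
  finally show ?thesis
    using moment_inverse_shrinkage[OF q] q integ_cmult[of "\<lambda>v g. g + 1" "q - 2"] by simp
qed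

end

subsection \<open>The posterior in coordinates\<close>

text \<open>\<open>bh\<close> and \<open>ga\<close> are the coordinates of the least squares
  estimate and of the prior mean; \<open>k0\<close> collects the factors of the joint density that
  depend on none of \<beta>, v, g.\<close>

locale g_prior_posterior = design n p X V L + variance_g N q B T
  for n p X V L N q B T +
  fixes bh ga :: "nat \<Rightarrow> real" and k0 :: real
  assumes k0: "k0 > 0" and T_eq: "T = qn (\<lambda>j. bh j - ga j)"
begin

text \<open>The joint density before \<beta> is integrated out, in the parameters of
  \<open>variance_g\<close>; \<open>q + 2 - real p\<close> stands for c.\<close>

definition kern :: "(nat \<Rightarrow> real) \<Rightarrow> real \<Rightarrow> real \<Rightarrow> real" where
  "kern x v g = (if 0 < v \<and> 0 < g
     then k0 * v powr (- (N + real p) / 2 - 1) * g powr (- real p / 2) * (g + 1) powr (- (q + 2 - real p) / 2)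
       * exp (- (qdist x bh + qdist x ga / g + B) / (2 * v))
     else 0)"

definition mu :: "real \<Rightarrow> nat \<Rightarrow> real" where
  "mu g j = (g * bh j + ga j) / (g + 1)"

abbreviation PVG :: "((nat \<Rightarrow> real) \<times> real \<times> real) measure" where
  "PVG \<equiv> P \<Otimes>\<^sub>M lborel \<Otimes>\<^sub>M lborel"

abbreviation event :: "((nat \<Rightarrow> real) \<Rightarrow> real \<Rightarrow> real \<Rightarrow> bool) \<Rightarrow> ((nat \<Rightarrow> real) \<times> real \<times> real) set" where
  "event R \<equiv> {(x, v, g). x \<in> space P \<and> R x v g}"

definition U :: "((nat \<Rightarrow> real) \<times> real \<times> real) measure" where
  "U = density PVG (\<lambda>(x, v, g). ennreal (kern x v g))"

definition Post :: "((nat \<Rightarrow> real) \<times> real \<times> real) measure" where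
  "Post = scale_measure (1 / emeasure U (space U)) U"

abbreviation noise :: "real \<Rightarrow> ((nat \<Rightarrow> real) \<times> real \<times> real) set" where
  "noise \<epsilon> \<equiv> event (\<lambda>x v g. \<exists>i<p. \<bar>x i - mu g i\<bar> > \<epsilon>)"

text \<open>A scalar identity applied to each fitted value and summed over the rows of the design;
  the remainder, free of x, sums to T u.\<close>

lemma complete_square:
  assumes g: "g > 0"
  shows "qdist x bh + qdist x ga / g =
    (g + 1) / g * qdist x (mu g) + T / (g + 1)"
proof -
  have lin_mu: "lin (mu g) i = (g * lin bh i + lin ga i) / (g + 1)" for i
    unfolding lin_def mu_def sum_distrib_left sum.distrib[symmetric] sum_divide_distrib
    by (intro sum.cong refl) (simp add: distrib_left mult_ac)
  have sq: "(A - b)\<^sup>2 + (A - d)\<^sup>2 / g = (g + 1) / g * (A - (g * b + d) / (g + 1))\<^sup>2 + (b - d)\<^sup>2 / (g + 1)" for A b d :: real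
  proof -
    have "A - (g * b + d) / (g + 1) = ((g + 1) * A - (g * b + d)) / (g + 1)"
      using g by (simp add: field_simps)
    moreover have "(g + 1) / g * (z / (g + 1))\<^sup>2 = z\<^sup>2 / (g * (g + 1))" for z
      using g by (simp add: power2_eq_square divide_simps)
    ultimately have rhs: "(g + 1) / g * (A - (g * b + d) / (g + 1))\<^sup>2 = ((g + 1) * A - (g * b + d))\<^sup>2 / (g * (g + 1))"
      by simp
    show ?thesis unfolding rhs using g by (simp add: divide_simps power2_eq_square) (simp add: algebra_simps)
  qed
  show ?thesis
    unfolding qn_def lin_diff lin_mu T_eq sum_divide_distrib sum_distrib_left sum.distrib[symmetric] sq ..
qed

text \<open>Given v and g, the coefficients are Gaussian around \<open>mu g\<close> with precision
  \<tau> times the Gram matrix. The factor \<tau>^(p/2) is the reciprocal of what the Gaussian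
  integral returns, so integration over x leaves a multiple of \<open>psi\<close>. Moreover \<tau>
  \<ge> 1/v for every g > 0.\<close>

lemma kern_eq:
  assumes v: "v > 0" and g: "g > 0"
  defines "\<tau> \<equiv> (g + 1) / (g * v)"
  shows "kern x v g = k0 * \<tau> powr (real p / 2) * psi v g * exp (- \<tau> * qdist x (mu g) / 2)"
proof -
  have t: "\<tau> powr (real p / 2) = (g + 1) powr (real p / 2) * g powr (- real p / 2) * v powr (- real p / 2)"
    using v g by (simp add: \<tau>_def powr_divide powr_mult powr_minus divide_simps)
  have e1: "v powr (- (N + real p) / 2 - 1) = v powr (- N / 2 - 1) * v powr (- real p / 2)"
    unfolding powr_add[symmetric] by (rule arg_cong[where f = "(powr) v"]) (simp add: field_simps)
  have e2: "(g + 1) powr (- (q + 2 - real p) / 2) = (g + 1) powr (- q / 2 - 1) * (g + 1) powr (real p / 2)"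
    unfolding powr_add[symmetric] by (rule arg_cong[where f = "(powr) (g + 1)"]) (simp add: field_simps)
  have e3: "exp (- (qdist x bh + qdist x ga / g + B) / (2 * v)) =
      exp (- (B + T / (g + 1)) / (2 * v)) * exp (- \<tau> * qdist x (mu g) / 2)"
    unfolding complete_square[OF g] mult_exp_exp using v g
    by (intro arg_cong[where f = exp]) (simp add: \<tau>_def divide_simps, simp add: algebra_simps)
  show ?thesis
    using v g unfolding kern_def e1 e2 e3 t psi_def by simp
qed

lemma measurable_qn_comp [measurable (raw)]:
  assumes "\<And>j. j < p \<Longrightarrow> (\<lambda>w. f w j) \<in> borel_measurable M"
  shows "(\<lambda>w. qn (f w)) \<in> borel_measurable M"
  unfolding qn_def lin_def using assms
  by (intro borel_measurable_sum borel_measurable_power borel_measurable_times borel_measurable_const) auto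

lemma measurable_kern [measurable]:
  "(\<lambda>(x, v, g). kern x v g) \<in> borel_measurable PVG"
  unfolding kern_def by measurable

lemma measurable_ennreal_kern [measurable]:
  "(\<lambda>(x, v, g). ennreal (kern x v g)) \<in> borel_measurable PVG"
  using measurable_compose[OF measurable_kern measurable_ennreal] by (simp add: case_prod_beta)

lemma space_U: "space U = space P \<times> UNIV" and sets_U: "sets U = sets PVG"
  by (simp_all add: U_def space_pair_measure)

lemma nn_integral_iterated:
  fixes f :: "(nat \<Rightarrow> real) \<times> real \<times> real \<Rightarrow> ennreal"
  assumes [measurable]: "f \<in> borel_measurable PVG"
  shows "(\<integral>\<^sup>+w. f w \<partial>PVG) =
    (\<integral>\<^sup>+(v, g). (\<integral>\<^sup>+x. f (x, v, g) \<partial>P) \<partial>VG)"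
proof -
  interpret product_sigma_finite "\<lambda>_::nat. lborel :: real measure" ..
  interpret finite_product_sigma_finite "\<lambda>_::nat. lborel :: real measure" "{..<p}" by standard auto
  interpret pair_sigma_finite P "lborel \<Otimes>\<^sub>M lborel :: (real \<times> real) measure" ..
  show ?thesis
    using nn_integral_snd[OF assms] unfolding case_prod_beta prod.collapse by (rule sym)
qed

lemma integral_kern:
  assumes "v > 0" "g > 0"
  shows "(\<integral>\<^sup>+x. ennreal (kern x v g) \<partial>P) = ennreal k0 * C * ennreal (psi v g)"
proof -
  define \<tau> where "\<tau> = (g + 1) / (g * v)"
  have \<tau>: "\<tau> > 0" using assms by (simp add: \<tau>_def)
  have "(\<integral>\<^sup>+x. ennreal (kern x v g) \<partial>P) =
      (\<integral>\<^sup>+x. ennreal (k0 * \<tau> powr (real p / 2) * psi v g) * ennreal (exp (- \<tau> * qdist x (mu g) / 2)) \<partial>P)"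
    using k0 psi_nonneg unfolding kern_eq[OF assms] \<tau>_def[symmetric] by (simp add: ennreal_mult')
  also have "\<dots> = ennreal (k0 * \<tau> powr (real p / 2) * psi v g) * (C * ennreal (\<tau> powr (- real p / 2)))"
    by (subst nn_integral_cmult, measurable) (simp only: gaussian_integral[OF \<tau>])
  also have "\<dots> = C * ennreal (k0 * psi v g * (\<tau> powr (real p / 2) * \<tau> powr (- real p / 2)))"
    using k0 psi_nonneg[of v g] by (simp add: ennreal_mult' mult_ac)
  also have "\<tau> powr (real p / 2) * \<tau> powr (- real p / 2) = 1"
    using \<tau> by (simp add: powr_add[symmetric])
  finally show ?thesis using k0 psi_nonneg by (simp add: ennreal_mult' mult_ac)
qed

text \<open>Reduces the mass of an event to a conditional bound given v and g, stated relative to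
  \<open>psi\<close> so that the moment lemmas apply.\<close>

lemma emeasure_U_le:
  assumes A: "A \<in> sets PVG" and [measurable]: "case_prod \<phi> \<in> borel_measurable VG"
    and le: "\<And>v g. v > 0 \<Longrightarrow> g > 0 \<Longrightarrow>
      (\<integral>\<^sup>+x. ennreal (kern x v g) * indicator A (x, v, g) \<partial>P) \<le> ennreal k0 * C * ennreal (\<phi> v g * psi v g)"
  shows "emeasure U A \<le> ennreal k0 * C * integ \<phi>"
proof -
  have "emeasure U A = (\<integral>\<^sup>+w. (case w of (x, v, g) \<Rightarrow> ennreal (kern x v g)) * indicator A w \<partial>PVG)"
    unfolding U_def by (rule emeasure_density[OF measurable_ennreal_kern A])
  also have "\<dots> = (\<integral>\<^sup>+(v, g). (\<integral>\<^sup>+x. ennreal (kern x v g) * indicator A (x, v, g) \<partial>P) \<partial>VG)"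
    using nn_integral_iterated[OF borel_measurable_times_ennreal[OF measurable_ennreal_kern borel_measurable_indicator[OF A]]]
    by (simp only: prod.case)
  also have "\<dots> \<le> (\<integral>\<^sup>+(v, g). ennreal k0 * C * ennreal (\<phi> v g * psi v g) \<partial>VG)"
  proof (intro nn_integral_mono, clarify)
    fix v g :: real
    show "(\<integral>\<^sup>+x. ennreal (kern x v g) * indicator A (x, v, g) \<partial>P) \<le> ennreal k0 * C * ennreal (\<phi> v g * psi v g)"
      using le[of v g] by (cases "v > 0 \<and> g > 0") (auto simp: kern_def)
  qed
  also have "\<dots> = ennreal k0 * C * integ \<phi>"
    unfolding integ_def by (subst nn_integral_cmult[symmetric]) (auto simp: case_prod_beta intro!: nn_integral_cong)
  finally show ?thesis .
qed

lemma g_event_sets: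
  assumes [measurable]: "Measurable.pred borel R"
  shows "event (\<lambda>x v g. R g) \<in> sets PVG"
proof -
  have "event (\<lambda>x v g. R g) = {w \<in> space PVG. R (snd (snd w))}"
    by (auto simp: space_pair_measure)
  also have "\<dots> \<in> sets PVG" by measurable
  finally show ?thesis .
qed

text \<open>Markov's inequality for an event that depends on g only.\<close>

lemma emeasure_U_g_event_le:
  assumes R: "Measurable.pred borel R" and [measurable]: "\<phi> \<in> borel_measurable borel"
    and le: "\<And>g. g > 0 \<Longrightarrow> R g \<Longrightarrow> 1 \<le> \<phi> g" and nonneg: "\<And>g. g > 0 \<Longrightarrow> 0 \<le> \<phi> g"
  shows "emeasure U (event (\<lambda>x v g. R g)) \<le> ennreal k0 * C * integ (\<lambda>v g. \<phi> g)"
proof (rule emeasure_U_le[OF g_event_sets[OF R]])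
  fix v g :: real assume vg: "v > 0" "g > 0"
  have "(\<integral>\<^sup>+x. ennreal (kern x v g) * indicator (event (\<lambda>x v g. R g)) (x, v, g) \<partial>P)
      \<le> (\<integral>\<^sup>+x. ennreal (of_bool (R g)) * ennreal (kern x v g) \<partial>P)"
    by (intro nn_integral_mono) (auto simp: indicator_def)
  also have "\<dots> = ennreal k0 * C * (ennreal (of_bool (R g)) * ennreal (psi v g))"
    using integral_kern[OF vg] by (cases "R g") auto
  also have "\<dots> \<le> ennreal k0 * C * ennreal (\<phi> g * psi v g)"
    using le[OF vg(2)] nonneg[OF vg(2)] mult_right_mono[of 1 "\<phi> g" "psi v g"] psi_nonneg[of v g]
    by (intro mult_left_mono) (auto simp: of_bool_def intro: ennreal_leI)
  finally show "(\<integral>\<^sup>+x. ennreal (kern x v g) * indicator (event (\<lambda>x v g. R g)) (x, v, g) \<partial>P)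
      \<le> ennreal k0 * C * ennreal (\<phi> g * psi v g)" .
qed measurable

lemma emeasure_U_space: "emeasure U (space U) = ennreal k0 * C * Z"
proof -
  have "emeasure U (space U) =
      (\<integral>\<^sup>+w. (case w of (x, v, g) \<Rightarrow> ennreal (kern x v g)) * indicator (space U) w \<partial>PVG)"
    unfolding U_def space_density by (rule emeasure_density[OF measurable_ennreal_kern sets.top])
  also have "\<dots> = (\<integral>\<^sup>+w. (case w of (x, v, g) \<Rightarrow> ennreal (kern x v g)) \<partial>PVG)"
    by (intro nn_integral_cong) (auto simp: space_U space_pair_measure indicator_def)
  also have "\<dots> = (\<integral>\<^sup>+(v, g). (\<integral>\<^sup>+x. ennreal (kern x v g) \<partial>P) \<partial>VG)"
    using nn_integral_iterated[OF measurable_ennreal_kern] by (simp only: prod.case)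
  also have "\<dots> = (\<integral>\<^sup>+(v, g). ennreal k0 * C * ennreal (1 * psi v g) \<partial>VG)"
  proof (intro nn_integral_cong, clarify)
    fix v g :: real
    show "(\<integral>\<^sup>+x. ennreal (kern x v g) \<partial>P) = ennreal k0 * C * ennreal (1 * psi v g)"
      using integral_kern[of v g] by (cases "v > 0 \<and> g > 0") (auto simp: psi_def kern_def)
  qed
  also have "\<dots> = ennreal k0 * C * Z"
    unfolding integ_def by (subst nn_integral_cmult[symmetric]) (auto simp: case_prod_beta intro!: nn_integral_cong)
  finally show ?thesis .
qed

lemma noise_sets:
  "noise \<epsilon> \<in> sets PVG"
proof -
  have "noise \<epsilon> =
      (\<Union>i\<in>{..<p}. {w \<in> space PVG. \<bar>fst w i - mu (snd (snd w)) i\<bar> > \<epsilon>})"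
    by (auto simp: space_pair_measure)
  also have "\<dots> \<in> sets PVG"
    unfolding mu_def by measurable
  finally show ?thesis .
qed

lemma emeasure_U_noise_le:
  assumes \<epsilon>: "\<epsilon> > 0"
  shows "emeasure U (noise \<epsilon>) \<le>
    ennreal k0 * C * integ (\<lambda>v g. 8 * L / \<epsilon>\<^sup>2 / sqrt n * v)" (is "emeasure U ?A \<le> _")
proof (rule emeasure_U_le[OF noise_sets])
  fix v g :: real assume vg: "v > 0" "g > 0"
  define \<tau> where "\<tau> = (g + 1) / (g * v)"
  have \<tau>: "\<tau> > 0" "\<tau> \<ge> 1 / v" using vg by (auto simp: \<tau>_def divide_simps)
  define E where "E = {x \<in> space P. \<exists>i<p. \<bar>x i - mu g i\<bar> > \<epsilon>}"
  have [measurable]: "E \<in> sets P"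
  proof -
    have "E = (\<Union>i\<in>{..<p}. {x \<in> space P. \<bar>x i - mu g i\<bar> > \<epsilon>})" by (auto simp: E_def)
    also have "\<dots> \<in> sets P" by measurable
    finally show ?thesis .
  qed
  define c where "c = k0 * \<tau> powr (real p / 2) * psi v g"
  have c: "c \<ge> 0" using k0 psi_nonneg by (simp add: c_def)
  have "(\<integral>\<^sup>+x. ennreal (kern x v g) * indicator ?A (x, v, g) \<partial>P) =
      (\<integral>\<^sup>+x. ennreal c * (indicator E x * ennreal (exp (- \<tau> * qdist x (mu g) / 2))) \<partial>P)"
    using vg c by (intro nn_integral_cong) (auto simp: kern_eq \<tau>_def[symmetric] c_def[symmetric] E_def indicator_def ennreal_mult')
  also have "\<dots> = ennreal c * (\<integral>\<^sup>+x. indicator E x * ennreal (exp (- \<tau> * qdist x (mu g) / 2)) \<partial>P)"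
    by (rule nn_integral_cmult) measurable
  also have "\<dots> \<le> ennreal c * (C * ennreal (\<tau> powr (- real p / 2)) * ennreal (8 * L / \<epsilon>\<^sup>2 * (v / sqrt n)))"
  proof (rule mult_left_mono)
    have "(\<integral>\<^sup>+x. indicator E x * ennreal (exp (- \<tau> * qdist x (mu g) / 2)) \<partial>P) \<le>
        (\<integral>\<^sup>+x. indicator {x. \<exists>i<p. \<bar>x i - mu g i\<bar> > \<epsilon>} x * ennreal (exp (- \<tau> * qdist x (mu g) / 2)) \<partial>P)"
      by (intro nn_integral_mono) (auto simp: E_def indicator_def)
    also have "\<dots> \<le> C * ennreal (\<tau> powr (- real p / 2)) * ennreal (8 * L / \<epsilon>\<^sup>2 * (v / sqrt n))"
      using vg \<tau> \<epsilon> by (intro gaussian_sup_tail) auto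
    finally show "(\<integral>\<^sup>+x. indicator E x * ennreal (exp (- \<tau> * qdist x (mu g) / 2)) \<partial>P) \<le>
        C * ennreal (\<tau> powr (- real p / 2)) * ennreal (8 * L / \<epsilon>\<^sup>2 * (v / sqrt n))" .
  qed simp
  also have "\<dots> = C * ennreal (c * \<tau> powr (- real p / 2) * (8 * L / \<epsilon>\<^sup>2 * (v / sqrt n)))"
  proof -
    have "ennreal c * (C * ennreal s * ennreal r) = C * ennreal (c * s * r)" if "s \<ge> 0" "r \<ge> 0" for s r
      using c that by (simp add: ennreal_mult mult_ac)
    then show ?thesis using vg L_pos by (metis (no_types, lifting) powr_ge_zero divide_nonneg_nonneg mult_nonneg_nonneg less_imp_le real_sqrt_ge_zero of_nat_0_le_iff zero_le_power2 zero_le_numeral)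
  qed
  also have "c * \<tau> powr (- real p / 2) = k0 * psi v g * (\<tau> powr (real p / 2) * \<tau> powr (- real p / 2))"
    by (simp add: c_def)
  also have "\<tau> powr (real p / 2) * \<tau> powr (- real p / 2) = 1"
    using \<tau> by (simp add: powr_add[symmetric])
  also have "C * ennreal (k0 * psi v g * 1 * (8 * L / \<epsilon>\<^sup>2 * (v / sqrt n))) =
      C * ennreal (k0 * (8 * L / \<epsilon>\<^sup>2 / sqrt n * v * psi v g))"
    by (simp add: mult_ac)
  also have "\<dots> = ennreal k0 * C * ennreal (8 * L / \<epsilon>\<^sup>2 / sqrt n * v * psi v g)"
    unfolding ennreal_mult'[OF less_imp_le[OF k0]] by (simp only: mult_ac)
  finally show "(\<integral>\<^sup>+x. ennreal (kern x v g) * indicator ?A (x, v, g) \<partial>P) \<le>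
      ennreal k0 * C * ennreal (8 * L / \<epsilon>\<^sup>2 / sqrt n * v * psi v g)" .
qed measurable

end

section \<open>Markov bounds for the normalized posterior\<close>

locale proper_g_prior_posterior = g_prior_posterior +
  assumes proper: "prob_space Post"
begin

text \<open>In \<open>ennreal\<close> a total mass W equal to 0 or to infinity gives (1 / W) * W =
  0, so a probability space excludes both.\<close>

lemma Z_finite: "Z < \<infinity>" and Z_nonzero: "Z \<noteq> 0"
proof -
  interpret prob_space Post by (rule proper)
  define W where "W = ennreal k0 * C * Z"
  have one: "(1 / W) * W = 1"
    using emeasure_space_1 unfolding Post_def
    by (simp add: emeasure_scale_measure emeasure_U_space W_def space_scale_measure)
  then have "W \<noteq> 0" by auto
  moreover have "W \<noteq> \<infinity>" using one by auto
  ultimately show "Z < \<infinity>" "Z \<noteq> 0"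
    using k0 C_nonzero by (auto simp: W_def less_top ennreal_mult_eq_top_iff)
qed

text \<open>The factor \<open>k0 * C\<close> occurs both in the mass of the event and in the total
  mass, hence cancels; what remains is a bound for the moment I / Z.\<close>

lemma prob_le:
  assumes A: "emeasure U A \<le> ennreal k0 * C * (ennreal r * I)"
    and I: "ennreal d * I \<le> ennreal m * Z" and pos: "d > 0" "m \<ge> 0" "r \<ge> 0"
  shows "measure Post A \<le> r * m / d"
proof -
  define W where "W = ennreal k0 * C * Z"
  have W: "W \<noteq> 0" "W \<noteq> \<infinity>"
    using Z_finite Z_nonzero k0 C_nonzero C_finite by (auto simp: W_def ennreal_mult_eq_top_iff)
  have "I = ennreal (1 / d) * (ennreal d * I)"
    using pos by (simp add: mult.assoc[symmetric] ennreal_mult'[symmetric])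
  also have "\<dots> \<le> ennreal (1 / d) * (ennreal m * Z)" by (intro mult_left_mono I) simp
  finally have "ennreal r * I \<le> ennreal r * (ennreal (1 / d) * (ennreal m * Z))" by (rule mult_left_mono) simp
  also have "\<dots> = ennreal (r * m / d) * Z"
    using pos by (simp add: mult.assoc[symmetric] ennreal_mult'[symmetric])
  finally have "ennreal k0 * C * (ennreal r * I) \<le> ennreal k0 * C * (ennreal (r * m / d) * Z)"
    by (rule mult_left_mono) simp
  also have "\<dots> = W * ennreal (r * m / d)" by (simp add: W_def mult_ac)
  finally have "ennreal k0 * C * (ennreal r * I) \<le> W * ennreal (r * m / d)" .
  with A have "emeasure U A \<le> W * ennreal (r * m / d)" by (rule order_trans)
  then have "(1 / W) * emeasure U A \<le> (1 / W) * (W * ennreal (r * m / d))" by (rule mult_left_mono) simp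
  also have "\<dots> = ennreal (r * m / d)"
  proof -
    obtain w where w: "W = ennreal w" "w > 0"
      using W by (cases W) (auto simp: less_le)
    then have "1 / W = ennreal (1 / w)" using divide_ennreal[of 1 w] by simp
    with w show ?thesis by (simp add: mult.assoc[symmetric] ennreal_mult'[symmetric])
  qed
  finally have "emeasure Post A \<le> ennreal (r * m / d)"
    unfolding Post_def emeasure_U_space W_def[symmetric] by (simp add: emeasure_scale_measure)
  then show ?thesis
    unfolding measure_def using pos by (intro enn2real_leI) auto
qed

lemma prob_shrinkage_gt:
  assumes gap: "N - q - 2 > 0" and \<kappa>: "\<kappa> > 0"
  shows "measure Post (event (\<lambda>x v g. T / (g + 1) > \<kappa>)) \<le> (1 / \<kappa>) * (q * B) / (N - q - 2)"
proof (rule prob_le)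
  have "emeasure U (event (\<lambda>x v g. T / (g + 1) > \<kappa>)) \<le> ennreal k0 * C * integ (\<lambda>v g. (1 / \<kappa>) * (T / (g + 1)))"
  proof (rule emeasure_U_g_event_le)
    show "0 \<le> (1 / \<kappa>) * (T / (g + 1))" if "g > 0" for g
      using that T \<kappa> by simp
    show "1 \<le> (1 / \<kappa>) * (T / (g + 1))" if "T / (g + 1) > \<kappa>" for g
      using mult_left_mono[OF less_imp_le[OF that], of "1 / \<kappa>"] \<kappa> by simp
  qed measurable
  also have "integ (\<lambda>v g. (1 / \<kappa>) * (T / (g + 1))) = ennreal (1 / \<kappa>) * integ (\<lambda>v g. T / (g + 1))"
    by (rule integ_cmult) (use \<kappa> in auto)
  finally show "emeasure U (event (\<lambda>x v g. T / (g + 1) > \<kappa>)) \<le> ennreal k0 * C * (ennreal (1 / \<kappa>) * integ (\<lambda>v g. T / (g + 1)))" .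
  show "ennreal (N - q - 2) * integ (\<lambda>v g. T / (g + 1)) \<le> ennreal (q * B) * Z"
    by (rule mean_shrinkage[OF Z_finite gap])
qed (use \<kappa> gap B q_pos[OF Z_finite] in auto)

lemma prob_noise_gt:
  assumes gap: "N - q - 2 > 0" and \<epsilon>: "\<epsilon> > 0"
  shows "measure Post (noise \<epsilon>) \<le> 8 * L / \<epsilon>\<^sup>2 / sqrt n * B / (N - q - 2)"
proof (rule prob_le)
  have "integ (\<lambda>v g. 8 * L / \<epsilon>\<^sup>2 / sqrt n * v) = ennreal (8 * L / \<epsilon>\<^sup>2 / sqrt n) * integ (\<lambda>v g. v)"
    by (rule integ_cmult) (use L_pos in auto)
  then show "emeasure U (noise \<epsilon>)
      \<le> ennreal k0 * C * (ennreal (8 * L / \<epsilon>\<^sup>2 / sqrt n) * integ (\<lambda>v g. v))"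
    using emeasure_U_noise_le[OF \<epsilon>] by simp
  show "ennreal (N - q - 2) * integ (\<lambda>v g. v) \<le> ennreal B * Z"
    by (rule mean_v[OF Z_finite gap])
qed (use gap B L_pos in auto)

lemma prob_shrinkage_less:
  assumes q: "q > 2" and \<kappa>: "\<kappa> > 0"
  shows "measure Post (event (\<lambda>x v g. 1 / (g + 1) < \<kappa>)) \<le> \<kappa> * (T * N / B + q) / (q - 2)"
proof (rule prob_le)
  have "emeasure U (event (\<lambda>x v g. 1 / (g + 1) < \<kappa>)) \<le> ennreal k0 * C * integ (\<lambda>v g. \<kappa> * (g + 1))"
    by (rule emeasure_U_g_event_le) (use \<kappa> in \<open>auto simp: field_simps\<close>)
  also have "integ (\<lambda>v g. \<kappa> * (g + 1)) = ennreal \<kappa> * integ (\<lambda>v g. g + 1)"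
    by (rule integ_cmult) (use \<kappa> in auto)
  finally show "emeasure U (event (\<lambda>x v g. 1 / (g + 1) < \<kappa>)) \<le> ennreal k0 * C * (ennreal \<kappa> * integ (\<lambda>v g. g + 1))" .
  show "ennreal (q - 2) * integ (\<lambda>v g. g + 1) \<le> ennreal (T * N / B + q) * Z"
    by (rule mean_inverse_shrinkage[OF q])
qed (use \<kappa> q T N B in auto)

end

subsection \<open>Gaussian errors\<close>

lemma nn_integral_normal_density:
  "\<sigma> > 0 \<Longrightarrow> (\<integral>\<^sup>+x. ennreal (normal_density \<mu> \<sigma> x) \<partial>lborel) = 1"
  by (subst nn_integral_eq_integral) auto

text \<open>Each function integrated below turns the centred normal density into a multiple of
  another normal density, so its expectation is that multiple.\<close>

lemma nn_integral_normal_density_mult: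
  assumes "\<tau> > 0" "k \<ge> 0" "\<And>x. normal_density 0 \<sigma> x * f x = k * normal_density m \<tau> x" "\<And>x. f x \<ge> 0"
  shows "(\<integral>\<^sup>+x. ennreal (normal_density 0 \<sigma> x) * ennreal (f x) \<partial>lborel) = ennreal k"
proof -
  have "(\<integral>\<^sup>+x. ennreal (normal_density 0 \<sigma> x) * ennreal (f x) \<partial>lborel) =
      (\<integral>\<^sup>+x. ennreal k * ennreal (normal_density m \<tau> x) \<partial>lborel)"
    using assms by (intro nn_integral_cong) (simp add: ennreal_mult'[symmetric])
  also have "\<dots> = ennreal k"
    using nn_integral_normal_density[OF assms(1)] by (subst nn_integral_cmult) auto
  finally show ?thesis .
qed

lemma normal_mgf:
  assumes "\<sigma> > 0"
  shows "(\<integral>\<^sup>+x. ennreal (normal_density 0 \<sigma> x) * ennreal (exp (w * x)) \<partial>lborel) = ennreal (exp (\<sigma>\<^sup>2 * w\<^sup>2 / 2))"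
proof (rule nn_integral_normal_density_mult)
  fix x
  have "- x\<^sup>2 / (2 * \<sigma>\<^sup>2) + w * x = \<sigma>\<^sup>2 * w\<^sup>2 / 2 - (x - w * \<sigma>\<^sup>2)\<^sup>2 / (2 * \<sigma>\<^sup>2)"
    using assms by (simp add: divide_simps) (simp add: algebra_simps power2_eq_square)
  then show "normal_density 0 \<sigma> x * exp (w * x) = exp (\<sigma>\<^sup>2 * w\<^sup>2 / 2) * normal_density (w * \<sigma>\<^sup>2) \<sigma> x"
    by (simp add: normal_density_def mult_exp_exp)
qed (use assms in auto)

text \<open>The rate 1/(4 \<sigma>^2) is half the critical rate 1/(2 \<sigma>^2), so the tilted
  variance is 2 \<sigma>^2 and the factor is sqrt 2.\<close>

lemma normal_square_mgf:
  assumes "\<sigma> > 0"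
  shows "(\<integral>\<^sup>+x. ennreal (normal_density 0 \<sigma> x) * ennreal (exp (x\<^sup>2 / (4 * \<sigma>\<^sup>2))) \<partial>lborel) = ennreal (sqrt 2)"
proof (rule nn_integral_normal_density_mult)
  fix x
  have s2: "(sqrt 2 * \<sigma>)\<^sup>2 = 2 * \<sigma>\<^sup>2" by (simp add: power_mult_distrib)
  have "- x\<^sup>2 / (2 * \<sigma>\<^sup>2) + x\<^sup>2 / (4 * \<sigma>\<^sup>2) = - x\<^sup>2 / (2 * (2 * \<sigma>\<^sup>2))"
    using assms by (simp add: divide_simps)
  then have e: "exp (- x\<^sup>2 / (2 * \<sigma>\<^sup>2)) * exp (x\<^sup>2 / (4 * \<sigma>\<^sup>2)) = exp (- x\<^sup>2 / (2 * (2 * \<sigma>\<^sup>2)))"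
    by (simp only: mult_exp_exp)
  have "sqrt (2 * pi * (2 * \<sigma>\<^sup>2)) = sqrt 2 * sqrt (2 * pi * \<sigma>\<^sup>2)"
    unfolding real_sqrt_mult[symmetric] by (simp add: mult_ac)
  then show "normal_density 0 \<sigma> x * exp (x\<^sup>2 / (4 * \<sigma>\<^sup>2)) = sqrt 2 * normal_density 0 (sqrt 2 * \<sigma>) x"
    unfolding normal_density_def s2 using e by (simp add: mult_ac)
qed (use assms in auto)

text \<open>One coordinate of the inner integral over the errors in \<open>resid_mgf\<close>:
  multiplying two Gaussians of equal variance halves the variance.\<close>

lemma normal_residual_mgf:
  assumes "\<sigma> > 0"
  shows "(\<integral>\<^sup>+x. ennreal (normal_density 0 \<sigma> x) * ennreal (exp (- (x - m)\<^sup>2 / (2 * \<sigma>\<^sup>2))) \<partial>lborel) =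
    ennreal (1 / sqrt 2 * exp (- m\<^sup>2 / (4 * \<sigma>\<^sup>2)))"
proof (rule nn_integral_normal_density_mult)
  fix x
  have "- x\<^sup>2 / (2 * \<sigma>\<^sup>2) + - (x - m)\<^sup>2 / (2 * \<sigma>\<^sup>2) = - m\<^sup>2 / (4 * \<sigma>\<^sup>2) + - (x - m / 2)\<^sup>2 / (2 * (\<sigma> / sqrt 2)\<^sup>2)"
    using assms by (simp add: power_divide divide_simps) (simp add: algebra_simps power2_eq_square)
  then have e: "exp (- x\<^sup>2 / (2 * \<sigma>\<^sup>2)) * exp (- (x - m)\<^sup>2 / (2 * \<sigma>\<^sup>2)) =
      exp (- m\<^sup>2 / (4 * \<sigma>\<^sup>2)) * exp (- (x - m / 2)\<^sup>2 / (2 * (\<sigma> / sqrt 2)\<^sup>2))"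
    by (simp only: mult_exp_exp)
  have "sqrt (2 * pi * \<sigma>\<^sup>2) = sqrt 2 * sqrt (2 * pi * (\<sigma> / sqrt 2)\<^sup>2)"
    unfolding real_sqrt_mult[symmetric] using assms by (simp add: power_divide)
  then show "normal_density 0 \<sigma> x * exp (- (x - m)\<^sup>2 / (2 * \<sigma>\<^sup>2)) =
      1 / sqrt 2 * exp (- m\<^sup>2 / (4 * \<sigma>\<^sup>2)) * normal_density (m / 2) (\<sigma> / sqrt 2) x"
    unfolding normal_density_def using e by (simp add: mult_ac)
qed (use assms in auto)

text \<open>Independence is encoded as a product density on the product space, so expectations of
  products factor by Fubini.\<close>

definition iid_normal :: "'w measure \<Rightarrow> nat \<Rightarrow> real \<Rightarrow> ('w \<Rightarrow> nat \<Rightarrow> real) \<Rightarrow> bool" where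
  "iid_normal M n \<sigma> x \<longleftrightarrow>
     distributed M (\<Pi>\<^sub>M i\<in>{..<n}. lborel) x (\<lambda>z. \<Prod>i<n. ennreal (normal_density 0 \<sigma> (z i)))"

lemma iid_normal_measurable:
  "iid_normal M n \<sigma> x \<Longrightarrow> x \<in> measurable M (\<Pi>\<^sub>M i\<in>{..<n}. lborel)"
  unfolding iid_normal_def by (rule distributed_measurable)

lemma iid_normal_component_measurable:
  assumes "iid_normal M n \<sigma> x" "i < n"
  shows "(\<lambda>\<omega>. x \<omega> i) \<in> borel_measurable M"
  using measurable_compose[OF iid_normal_measurable[OF assms(1)] measurable_component_singleton[of i "{..<n}"]] assms(2)
  by simp

lemma iid_normal_nn_integral:
  assumes "iid_normal M n \<sigma> x" and h: "h \<in> borel_measurable (\<Pi>\<^sub>M i\<in>{..<n}. lborel)"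
  shows "(\<integral>\<^sup>+\<omega>. h (x \<omega>) \<partial>M) = (\<integral>\<^sup>+z. (\<Prod>i<n. ennreal (normal_density 0 \<sigma> (z i))) * h z \<partial>(\<Pi>\<^sub>M i\<in>{..<n}. lborel))"
  using distributed_nn_integral[OF assms(1)[unfolded iid_normal_def] h] by simp

lemma nn_integral_normal_prod:
  fixes n :: nat and f :: "nat \<Rightarrow> real \<Rightarrow> real"
  assumes [measurable]: "\<And>i. i < n \<Longrightarrow> f i \<in> borel_measurable borel"
  shows "(\<integral>\<^sup>+z. (\<Prod>i<n. ennreal (normal_density 0 \<sigma> (z i))) * (\<Prod>i<n. ennreal (f i (z i))) \<partial>(\<Pi>\<^sub>M i\<in>{..<n}. lborel)) =
    (\<Prod>i<n. \<integral>\<^sup>+x. ennreal (normal_density 0 \<sigma> x) * ennreal (f i x) \<partial>lborel)"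
proof -
  interpret product_sigma_finite "\<lambda>_::nat. lborel :: real measure" ..
  show ?thesis
    unfolding prod.distrib[symmetric]
    using product_nn_integral_prod[of "{..<n}" "\<lambda>i x. ennreal (normal_density 0 \<sigma> x) * ennreal (f i x)"] by simp
qed

lemma ennreal_exp_sum: "ennreal (exp (\<Sum>i<n. f i)) = (\<Prod>i<(n::nat). ennreal (exp (f i)))"
  by (simp add: exp_sum prod_ennreal)

lemma iid_normal_linear_mgf:
  assumes x: "iid_normal M n \<sigma> x" and \<sigma>: "\<sigma> > 0"
  shows "(\<integral>\<^sup>+\<omega>. ennreal (exp (\<Sum>i<n. w i * x \<omega> i)) \<partial>M) = ennreal (exp (\<sigma>\<^sup>2 * (\<Sum>i<n. (w i)\<^sup>2) / 2))"
proof -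
  have "(\<integral>\<^sup>+\<omega>. ennreal (exp (\<Sum>i<n. w i * x \<omega> i)) \<partial>M) =
      (\<integral>\<^sup>+z. (\<Prod>i<n. ennreal (normal_density 0 \<sigma> (z i))) * (\<Prod>i<n. ennreal (exp (w i * z i))) \<partial>(\<Pi>\<^sub>M i\<in>{..<n}. lborel))"
    unfolding ennreal_exp_sum by (rule iid_normal_nn_integral[OF x]) measurable
  also have "\<dots> = (\<Prod>i<n. ennreal (exp (\<sigma>\<^sup>2 * (w i)\<^sup>2 / 2)))"
    by (subst nn_integral_normal_prod) (auto simp: normal_mgf[OF \<sigma>])
  also have "\<dots> = ennreal (exp (\<sigma>\<^sup>2 * (\<Sum>i<n. (w i)\<^sup>2) / 2))"
    by (simp add: ennreal_exp_sum[symmetric] sum_distrib_left sum_divide_distrib)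
  finally show ?thesis .
qed

lemma iid_normal_square_mgf:
  assumes x: "iid_normal M n \<sigma> x" and \<sigma>: "\<sigma> > 0"
  shows "(\<integral>\<^sup>+\<omega>. ennreal (exp (\<Sum>i<n. (x \<omega> i)\<^sup>2 / (4 * \<sigma>\<^sup>2))) \<partial>M) = ennreal (sqrt 2 ^ n)"
proof -
  have "(\<integral>\<^sup>+\<omega>. ennreal (exp (\<Sum>i<n. (x \<omega> i)\<^sup>2 / (4 * \<sigma>\<^sup>2))) \<partial>M) =
      (\<integral>\<^sup>+z. (\<Prod>i<n. ennreal (normal_density 0 \<sigma> (z i))) * (\<Prod>i<n. ennreal (exp ((z i)\<^sup>2 / (4 * \<sigma>\<^sup>2)))) \<partial>(\<Pi>\<^sub>M i\<in>{..<n}. lborel))"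
    unfolding ennreal_exp_sum by (rule iid_normal_nn_integral[OF x]) measurable
  also have "\<dots> = (\<Prod>i<n. ennreal (sqrt 2))"
    by (subst nn_integral_normal_prod) (auto simp: normal_square_mgf[OF \<sigma>])
  finally show ?thesis by (simp add: ennreal_power)
qed

section \<open>Least squares and the Laplace transform of the residual sum of squares\<close>

context design
begin

definition beta_hat :: "(nat \<Rightarrow> real) \<Rightarrow> nat \<Rightarrow> real" where
  "beta_hat y j = (\<Sum>k<p. V j k * (\<Sum>l<n. X l k * y l))"

definition resid :: "(nat \<Rightarrow> real) \<Rightarrow> real" where
  "resid y = (\<Sum>i<n. (y i - lin (beta_hat y) i)\<^sup>2)"

lemma normal_equations:
  assumes "i < p"
  shows "(\<Sum>l<n. X l i * lin (beta_hat y) l) = (\<Sum>l<n. X l i * y l)"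
proof -
  define w where "w k = (\<Sum>l<n. X l k * y l)" for k
  have "(\<Sum>l<n. X l i * lin (beta_hat y) l) = (\<Sum>l<n. \<Sum>j<p. \<Sum>k<p. X l i * X l j * V j k * w k)"
    unfolding lin_def beta_hat_def w_def[symmetric] by (simp add: sum_distrib_left mult_ac)
  also have "\<dots> = (\<Sum>j<p. \<Sum>l<n. \<Sum>k<p. X l i * X l j * V j k * w k)" by (rule sum.swap)
  also have "\<dots> = (\<Sum>j<p. \<Sum>k<p. \<Sum>l<n. X l i * X l j * V j k * w k)"
    by (rule sum.cong[OF refl], rule sum.swap)
  also have "\<dots> = (\<Sum>k<p. \<Sum>j<p. \<Sum>l<n. X l i * X l j * V j k * w k)" by (rule sum.swap)
  also have "\<dots> = (\<Sum>k<p. (\<Sum>j<p. (\<Sum>l<n. X l i * X l j) * V j k) * w k)"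
    by (simp add: sum_distrib_right)
  also have "\<dots> = (\<Sum>k<p. if i = k then w k else 0)"
    using assms by (intro sum.cong) (auto simp: gram_inv)
  finally show ?thesis using assms by (simp add: w_def)
qed

lemma inner_lin_resid: "(\<Sum>l<n. lin z l * (y l - lin (beta_hat y) l)) = 0"
proof -
  have "(\<Sum>l<n. lin z l * (y l - lin (beta_hat y) l)) = (\<Sum>l<n. \<Sum>i<p. z i * (X l i * y l - X l i * lin (beta_hat y) l))"
    unfolding lin_def[of z] sum_distrib_right by (intro sum.cong refl) (simp add: algebra_simps)
  also have "\<dots> = (\<Sum>i<p. z i * ((\<Sum>l<n. X l i * y l) - (\<Sum>l<n. X l i * lin (beta_hat y) l)))"
    by (subst sum.swap) (simp add: sum_distrib_left sum_subtractf[symmetric])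
  also have "\<dots> = 0" by (simp add: normal_equations)
  finally show ?thesis .
qed

text \<open>The residual vector is orthogonal to the column space by \<open>inner_lin_resid\<close>,
  which removes the cross term.\<close>

lemma pythagoras: "(\<Sum>i<n. (y i - lin z i)\<^sup>2) = resid y + qn (\<lambda>j. z j - beta_hat y j)"
proof -
  have "(y i - lin z i)\<^sup>2 = (y i - lin (beta_hat y) i)\<^sup>2 + (lin (\<lambda>j. z j - beta_hat y j) i)\<^sup>2
      - 2 * (lin (\<lambda>j. z j - beta_hat y j) i * (y i - lin (beta_hat y) i))" for i
    by (simp add: lin_diff power2_eq_square algebra_simps)
  then show ?thesis
    using inner_lin_resid[of "\<lambda>j. z j - beta_hat y j" y]
    by (simp add: resid_def qn_def sum.distrib sum_subtractf sum_distrib_left[symmetric])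
qed

lemma measurable_resid [measurable]: "resid \<in> borel_measurable (\<Pi>\<^sub>M i\<in>{..<n}. lborel)"
  unfolding resid_def[abs_def] lin_def beta_hat_def by measurable

text \<open>Integrating \<open>exp (- \<parallel>e - X z\<parallel>\<^sup>2 / (2 \<sigma>\<^sup>2))\<close> over z first gives a multiple of the left-hand
  integrand, by the Pythagorean identity; over e first it leaves a Gaussian integral in z.\<close>

lemma resid_mgf:
  assumes x: "iid_normal M n \<sigma> x" and \<sigma>: "\<sigma> > 0"
  shows "(\<integral>\<^sup>+\<omega>. ennreal (exp (- resid (x \<omega>) / (2 * \<sigma>\<^sup>2))) \<partial>M) = ennreal (2 powr (- (real n - real p) / 2))"
    (is "?I = _")
proof -
  let ?Pn = "\<Pi>\<^sub>M i\<in>{..<n}. lborel :: real measure"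
  let ?\<phi> = "\<lambda>e. \<Prod>i<n. ennreal (normal_density 0 \<sigma> (e i))"
  let ?K = "\<lambda>e z. ennreal (exp (- (\<Sum>i<n. (e i - lin z i)\<^sup>2) / (2 * \<sigma>\<^sup>2)))"
  interpret product_sigma_finite "\<lambda>_::nat. lborel :: real measure" ..
  interpret p: finite_product_sigma_finite "\<lambda>_::nat. lborel :: real measure" "{..<p}" by standard auto
  interpret n: finite_product_sigma_finite "\<lambda>_::nat. lborel :: real measure" "{..<n}" by standard auto
  interpret pair_sigma_finite P ?Pn ..
  define \<tau> where "\<tau> = 1 / \<sigma>\<^sup>2"
  have \<tau>: "\<tau> > 0" "\<tau> / 2 > 0" using \<sigma> by (auto simp: \<tau>_def)
  have inner_z: "(\<integral>\<^sup>+z. ?K e z \<partial>P) = ennreal (exp (- resid e / (2 * \<sigma>\<^sup>2))) * (C * ennreal (\<tau> powr (- real p / 2)))" for e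
  proof -
    have "?K e z = ennreal (exp (- resid e / (2 * \<sigma>\<^sup>2))) * ennreal (exp (- \<tau> * qn (\<lambda>j. z j - beta_hat e j) / 2))" for z
      unfolding pythagoras by (simp add: ennreal_mult'[symmetric] mult_exp_exp \<tau>_def add_divide_distrib diff_divide_distrib)
    then show ?thesis
      using gaussian_integral[OF \<tau>(1), of "beta_hat e"] by (simp add: nn_integral_cmult)
  qed
  have inner_e: "(\<integral>\<^sup>+e. ?\<phi> e * ?K e z \<partial>?Pn) = ennreal ((1 / sqrt 2) ^ n) * ennreal (exp (- (\<tau> / 2) * qn (\<lambda>j. z j - 0) / 2))" for z
  proof -
    have "?K e z = (\<Prod>i<n. ennreal (exp (- (e i - lin z i)\<^sup>2 / (2 * \<sigma>\<^sup>2))))" for e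
      by (simp add: ennreal_exp_sum[symmetric] sum_negf sum_divide_distrib)
    then have "(\<integral>\<^sup>+e. ?\<phi> e * ?K e z \<partial>?Pn) = (\<Prod>i<n. ennreal (1 / sqrt 2 * exp (- (lin z i)\<^sup>2 / (4 * \<sigma>\<^sup>2))))"
      by (simp only:) (subst nn_integral_normal_prod, measurable, simp only: normal_residual_mgf[OF \<sigma>])
    also have "\<dots> = ennreal (\<Prod>i<n. 1 / sqrt 2 * exp (- (lin z i)\<^sup>2 / (4 * \<sigma>\<^sup>2)))"
      by (rule prod_ennreal) simp
    also have "(\<Prod>i<n. 1 / sqrt 2 * exp (- (lin z i)\<^sup>2 / (4 * \<sigma>\<^sup>2))) = (1 / sqrt 2) ^ n * exp (- (\<tau> / 2) * qn (\<lambda>j. z j - 0) / 2)"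
      unfolding prod.distrib by (simp add: exp_sum[symmetric] qn_def \<tau>_def sum_negf sum_divide_distrib sum_distrib_left)
    finally show ?thesis by (simp add: ennreal_mult')
  qed
  have mK: "(\<lambda>(z, e). ?\<phi> e * ?K e z) \<in> borel_measurable (P \<Otimes>\<^sub>M ?Pn)"
    unfolding lin_def by measurable
  have "?I * (C * ennreal (\<tau> powr (- real p / 2))) =
      (\<integral>\<^sup>+e. ?\<phi> e * ennreal (exp (- resid e / (2 * \<sigma>\<^sup>2))) \<partial>?Pn) * (C * ennreal (\<tau> powr (- real p / 2)))"
    by (subst iid_normal_nn_integral[OF x]) auto
  also have "\<dots> = (\<integral>\<^sup>+e. ?\<phi> e * (\<integral>\<^sup>+z. ?K e z \<partial>P) \<partial>?Pn)"
    unfolding inner_z by (subst nn_integral_multc[symmetric]) (auto simp: mult.assoc)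
  also have "\<dots> = (\<integral>\<^sup>+e. (\<integral>\<^sup>+z. ?\<phi> e * ?K e z \<partial>P) \<partial>?Pn)"
    unfolding lin_def by (intro nn_integral_cong nn_integral_cmult[symmetric]) measurable
  also have "\<dots> = (\<integral>\<^sup>+z. (\<integral>\<^sup>+e. ?\<phi> e * ?K e z \<partial>?Pn) \<partial>P)"
    by (rule Fubini'[OF mK])
  also have "\<dots> = ennreal ((1 / sqrt 2) ^ n) * (C * ennreal ((\<tau> / 2) powr (- real p / 2)))"
    unfolding inner_e gaussian_integral[OF \<tau>(2), of "\<lambda>_. 0", symmetric] by (rule nn_integral_cmult) measurable
  finally have eq: "?I * (C * ennreal (\<tau> powr (- real p / 2))) = ennreal ((1 / sqrt 2) ^ n) * (C * ennreal ((\<tau> / 2) powr (- real p / 2)))" .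
  \<comment> \<open>The n error coordinates contribute 2^(-n/2), and the halved precision in z gives
    back 2^(p/2). The result is the Laplace transform at 1/2 of a chi-square law with n - p degrees
    of freedom.\<close>
  have "(1 / sqrt 2) ^ n = 2 powr (- real n / 2)"
  proof -
    have "1 / sqrt 2 = 2 powr (- (1 / 2))"
      unfolding powr_minus_divide by (simp add: powr_half_sqrt)
    then have "(1 / sqrt 2) ^ n = (2 powr (- (1 / 2))) powr real n" by (simp add: powr_realpow)
    then show ?thesis by (simp add: powr_powr)
  qed
  moreover have "(\<tau> / 2) powr (- real p / 2) = \<tau> powr (- real p / 2) * 2 powr (real p / 2)"
    using \<tau> by (simp add: powr_divide powr_minus divide_simps)
  moreover have "2 powr (- real n / 2) * 2 powr (real p / 2) = (2::real) powr (- (real n - real p) / 2)"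
    unfolding powr_add[symmetric] by (rule arg_cong[where f = "(powr) 2"]) (simp add: field_simps)
  ultimately have r: "(1 / sqrt 2) ^ n * (\<tau> / 2) powr (- real p / 2) = 2 powr (- (real n - real p) / 2) * \<tau> powr (- real p / 2)"
    by simp
  have "ennreal ((1 / sqrt 2) ^ n) * (C * ennreal ((\<tau> / 2) powr (- real p / 2))) =
      C * ennreal ((1 / sqrt 2) ^ n * (\<tau> / 2) powr (- real p / 2))"
    by (subst ennreal_mult) (simp_all add: mult_ac)
  also have "\<dots> = ennreal (2 powr (- (real n - real p) / 2)) * (C * ennreal (\<tau> powr (- real p / 2)))"
    unfolding r by (subst ennreal_mult) (simp_all add: mult_ac)
  finally have "ennreal ((1 / sqrt 2) ^ n) * (C * ennreal ((\<tau> / 2) powr (- real p / 2))) =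
      ennreal (2 powr (- (real n - real p) / 2)) * (C * ennreal (\<tau> powr (- real p / 2)))" .
  with eq have "?I * (C * ennreal (\<tau> powr (- real p / 2))) = ennreal (2 powr (- (real n - real p) / 2)) * (C * ennreal (\<tau> powr (- real p / 2)))"
    by simp
  moreover have "C * ennreal (\<tau> powr (- real p / 2)) \<noteq> 0" "C * ennreal (\<tau> powr (- real p / 2)) \<noteq> \<top>"
    using C_nonzero C_finite \<tau> by (auto simp: ennreal_mult_eq_top_iff)
  ultimately show ?thesis by (metis ennreal_mult_cancel_left mult.commute)
qed

end

text \<open>Markov's inequality and the first Borel-Cantelli lemma, which imposes nothing on the
  joint law of the \<open>f n\<close>.\<close>

lemma AE_eventually_less:
  fixes f :: "nat \<Rightarrow> 'w \<Rightarrow> real"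
  assumes f: "\<And>n. n \<ge> 1 \<Longrightarrow> f n \<in> borel_measurable M"
    and le: "\<And>n. n \<ge> 1 \<Longrightarrow> (\<integral>\<^sup>+\<omega>. ennreal (f n \<omega>) \<partial>M) \<le> ennreal (K n)"
    and pos: "\<And>n. t n > 0" "\<And>n. K n \<ge> 0"
    and sum: "summable (\<lambda>n. K n / t n)"
  shows "AE \<omega> in M. \<forall>\<^sub>F n in sequentially. f n \<omega> < t n"
proof -
  \<comment> \<open>At index 0 neither measurability nor a bound is available, so the exceptional
    set is taken to be empty there.\<close>
  define A where "A n = (if n \<ge> 1 then {\<omega> \<in> space M. t n \<le> f n \<omega>} else {})" for n
  have A: "A n \<in> sets M" for n
    unfolding A_def using f[of n] by (cases "n \<ge> 1") auto
  have em: "emeasure M (A n) \<le> ennreal (K n / t n)" for n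
  proof (cases "n \<ge> 1")
    case True
    have "emeasure M (A n) = (\<integral>\<^sup>+\<omega>. indicator (A n) \<omega> \<partial>M)" using A by simp
    also have "\<dots> \<le> (\<integral>\<^sup>+\<omega>. ennreal (1 / t n) * ennreal (f n \<omega>) \<partial>M)"
    proof (rule nn_integral_mono)
      fix \<omega>
      show "indicator (A n) \<omega> \<le> ennreal (1 / t n) * ennreal (f n \<omega>)"
      proof (cases "\<omega> \<in> A n")
        case True
        then have "1 \<le> 1 / t n * f n \<omega>" using pos(1)[of n] by (simp add: A_def split: if_splits)
        then show ?thesis using pos(1)[of n] True by (simp add: ennreal_mult'[symmetric])
      qed simp
    qed
    also have "\<dots> = ennreal (1 / t n) * (\<integral>\<^sup>+\<omega>. ennreal (f n \<omega>) \<partial>M)"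
      using f[OF True] by (intro nn_integral_cmult) auto
    also have "\<dots> \<le> ennreal (1 / t n) * ennreal (K n)" by (intro mult_left_mono le True) simp
    also have "\<dots> = ennreal (K n / t n)" using pos[of n] by (simp add: ennreal_mult'[symmetric])
    finally show ?thesis .
  qed (simp add: A_def)
  have "summable (\<lambda>n. measure M (A n))"
  proof (rule summable_comparison_test'[OF sum])
    fix n
    have "measure M (A n) \<le> K n / t n"
      unfolding measure_def by (rule enn2real_leI) (use em pos[of n] in auto)
    then show "norm (measure M (A n)) \<le> K n / t n" by simp
  qed
  moreover have "emeasure M (A n) < \<infinity>" for n using em[of n] by (simp add: less_top le_less_trans[OF _ ennreal_less_top] order_le_less_trans)
  ultimately have "AE \<omega> in M. \<forall>\<^sub>F n in sequentially. \<omega> \<in> space M - A n"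
    using A by (intro borel_cantelli_AE1) auto
  then show ?thesis
  proof eventually_elim
    case (elim \<omega>)
    show ?case using elim eventually_ge_at_top[of 1]
      by eventually_elim (auto simp: A_def not_le)
  qed
qed

subsection \<open>Quadratic forms of symmetric matrices\<close>

abbreviation qform :: "real mat \<Rightarrow> real vec \<Rightarrow> real" where
  "qform A x \<equiv> x \<bullet> (A *\<^sub>v x)"

lemma symmetric_scalar_prod:
  assumes "A \<in> carrier_mat n n" "A\<^sup>T = A" "x \<in> carrier_vec n" "y \<in> carrier_vec n"
  shows "x \<bullet> (A *\<^sub>v y) = (A *\<^sub>v x) \<bullet> (y :: real vec)"
  using transpose_vec_mult_scalar[OF assms(1,4,3)] assms
  by (simp add: comm_scalar_prod[of _ n])

lemma scalar_prod_self_sum: "(x :: real vec) \<bullet> x = (\<Sum>i<dim_vec x. (x $ i)\<^sup>2)"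
  by (simp add: scalar_prod_def power2_eq_square lessThan_atLeast0)

lemma scalar_prod_self_nonneg: "(x :: real vec) \<bullet> x \<ge> 0"
  by (simp add: scalar_prod_self_sum sum_nonneg)

lemma scalar_prod_self_eq_0: "(x :: real vec) \<in> carrier_vec n \<Longrightarrow> x \<bullet> x = 0 \<Longrightarrow> x = 0\<^sub>v n"
  by (intro eq_vecI) (auto simp: scalar_prod_self_sum sum_nonneg_eq_0_iff)

text \<open>A crude estimate by absolute row sums. Its constant disappears from the final eigenvalue
  bound; it only makes the extremal argument start and the inverse bounded.\<close>

lemma qform_bounded:
  assumes A: "A \<in> carrier_mat n n"
  shows "\<exists>c>0. \<forall>x\<in>carrier_vec n. qform A x \<le> c * (x \<bullet> x) \<and> (A *\<^sub>v x) \<bullet> (A *\<^sub>v x) \<le> c * (x \<bullet> x)"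
proof -
  define R where "R i = (\<Sum>j<n. \<bar>A $$ (i, j)\<bar>)" for i
  define c where "c = 1 + (\<Sum>i<n. R i) + (\<Sum>i<n. (R i)\<^sup>2)"
  have R: "R i \<ge> 0" for i by (simp add: R_def sum_nonneg)
  have c: "c > 0" using R by (auto simp: c_def intro!: add_pos_nonneg sum_nonneg)
  have "qform A x \<le> c * (x \<bullet> x) \<and> (A *\<^sub>v x) \<bullet> (A *\<^sub>v x) \<le> c * (x \<bullet> x)" if x: "x \<in> carrier_vec n" for x
  proof
    define m where "m = sqrt (x \<bullet> x)"
    have m: "m \<ge> 0" "m\<^sup>2 = x \<bullet> x" using scalar_prod_self_nonneg[of x] by (auto simp: m_def)
    have xi: "\<bar>x $ i\<bar> \<le> m" if "i < n" for i
    proof -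
      have "(x $ i)\<^sup>2 \<le> x \<bullet> x"
        unfolding scalar_prod_self_sum using x that by (intro member_le_sum) auto
      then show ?thesis unfolding m_def by (rule real_le_rsqrt[of "\<bar>x $ i\<bar>", simplified])
    qed
    have Ax: "\<bar>(A *\<^sub>v x) $ i\<bar> \<le> R i * m" if "i < n" for i
    proof -
      have "(A *\<^sub>v x) $ i = (\<Sum>j<n. A $$ (i, j) * x $ j)"
        using A x that by (simp add: scalar_prod_def lessThan_atLeast0)
      also have "\<bar>\<dots>\<bar> \<le> (\<Sum>j<n. \<bar>A $$ (i, j)\<bar> * m)"
        using xi by (intro order_trans[OF sum_abs] sum_mono) (auto simp: abs_mult intro!: mult_left_mono)
      finally show ?thesis by (simp add: R_def sum_distrib_right)
    qed
    have "qform A x = (\<Sum>i<n. x $ i * (A *\<^sub>v x) $ i)"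
      using A x by (simp add: scalar_prod_def lessThan_atLeast0)
    also have "\<dots> \<le> (\<Sum>i<n. m * (R i * m))"
    proof (rule sum_mono)
      fix i assume "i \<in> {..<n}"
      then have "\<bar>x $ i * (A *\<^sub>v x) $ i\<bar> \<le> m * (R i * m)"
        unfolding abs_mult using xi Ax m by (intro mult_mono) auto
      then show "x $ i * (A *\<^sub>v x) $ i \<le> m * (R i * m)" by linarith
    qed
    also have "\<dots> = (\<Sum>i<n. R i) * (x \<bullet> x)"
      unfolding m(2)[symmetric] by (simp add: sum_distrib_left sum_distrib_right power2_eq_square mult_ac)
    also have "\<dots> \<le> c * (x \<bullet> x)"
      using scalar_prod_self_nonneg[of x] by (intro mult_right_mono) (auto simp: c_def sum_nonneg)
    finally show "qform A x \<le> c * (x \<bullet> x)" .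
    have "(A *\<^sub>v x) \<bullet> (A *\<^sub>v x) = (\<Sum>i<n. ((A *\<^sub>v x) $ i)\<^sup>2)"
      unfolding scalar_prod_self_sum using A by simp
    also have "\<dots> \<le> (\<Sum>i<n. (R i * m)\<^sup>2)"
    proof (rule sum_mono)
      fix i assume "i \<in> {..<n}"
      then show "((A *\<^sub>v x) $ i)\<^sup>2 \<le> (R i * m)\<^sup>2"
        using Ax[of i] R[of i] m by (subst abs_le_square_iff[symmetric]) auto
    qed
    also have "\<dots> = (\<Sum>i<n. (R i)\<^sup>2) * (x \<bullet> x)"
      unfolding m(2)[symmetric] by (simp add: sum_distrib_right power_mult_distrib)
    also have "\<dots> \<le> c * (x \<bullet> x)"
      using scalar_prod_self_nonneg[of x] R by (intro mult_right_mono) (auto simp: c_def sum_nonneg)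
    finally show "(A *\<^sub>v x) \<bullet> (A *\<^sub>v x) \<le> c * (x \<bullet> x)" .
  qed
  with c show ?thesis by blast
qed

text \<open>The operator inequality A^2 \<le> c A for 0 \<le> A \<le> c I without diagonalization:
  the form of A is nonnegative at x - A x / c, and its cubic term is bounded through A \<le> c
  I.\<close>

lemma psd_mult_vec_le:
  assumes A: "A \<in> carrier_mat n n" and sym: "A\<^sup>T = A"
    and psd: "\<And>x. x \<in> carrier_vec n \<Longrightarrow> qform A x \<ge> 0"
    and le: "\<And>x. x \<in> carrier_vec n \<Longrightarrow> qform A x \<le> c * (x \<bullet> x)" and c: "c > 0"
    and x: "x \<in> carrier_vec n"
  shows "(A *\<^sub>v x) \<bullet> (A *\<^sub>v x) \<le> c * qform A x"
proof -
  define y where "y = A *\<^sub>v x"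
  have y: "y \<in> carrier_vec n" using A x by (simp add: y_def)
  have Ay: "A *\<^sub>v y \<in> carrier_vec n" using A y by simp
  define s where "s = 1 / c"
  have "0 \<le> qform A (x - s \<cdot>\<^sub>v y)" by (rule psd) (use x y in auto)
  also have "A *\<^sub>v (x - s \<cdot>\<^sub>v y) = y - s \<cdot>\<^sub>v (A *\<^sub>v y)"
    using A x y by (simp add: mult_minus_distrib_mat_vec mult_mat_vec y_def)
  also have "(x - s \<cdot>\<^sub>v y) \<bullet> (y - s \<cdot>\<^sub>v (A *\<^sub>v y)) = x \<bullet> y - s * (x \<bullet> (A *\<^sub>v y)) - s * (y \<bullet> y) + s * s * (y \<bullet> (A *\<^sub>v y))"
    using x y Ay by (simp add: minus_scalar_prod_distrib[of _ n] scalar_prod_minus_distrib[of _ n] algebra_simps)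
  also have "x \<bullet> (A *\<^sub>v y) = y \<bullet> y"
    using symmetric_scalar_prod[OF A sym x y] by (simp add: y_def)
  also have "s * s * (y \<bullet> (A *\<^sub>v y)) \<le> s * s * (c * (y \<bullet> y))"
    using le[OF y] by (intro mult_left_mono) auto
  finally have "0 \<le> x \<bullet> y - s * (y \<bullet> y)" using c by (simp add: s_def)
  then show ?thesis using c by (simp add: s_def y_def field_simps)
qed

text \<open>The least t with \<open>t I - A\<close> positive semidefinite is an eigenvalue: otherwise \<open>t I - A\<close>
  would be invertible, hence bounded below by a positive multiple of I, and t could be decreased.\<close>

lemma qform_le_if_eigenvalues_le:
  fixes A :: "real mat"
  assumes A: "A \<in> carrier_mat n n" and sym: "A\<^sup>T = A"
    and ev: "\<And>l. eigenvalue A l \<Longrightarrow> l \<le> K" and x: "x \<in> carrier_vec n"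
  shows "qform A x \<le> K * (x \<bullet> x)"
proof (cases "n = 0")
  case True
  then show ?thesis using A x by (simp add: scalar_prod_def)
next
  case False
  define S where "S = {t. \<forall>x\<in>carrier_vec n. qform A x \<le> t * (x \<bullet> x)}"
  obtain c where "c > 0" "\<And>x. x \<in> carrier_vec n \<Longrightarrow> qform A x \<le> c * (x \<bullet> x)"
    "\<And>x. x \<in> carrier_vec n \<Longrightarrow> (A *\<^sub>v x) \<bullet> (A *\<^sub>v x) \<le> c * (x \<bullet> x)"
    using qform_bounded[OF A] by auto
  then have c: "c \<in> S" by (simp add: S_def)
  \<comment> \<open>Bounds \<open>S\<close> below. In dimension 0 there is no such vector and
    \<open>S\<close> would be the whole real line, which is why that case is separate.\<close>
  define e where "e = (unit_vec n 0 :: real vec)"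
  have e: "e \<in> carrier_vec n" "e \<bullet> e = 1" using False by (auto simp: e_def)
  have bdd: "bdd_below S"
    by (rule bdd_belowI[of _ "qform A e"]) (use e in \<open>force simp: S_def\<close>)
  define t where "t = Inf S"
  have t: "t \<in> S"
    unfolding S_def
  proof (intro CollectI ballI)
    fix x :: "real vec" assume x: "x \<in> carrier_vec n"
    show "qform A x \<le> t * (x \<bullet> x)"
    proof (cases "x \<bullet> x = 0")
      case True
      then show ?thesis using c x by (auto simp: S_def)
    next
      case False
      then have pos: "x \<bullet> x > 0" using scalar_prod_self_nonneg[of x] by linarith
      have "qform A x / (x \<bullet> x) \<le> t"
        unfolding t_def using c pos x by (intro cInf_greatest) (auto simp: S_def field_simps)
      then show ?thesis using pos by (simp add: field_simps)
    qed
  qed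
  have "t \<le> K"
  proof (rule ccontr)
    assume "\<not> t \<le> K"
    then have nev: "\<not> eigenvalue A t" using ev by blast
    define B where "B = t \<cdot>\<^sub>m 1\<^sub>m n - A"
    have B: "B \<in> carrier_mat n n" using A unfolding B_def by (rule minus_carrier_mat)
    have Bx: "B *\<^sub>v x = t \<cdot>\<^sub>v x - A *\<^sub>v x" if "x \<in> carrier_vec n" for x
      unfolding B_def using A that by (subst minus_mult_distrib_mat_vec[of _ n n]) auto
    have qB: "qform B x = t * (x \<bullet> x) - qform A x" if "x \<in> carrier_vec n" for x
      using A that by (simp add: Bx scalar_prod_minus_distrib[of _ n])
    have Bsym: "B\<^sup>T = B"
    proof (rule eq_matI)
      fix i j assume ij: "i < dim_row B" "j < dim_col B"
      have "A $$ (j, i) = A $$ (i, j)"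
        using arg_cong[OF sym, of "\<lambda>M. M $$ (i, j)"] ij A B by simp
      then show "B\<^sup>T $$ (i, j) = B $$ (i, j)" using ij A B by (auto simp: B_def)
    qed (use B in auto)
    have "det B \<noteq> 0"
    proof
      assume "det B = 0"
      then obtain v where v: "v \<in> carrier_vec n" "v \<noteq> 0\<^sub>v n" "B *\<^sub>v v = 0\<^sub>v n"
        using det_0_iff_vec_prod_zero_field[OF B] by blast
      have "A *\<^sub>v v = t \<cdot>\<^sub>v v"
      proof (rule eq_vecI)
        fix i assume i: "i < dim_vec (t \<cdot>\<^sub>v v)"
        have "(t \<cdot>\<^sub>v v - A *\<^sub>v v) $ i = 0" using v Bx[OF v(1)] i by simp
        then show "(A *\<^sub>v v) $ i = (t \<cdot>\<^sub>v v) $ i" using A v i by simp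
      qed (use A v in auto)
      then show False using nev v A by (auto simp: eigenvalue_def eigenvector_def)
    qed
    from det_non_zero_imp_unit[OF B this, of "()"] obtain B' where B': "B' \<in> carrier_mat n n" "B' * B = 1\<^sub>m n"
      by (auto simp: Units_def ring_mat_def)
    obtain c1 where c1: "c1 > 0" "\<And>x. x \<in> carrier_vec n \<Longrightarrow> qform B x \<le> c1 * (x \<bullet> x)"
      "\<And>x. x \<in> carrier_vec n \<Longrightarrow> (B *\<^sub>v x) \<bullet> (B *\<^sub>v x) \<le> c1 * (x \<bullet> x)"
      using qform_bounded[OF B] by auto
    obtain c2 where c2: "c2 > 0" "\<And>x. x \<in> carrier_vec n \<Longrightarrow> qform B' x \<le> c2 * (x \<bullet> x)"
      "\<And>x. x \<in> carrier_vec n \<Longrightarrow> (B' *\<^sub>v x) \<bullet> (B' *\<^sub>v x) \<le> c2 * (x \<bullet> x)"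
      using qform_bounded[OF B'(1)] by auto
    have psd: "qform B x \<ge> 0" if "x \<in> carrier_vec n" for x
      using t that by (simp add: qB S_def)
    \<comment> \<open>The decrement is the lower bound of B: \<bar>x\<bar>^2 \<le> c2 \<bar>B
      x\<bar>^2 since \<open>B'\<close> inverts B, and \<bar>B x\<bar>^2 \<le> c1 x \<bullet> B x by
      \<open>psd_mult_vec_le\<close>.\<close>
    have "t - 1 / (c1 * c2) \<in> S"
      unfolding S_def
    proof (intro CollectI ballI)
      fix x :: "real vec" assume x: "x \<in> carrier_vec n"
      have "x = B' *\<^sub>v (B *\<^sub>v x)" using x B B' by (subst assoc_mult_mat_vec[symmetric, of _ n n _ n]) auto
      then have "x \<bullet> x \<le> c2 * ((B *\<^sub>v x) \<bullet> (B *\<^sub>v x))" using c2(3)[of "B *\<^sub>v x"] x B by simp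
      also have "\<dots> \<le> c2 * (c1 * qform B x)"
        using psd_mult_vec_le[OF B Bsym psd c1(2) c1(1) x] c2 by (intro mult_left_mono) auto
      finally have "x \<bullet> x \<le> c2 * (c1 * (t * (x \<bullet> x) - qform A x))" using qB[OF x] by simp
      then show "qform A x \<le> (t - 1 / (c1 * c2)) * (x \<bullet> x)"
        using c1(1) c2(1) by (simp add: field_simps)
    qed
    then have "t \<le> t - 1 / (c1 * c2)" unfolding t_def by (rule cInf_lower[OF _ bdd])
    then show False using c1(1) c2(1) by (simp add: field_simps)
  qed
  have "qform A x \<le> t * (x \<bullet> x)" using t x by (simp add: S_def)
  also have "\<dots> \<le> K * (x \<bullet> x)" using \<open>t \<le> K\<close> scalar_prod_self_nonneg by (intro mult_right_mono)
  finally show ?thesis .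
qed

lemma mat_inv_eqI:
  assumes A: "A \<in> carrier_mat n n" and B: "B \<in> carrier_mat n n" and AB: "A * B = 1\<^sub>m n"
  shows "mat_inv A = B"
proof -
  have BA: "B * A = 1\<^sub>m n" by (rule mat_mult_left_right_inverse[OF A B AB])
  have "mat_inverse A \<noteq> None"
    using mat_inverse(1)[OF A, of "()"] A B AB BA by (auto simp: Units_def ring_mat_def)
  then obtain D where D: "mat_inverse A = Some D" by auto
  have D': "D * A = 1\<^sub>m n" "D \<in> carrier_mat n n" using mat_inverse(2)[OF A D] by auto
  have "D = D * (A * B)" using D' AB by simp
  also have "\<dots> = (D * A) * B" using A B D' by (intro assoc_mult_mat[symmetric, of _ n n _ n _ n]) auto
  also have "\<dots> = B" using D' B by simp
  finally show ?thesis by (simp add: mat_inv_def D)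
qed

text \<open>Linear independence here concerns the set of columns, which would not see a repeated
  column. So the columns are first shown to be distinct: otherwise that set has fewer than p
  elements and the rank is below p.\<close>

lemma full_column_rank_injective:
  fixes X :: "real mat"
  assumes X: "X \<in> carrier_mat n p" and rank: "vec_space.rank n X = p"
    and z: "z \<in> carrier_vec p" "X *\<^sub>v z = 0\<^sub>v n"
  shows "z = 0\<^sub>v p"
proof (rule ccontr)
  interpret vec_space "TYPE(real)" n .
  assume nz: "z \<noteq> 0\<^sub>v p"
  have "distinct (cols X)"
  proof (rule ccontr)
    assume "\<not> distinct (cols X)"
    then have lt: "card (set (cols X)) < p"
      using X card_length[of "cols X"] card_distinct[of "cols X"] by (auto simp: le_less)
    obtain S where S: "maximal S (\<lambda>T. T \<subseteq> set (cols X) \<and> lin_indpt T)"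
      using maximal_exists[of "(\<lambda>T. T \<subseteq> set (cols X) \<and> lin_indpt T)" "card (set (cols X))" "{}"]
      by (meson List.finite_set card_mono empty_iff empty_subsetI finite_lin_indpt2 rev_finite_subset)
    then have "card S \<le> card (set (cols X))" by (simp add: card_mono maximal_def)
    with lt rank rank_card_indpt[OF X S] show False by simp
  qed
  with lin_depI[OF X z(1) nz z(2)] full_rank_lin_indpt[OF X rank] show False by blast
qed

section \<open>Consequences of full column rank and of the eigenvalue bounds\<close>

locale full_rank_design =
  fixes n p :: nat and X :: "real mat" and lmin L :: real
  assumes n_pos: "n > 0" and p_le_n: "p \<le> n" and X: "X \<in> carrier_mat n p"
    and rank: "vec_space.rank n X = p" and lmin_pos: "lmin > 0" and L_pos: "L > 0"
    and eigenvalues: "\<And>l. eigenvalue (real n \<cdot>\<^sub>m mat_inv (X\<^sup>T * X)) l \<Longrightarrow> lmin \<le> l \<and> l \<le> L"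
begin

abbreviation G where "G \<equiv> X\<^sup>T * X"
abbreviation Gi where "Gi \<equiv> mat_inv G"

lemma G: "G \<in> carrier_mat p p" and XT: "X\<^sup>T \<in> carrier_mat p n"
  using X by auto

lemma qform_G:
  assumes z: "z \<in> carrier_vec p"
  shows "qform G z = (X *\<^sub>v z) \<bullet> (X *\<^sub>v z)"
proof -
  have "qform G z = z \<bullet> (X\<^sup>T *\<^sub>v (X *\<^sub>v z))"
    using X XT z by (simp add: assoc_mult_mat_vec[of _ p n _ p])
  also have "\<dots> = (X\<^sup>T *\<^sub>v (X *\<^sub>v z)) \<bullet> z"
    by (rule comm_scalar_prod[of _ p]) (use X z in auto)
  also have "\<dots> = (X *\<^sub>v z) \<bullet> (X *\<^sub>v z)"
    by (rule transpose_vec_mult_scalar[OF X z]) (use X z in auto)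
  finally show ?thesis .
qed

lemma det_G: "det G \<noteq> 0"
proof
  assume "det G = 0"
  then obtain v where v: "v \<in> carrier_vec p" "v \<noteq> 0\<^sub>v p" "G *\<^sub>v v = 0\<^sub>v p"
    using det_0_iff_vec_prod_zero_field[OF G] by blast
  have "(X *\<^sub>v v) \<bullet> (X *\<^sub>v v) = 0" using qform_G[OF v(1)] v by simp
  then have "X *\<^sub>v v = 0\<^sub>v n" by (intro scalar_prod_self_eq_0) (use X v in auto)
  then show False using full_column_rank_injective[OF X rank v(1)] v by blast
qed

lemma Gi: "Gi \<in> carrier_mat p p" and G_Gi: "G * Gi = 1\<^sub>m p" and Gi_G: "Gi * G = 1\<^sub>m p"
proof -
  from det_non_zero_imp_unit[OF G det_G, of "()"] obtain B where B: "B \<in> carrier_mat p p" "B * G = 1\<^sub>m p" "G * B = 1\<^sub>m p"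
    by (auto simp: Units_def ring_mat_def)
  with mat_inv_eqI[OF G B(1,3)] show "Gi \<in> carrier_mat p p" "G * Gi = 1\<^sub>m p" "Gi * G = 1\<^sub>m p" by simp_all
qed

lemma G_sym: "G\<^sup>T = G"
  using X by (simp add: transpose_mult[of _ p n _ p])

lemma Gi_sym: "Gi\<^sup>T = Gi"
proof -
  have "Gi\<^sup>T * G = 1\<^sub>m p"
    using arg_cong[OF G_Gi, of transpose_mat] G Gi G_sym by (simp add: transpose_mult[of _ p p _ p])
  have "Gi\<^sup>T = Gi\<^sup>T * (G * Gi)" using G_Gi Gi by simp
  also have "\<dots> = (Gi\<^sup>T * G) * Gi" using G Gi by (simp add: assoc_mult_mat[of _ p p _ p _ p])
  also have "\<dots> = Gi" using \<open>Gi\<^sup>T * G = 1\<^sub>m p\<close> Gi by simp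
  finally show ?thesis .
qed

lemma det_Gi: "det Gi \<noteq> 0"
  using det_mult[OF G Gi] G_Gi by auto

abbreviation W where "W \<equiv> real n \<cdot>\<^sub>m Gi"

lemma W: "W \<in> carrier_mat p p"
  using Gi by simp

lemma W_sym: "W\<^sup>T = W"
proof (rule eq_matI)
  fix i j assume ij: "i < dim_row W" "j < dim_col W"
  then have "Gi $$ (j, i) = Gi $$ (i, j)"
    using arg_cong[OF Gi_sym, of "\<lambda>M. M $$ (i, j)"] Gi by simp
  then show "W\<^sup>T $$ (i, j) = W $$ (i, j)" using ij Gi by simp
qed (use Gi in auto)

lemma qform_W_le: "x \<in> carrier_vec p \<Longrightarrow> qform W x \<le> L * (x \<bullet> x)"
  using eigenvalues by (intro qform_le_if_eigenvalues_le[OF W W_sym]) auto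

text \<open>The upper bound applied to \<open>- W\<close>, whose eigenvalues are the negatives of
  those of \<open>W\<close>.\<close>

lemma qform_W_ge:
  assumes x: "x \<in> carrier_vec p"
  shows "lmin * (x \<bullet> x) \<le> qform W x"
proof -
  have uW: "- W \<in> carrier_mat p p" using W by auto
  have "l \<le> - lmin" if l: "eigenvalue (- W) l" for l
  proof -
    obtain v where v: "v \<in> carrier_vec p" "v \<noteq> 0\<^sub>v p" "- W *\<^sub>v v = l \<cdot>\<^sub>v v"
      using l Gi by (auto simp: eigenvalue_def eigenvector_def)
    have "- (W *\<^sub>v v) = l \<cdot>\<^sub>v v" using v(3) uminus_mult_mat_vec[of v W] v(1) Gi by simp
    then have "W *\<^sub>v v = - (l \<cdot>\<^sub>v v)" using W v by (metis uminus_uminus_vec)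
    also have "\<dots> = (- l) \<cdot>\<^sub>v v" using v by auto
    finally have "eigenvalue W (- l)" using v Gi by (auto simp: eigenvalue_def eigenvector_def)
    then show ?thesis using eigenvalues by force
  qed
  moreover have "(- W)\<^sup>T = - W" using W W_sym by (simp add: transpose_uminus)
  ultimately have "qform (- W) x \<le> - lmin * (x \<bullet> x)"
    by (intro qform_le_if_eigenvalues_le[OF uW _ _ x]) auto
  moreover have "qform (- W) x = - qform W x" using Gi x uminus_mult_mat_vec[of x W] by simp
  ultimately show ?thesis by simp
qed

lemma W_G_mult:
  assumes z: "z \<in> carrier_vec p"
  shows "W *\<^sub>v (G *\<^sub>v z) = real n \<cdot>\<^sub>v z"
proof -
  have "W *\<^sub>v (G *\<^sub>v z) = (W * G) *\<^sub>v z" using W G z by simp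
  also have "W * G = real n \<cdot>\<^sub>m 1\<^sub>m p" using mult_smult_assoc_mat[OF Gi G] Gi_G by simp
  also have "\<dots> *\<^sub>v z = real n \<cdot>\<^sub>v z" using z by auto
  finally show ?thesis .
qed

text \<open>With y = G z one has W y = n z, so the inequality \<bar>W y\<bar>^2 \<le> L y \<bullet>
  W y reads n^2 \<bar>z\<bar>^2 \<le> L n \<bar>X z\<bar>^2.\<close>

lemma norm_le_norm_X:
  assumes z: "z \<in> carrier_vec p"
  shows "real n * (z \<bullet> z) \<le> L * ((X *\<^sub>v z) \<bullet> (X *\<^sub>v z))"
proof -
  define y where "y = G *\<^sub>v z"
  have y: "y \<in> carrier_vec p" using G z by (simp add: y_def)
  have Wy: "W *\<^sub>v y = real n \<cdot>\<^sub>v z" using W_G_mult[OF z] by (simp add: y_def)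
  have psd: "qform W x \<ge> 0" if "x \<in> carrier_vec p" for x
    using qform_W_ge[OF that] lmin_pos scalar_prod_self_nonneg[of x]
    by (meson less_imp_le mult_nonneg_nonneg order_trans)
  have "(W *\<^sub>v y) \<bullet> (W *\<^sub>v y) \<le> L * qform W y"
    by (rule psd_mult_vec_le[OF W W_sym psd qform_W_le L_pos y])
  also have "qform W y = real n * (y \<bullet> z)" using y z by (simp add: Wy)
  also have "y \<bullet> z = (X *\<^sub>v z) \<bullet> (X *\<^sub>v z)" using qform_G[OF z] y z comm_scalar_prod[of y p z] by (simp add: y_def)
  finally have "real n * (real n * (z \<bullet> z)) \<le> real n * (L * ((X *\<^sub>v z) \<bullet> (X *\<^sub>v z)))"
    using z by (simp add: Wy mult_ac)
  then show ?thesis using n_pos by simp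
qed

text \<open>Expand \<bar>n z - lmin y\<bar>^2 \<ge> 0 for y = G z, and bound the last term by lmin
  \<bar>y\<bar>^2 \<le> n z \<bullet> y, which is \<open>qform_W_ge\<close> at y.\<close>

lemma norm_X_le_norm:
  assumes z: "z \<in> carrier_vec p"
  shows "lmin * ((X *\<^sub>v z) \<bullet> (X *\<^sub>v z)) \<le> real n * (z \<bullet> z)"
proof -
  define y where "y = G *\<^sub>v z"
  have y: "y \<in> carrier_vec p" using G z by (simp add: y_def)
  have yz: "z \<bullet> y = (X *\<^sub>v z) \<bullet> (X *\<^sub>v z)" using qform_G[OF z] by (simp add: y_def)
  have "lmin * (y \<bullet> y) \<le> qform W y" by (rule qform_W_ge[OF y])
  also have "\<dots> = real n * (z \<bullet> y)"
    using y z W_G_mult[OF z] comm_scalar_prod[of y p z] by (simp add: y_def)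
  finally have 1: "lmin * (y \<bullet> y) \<le> real n * (z \<bullet> y)" .
  have "0 \<le> (real n \<cdot>\<^sub>v z - lmin \<cdot>\<^sub>v y) \<bullet> (real n \<cdot>\<^sub>v z - lmin \<cdot>\<^sub>v y)" by (rule scalar_prod_self_nonneg)
  also have "\<dots> = real n * (real n * (z \<bullet> z)) - 2 * (real n * lmin * (z \<bullet> y)) + lmin * (lmin * (y \<bullet> y))"
    using y z comm_scalar_prod[of y p z]
    by (simp add: minus_scalar_prod_distrib[of _ p] scalar_prod_minus_distrib[of _ p] algebra_simps)
  also have "lmin * (lmin * (y \<bullet> y)) \<le> lmin * (real n * (z \<bullet> y))"
    using 1 lmin_pos by (intro mult_left_mono) auto
  finally have "real n * (lmin * (z \<bullet> y)) \<le> real n * (real n * (z \<bullet> z))" by (simp add: algebra_simps)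
  then show ?thesis using n_pos yz by simp
qed

lemma Gi_diag:
  assumes i: "i < p"
  shows "Gi $$ (i, i) \<le> L / real n"
proof -
  let ?e = "unit_vec p i :: real vec"
  have "qform W ?e \<le> L * (?e \<bullet> ?e)" by (rule qform_W_le) simp
  moreover have "?e \<bullet> ?e = 1" using i by simp
  moreover have "qform W ?e = real n * Gi $$ (i, i)"
    using i Gi scalar_prod_left_unit[OF mult_mat_vec_carrier[OF W, of ?e] i] by simp
  ultimately show ?thesis using n_pos by (simp add: field_simps)
qed

end

subsection \<open>The posterior of the matrix model\<close>

lemma linf_norm_gt_iff:
  assumes "\<epsilon> \<ge> 0"
  shows "linf_norm x > \<epsilon> \<longleftrightarrow> (\<exists>i<dim_vec x. \<bar>x $ i\<bar> > \<epsilon>)"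
proof -
  have "linf_norm x > \<epsilon> \<longleftrightarrow> (\<exists>y\<in>insert 0 ((\<lambda>i. \<bar>x $ i\<bar>) ` {..<dim_vec x}). \<epsilon> < y)"
    unfolding linf_norm_def by (rule Max_gr_iff) auto
  then show ?thesis using assms by auto
qed

lemma linf_norm_ge: "i < dim_vec x \<Longrightarrow> \<bar>x $ i\<bar> \<le> linf_norm x"
  unfolding linf_norm_def by (rule Max_ge) auto

lemma linf_norm_nonneg: "linf_norm x \<ge> 0"
  unfolding linf_norm_def by (rule Max_ge) auto

lemma linf_norm_attained:
  assumes "linf_norm x > 0"
  obtains i where "i < dim_vec x" "\<bar>x $ i\<bar> = linf_norm x"
proof -
  have "linf_norm x \<in> insert 0 ((\<lambda>i. \<bar>x $ i\<bar>) ` {..<dim_vec x})"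
    unfolding linf_norm_def by (rule Max_in) auto
  then show ?thesis using assms that by auto
qed

lemma l2_norm_sq: "(l2_norm x)\<^sup>2 = x \<bullet> x"
  by (simp add: l2_norm_def scalar_prod_self_sum sum_nonneg)

lemma linf_norm_le_l2_norm: "(linf_norm x)\<^sup>2 \<le> (l2_norm x)\<^sup>2"
proof (cases "linf_norm x > 0")
  case True
  then obtain i where i: "i < dim_vec x" "\<bar>x $ i\<bar> = linf_norm x" by (rule linf_norm_attained)
  have "(x $ i)\<^sup>2 \<le> x \<bullet> x" unfolding scalar_prod_self_sum using i by (intro member_le_sum) auto
  then show ?thesis unfolding l2_norm_sq i(2)[symmetric] by simp
next
  case False
  then have "linf_norm x = 0" using linf_norm_nonneg[of x] by simp
  then show ?thesis by simp
qed

lemma index_mult_mat_sum: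
  assumes "A \<in> carrier_mat nr m" "B \<in> carrier_mat m nc" "i < nr" "j < nc"
  shows "(A * B) $$ (i, j) = (\<Sum>k<m. A $$ (i, k) * B $$ (k, j))"
  using assms by (simp add: scalar_prod_def lessThan_atLeast0)

lemma smult_mat_mult_vec:
  fixes A :: "real mat"
  assumes "A \<in> carrier_mat nr nc" "z \<in> carrier_vec nc"
  shows "(k \<cdot>\<^sub>m A) *\<^sub>v z = k \<cdot>\<^sub>v (A *\<^sub>v z)"
  using assms by (intro eq_vecI) (auto simp: scalar_prod_def sum_distrib_left mult_ac)

context full_rank_design
begin

lemma gram_index: "i < p \<Longrightarrow> k < p \<Longrightarrow> G $$ (i, k) = (\<Sum>l<n. X $$ (l, i) * X $$ (l, k))"
  using X by (simp add: scalar_prod_def lessThan_atLeast0)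

lemma X_mult_vec_index:
  "z \<in> carrier_vec p \<Longrightarrow> i < n \<Longrightarrow> (X *\<^sub>v z) $ i = (\<Sum>j<p. X $$ (i, j) * z $ j)"
  using X by (simp add: scalar_prod_def lessThan_atLeast0)

lemma norm_X_sum:
  "z \<in> carrier_vec p \<Longrightarrow> (X *\<^sub>v z) \<bullet> (X *\<^sub>v z) = (\<Sum>i<n. (\<Sum>j<p. X $$ (i, j) * z $ j)\<^sup>2)"
  using X X_mult_vec_index[of z] by (simp add: scalar_prod_self_sum)

sublocale D: design n p "\<lambda>i j. X $$ (i, j)" "\<lambda>i j. Gi $$ (i, j)" L
proof
  show "(\<Sum>k<p. (\<Sum>l<n. X $$ (l, i) * X $$ (l, k)) * Gi $$ (k, j)) = (if i = j then 1 else 0)"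
    if "i < p" "j < p" for i j
  proof -
    have "(G * Gi) $$ (i, j) = (\<Sum>k<p. G $$ (i, k) * Gi $$ (k, j))"
      using that by (rule index_mult_mat_sum[OF G Gi])
    also have "\<dots> = (\<Sum>k<p. (\<Sum>l<n. X $$ (l, i) * X $$ (l, k)) * Gi $$ (k, j))"
      using that gram_index by (intro sum.cong) auto
    finally show ?thesis using G_Gi that by simp
  qed
  show "real n * (\<Sum>j<p. (z j)\<^sup>2) \<le> L * (\<Sum>i<n. (\<Sum>j<p. X $$ (i, j) * z j)\<^sup>2)" for z
    using norm_le_norm_X[of "vec p z"] norm_X_sum[of "vec p z"] by (simp add: scalar_prod_self_sum)
qed (use n_pos p_le_n L_pos Gi_diag in auto)

lemma lin_eq: "z \<in> carrier_vec p \<Longrightarrow> i < n \<Longrightarrow> (X *\<^sub>v z) $ i = D.lin (\<lambda>j. z $ j) i"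
  by (simp add: X_mult_vec_index D.lin_def)

lemma qn_eq: "z \<in> carrier_vec p \<Longrightarrow> qform G z = D.qn (\<lambda>j. z $ j)"
  by (simp add: qform_G norm_X_sum D.qn_def D.lin_def)

lemma qn_diff_eq:
  "x \<in> carrier_vec p \<Longrightarrow> y \<in> carrier_vec p \<Longrightarrow> qform G (x - y) = D.qn (\<lambda>j. x $ j - y $ j)"
  by (subst qn_eq) (auto intro!: D.qn_cong)

lemma mvn_density_eq:
  assumes m: "m \<in> carrier_vec p" and x: "x \<in> carrier_vec p" and t: "t > 0"
  shows "mvn_density m (t \<cdot>\<^sub>m Gi) x =
    exp (- D.qn (\<lambda>j. x $ j - m $ j) / (2 * t)) / sqrt ((2 * pi) ^ p * (t ^ p * det Gi))"
proof -
  have "(t \<cdot>\<^sub>m Gi) * ((1 / t) \<cdot>\<^sub>m G) = t \<cdot>\<^sub>m (Gi * ((1 / t) \<cdot>\<^sub>m G))"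
    by (rule mult_smult_assoc_mat[of _ p p _ p]) (use Gi G in auto)
  also have "Gi * ((1 / t) \<cdot>\<^sub>m G) = (1 / t) \<cdot>\<^sub>m (Gi * G)"
    by (rule mult_smult_distrib[of _ p p _ p]) (use Gi G in auto)
  also have "t \<cdot>\<^sub>m ((1 / t) \<cdot>\<^sub>m (Gi * G)) = 1\<^sub>m p"
    using t unfolding Gi_G by (intro eq_matI) auto
  finally have "mat_inv (t \<cdot>\<^sub>m Gi) = (1 / t) \<cdot>\<^sub>m G"
    by (intro mat_inv_eqI[of _ p]) (use Gi G in auto)
  moreover have "((1 / t) \<cdot>\<^sub>m G) *\<^sub>v (x - m) = (1 / t) \<cdot>\<^sub>v (G *\<^sub>v (x - m))"
    using m x by (intro smult_mat_mult_vec[OF G]) auto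
  moreover have "(x - m) \<bullet> ((1 / t) \<cdot>\<^sub>v (G *\<^sub>v (x - m))) = (1 / t) * qform G (x - m)"
    using m x G by (intro scalar_prod_smult_distrib[of _ p]) auto
  ultimately show ?thesis
    using m Gi qn_diff_eq[OF x m] by (simp add: mvn_density_def field_simps)
qed

lemma ols_index:
  assumes y: "y \<in> carrier_vec n" and j: "j < p"
  shows "ols X y $ j = D.beta_hat (\<lambda>i. y $ i) j"
proof -
  have "(X\<^sup>T *\<^sub>v y) $ k = (\<Sum>l<n. X $$ (l, k) * y $ l)" if "k < p" for k
    using X y that by (simp add: scalar_prod_def lessThan_atLeast0)
  then have "(Gi *\<^sub>v (X\<^sup>T *\<^sub>v y)) $ j = (\<Sum>k<p. Gi $$ (j, k) * (\<Sum>l<n. X $$ (l, k) * y $ l))"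
    using j Gi X by (simp add: scalar_prod_def[of "row Gi j"] lessThan_atLeast0)
  then show ?thesis by (simp add: ols_def D.beta_hat_def)
qed

lemma ols_dim: "ols X y \<in> carrier_vec p"
  unfolding ols_def by (rule carrier_vecI) (use Gi in simp)

lemma rss_eq:
  assumes y: "y \<in> carrier_vec n"
  shows "rss X y = D.resid (\<lambda>i. y $ i)"
proof -
  have "(y - X *\<^sub>v ols X y) $ i = y $ i - D.lin (D.beta_hat (\<lambda>i. y $ i)) i" if "i < n" for i
    using that X y lin_eq[OF ols_dim that] ols_index[OF y] D.lin_cong[of "\<lambda>j. ols X y $ j"] by auto
  then show ?thesis
    using X by (simp add: rss_def l2_norm_sq scalar_prod_self_sum D.resid_def)
qed

end

text \<open>One sample size with fixed data \<open>bhat\<close> and \<open>s\<close>. The conditions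
  on \<open>s\<close>, \<open>na\<close>, \<open>gap\<close> and properness hold for almost every
  outcome once n is large; \<open>gap\<close> is N - q - 2 > 0.\<close>

locale posterior_setup = full_rank_design +
  fixes \<gamma> bhat \<beta>0 :: "real vec" and a b c s :: real
  assumes \<gamma>: "\<gamma> \<in> carrier_vec p" and bhat: "bhat \<in> carrier_vec p" and \<beta>0: "\<beta>0 \<in> carrier_vec p"
    and p_less_n: "p < n" and s: "s > 0" and b: "b \<ge> 0" and na: "real n + a > 2"
    and gap: "real n + a - real p - c > 0"
    and proper_posterior: "prob_space (posterior X \<gamma> a b c bhat s)"
begin

text \<open>The absolute value arises from the square roots in the two normal densities:
  \<open>sqrt x * sqrt x\<close> is \<bar>x\<bar> for either sign of x.\<close>

definition k0 :: real where
  "k0 = s powr (real (n - p) / 2 - 1) / (2 powr (real (n - p) / 2) * Gamma (real (n - p) / 2)) /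
     ((2 * pi) ^ p * \<bar>det Gi\<bar>)"

abbreviation "Nn \<equiv> real n + a"
abbreviation "qq \<equiv> real p + c - 2"
abbreviation "BB \<equiv> b + s"
abbreviation "TT \<equiv> D.qn (\<lambda>j. bhat $ j - \<gamma> $ j)"

lemma k0_pos: "k0 > 0"
  unfolding k0_def using s p_less_n det_Gi by (auto intro!: divide_pos_pos mult_pos_pos Gamma_real_pos)

sublocale post: g_prior_posterior n p "\<lambda>i j. X $$ (i, j)" "\<lambda>i j. Gi $$ (i, j)" L Nn qq BB TT "\<lambda>j. bhat $ j" "\<lambda>j. \<gamma> $ j" k0
  by unfold_locales (use na b s k0_pos D.qn_nonneg in auto)

lemma joint_kernel_eq:
  "joint_kernel X \<gamma> a b c bhat s (vec p x) v g = post.kern x v g"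
proof (cases "0 < v \<and> 0 < g")
  case True
  then have v: "v > 0" and g: "g > 0" by auto
  define A where "A = (2 * pi) ^ p * det Gi"
  define m where "m = real (n - p)"
  have m: "m = real n - real p" using p_less_n by (simp add: m_def)
  define K where "K = 2 powr (m / 2) * Gamma (m / 2)"
  have sqrt_pow: "sqrt (w ^ p) = w powr (real p / 2)" if "w > 0" for w
    using that by (simp add: powr_half_sqrt[symmetric] powr_realpow[symmetric] powr_powr)
  have d1: "mvn_density (vec p x) (v \<cdot>\<^sub>m Gi) bhat =
      exp (- D.qn (\<lambda>j. x j - bhat $ j) / (2 * v)) / (sqrt A * v powr (real p / 2))"
  proof -
    have "D.qn (\<lambda>j. bhat $ j - vec p x $ j) = D.qn (\<lambda>j. (- 1) * (x j - bhat $ j))"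
      by (rule D.qn_cong) simp
    also have "\<dots> = D.qn (\<lambda>j. x j - bhat $ j)" unfolding D.qn_scale by simp
    finally show ?thesis
      using mvn_density_eq[of "vec p x" bhat v] bhat v sqrt_pow[OF v]
      by (simp add: A_def real_sqrt_mult mult_ac)
  qed
  have d2: "mvn_density \<gamma> ((g * v) \<cdot>\<^sub>m Gi) (vec p x) =
      exp (- D.qn (\<lambda>j. x j - \<gamma> $ j) / (2 * (g * v))) / (sqrt A * (g powr (real p / 2) * v powr (real p / 2)))"
  proof -
    have "D.qn (\<lambda>j. vec p x $ j - \<gamma> $ j) = D.qn (\<lambda>j. x j - \<gamma> $ j)"
      by (rule D.qn_cong) simp
    then show ?thesis
      using mvn_density_eq[of \<gamma> "vec p x" "g * v"] \<gamma> v g sqrt_pow[of "g * v"]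
      by (simp add: A_def real_sqrt_mult powr_mult mult_ac)
  qed
  have d3: "scaled_chi_square_density v (n - p) s = s powr (m / 2 - 1) * v powr (- (m / 2)) * exp (- s / (2 * v)) / K"
  proof -
    define e where "e = m / 2 - 1"
    have "v powr (m / 2) = v powr e * v" using powr_add[of v e 1] v by (simp add: e_def)
    then have pw: "(s / v) powr e / v = s powr e * v powr (- (m / 2))"
      unfolding powr_minus using s v by (simp add: powr_divide divide_simps)
    have "scaled_chi_square_density v (n - p) s = ((s / v) powr e / v) * exp (- s / (2 * v)) / K"
      using s v by (simp add: scaled_chi_square_density_def chi_square_density_def m_def[symmetric] K_def e_def mult_ac)
    then show ?thesis unfolding pw by (simp add: e_def)
  qed
  have A: "sqrt A * sqrt A = \<bar>A\<bar>" by (simp add: real_sqrt_mult[symmetric])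
  have k0: "k0 = s powr (m / 2 - 1) / K / (sqrt A * sqrt A)"
    unfolding A by (simp add: k0_def K_def m_def A_def abs_mult)
  \<comment> \<open>Powers of v: p/2 from the density of the estimate, p/2 from the prior of
    \<beta>, (n - p)/2 from the chi-square density and a/2 + 1 from the inverse gamma prior.\<close>
  have vp: "v powr (- (Nn + real p) / 2 - 1) = v powr (- (real p / 2)) * v powr (- (real p / 2)) * v powr (- (m / 2)) * v powr (- a / 2 - 1)"
    unfolding powr_add[symmetric] m by (rule arg_cong[where f = "(powr) v"]) (simp add: field_simps)
  have ex: "exp (- (D.qn (\<lambda>j. x j - bhat $ j) + D.qn (\<lambda>j. x j - \<gamma> $ j) / g + BB) / (2 * v)) =
      exp (- D.qn (\<lambda>j. x j - bhat $ j) / (2 * v)) * exp (- s / (2 * v)) *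
      exp (- D.qn (\<lambda>j. x j - \<gamma> $ j) / (2 * (g * v))) * exp (- b / (2 * v))"
    unfolding mult_exp_exp using v g by (intro arg_cong[where f = exp]) (simp add: field_simps)
  have "joint_kernel X \<gamma> a b c bhat s (vec p x) v g =
     mvn_density (vec p x) (v \<cdot>\<^sub>m Gi) bhat * scaled_chi_square_density v (n - p) s
         * mvn_density \<gamma> ((g * v) \<cdot>\<^sub>m Gi) (vec p x) * (v powr (- a / 2 - 1) * exp (- b / (2 * v))) * (g + 1) powr (- c / 2)"
    using True X by (simp add: joint_kernel_def inverse_gamma_kernel_def hyper_g_kernel_def)
  also have "\<dots> = post.kern x v g"
    using True unfolding d1 d2 d3 post.kern_def unfolding k0 vp ex by (simp add: powr_minus field_simps)
  finally show ?thesis .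
qed (auto simp: joint_kernel_def post.kern_def)

lemma posterior_eq: "posterior X \<gamma> a b c bhat s = post.Post"
  using X by (simp add: posterior_def unnormalized_posterior_def post.Post_def post.U_def joint_kernel_eq Let_def)

sublocale pp: proper_g_prior_posterior n p "\<lambda>i j. X $$ (i, j)" "\<lambda>i j. Gi $$ (i, j)" L Nn qq BB TT "\<lambda>j. bhat $ j" "\<lambda>j. \<gamma> $ j" k0
  by (intro proper_g_prior_posterior.intro post.g_prior_posterior_axioms proper_g_prior_posterior_axioms.intro)
    (use proper_posterior posterior_eq in simp)

abbreviation "u g \<equiv> 1 / ((g::real) + 1)"

abbreviation far :: "real \<Rightarrow> ((nat \<Rightarrow> real) \<times> real \<times> real) set" where
  "far \<epsilon> \<equiv> post.event (\<lambda>x v g. \<exists>i<p. \<bar>x i - \<beta>0 $ i\<bar> > \<epsilon>)"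

definition err :: "real \<Rightarrow> real" where
  "err \<epsilon> = 8 * L / \<epsilon>\<^sup>2 / sqrt n * BB / (real n + a - real p - c)"

lemma mu_eq: "g > 0 \<Longrightarrow> post.mu g i = (1 - u g) * bhat $ i + u g * \<gamma> $ i"
  by (simp add: post.mu_def divide_simps)

lemma err_bound: "\<epsilon> > 0 \<Longrightarrow> measure post.Post (post.noise \<epsilon>) \<le> err \<epsilon>"
  using pp.prob_noise_gt[of \<epsilon>] gap by (simp add: err_def algebra_simps)

lemma linf_event:
  assumes "\<epsilon> > 0"
  shows "{w \<in> space post.Post. linf_norm (vec p (fst w) - \<beta>0) > \<epsilon>} =
      far \<epsilon>"
    and "far \<epsilon> \<in> sets post.Post"
proof -
  show "{w \<in> space post.Post. linf_norm (vec p (fst w) - \<beta>0) > \<epsilon>} =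
      far \<epsilon>"
    using assms \<beta>0 by (auto simp: linf_norm_gt_iff post.Post_def space_scale_measure post.space_U)
  have "far \<epsilon> =
      (\<Union>i\<in>{..<p}. {w \<in> space post.PVG. \<bar>fst w i - \<beta>0 $ i\<bar> > \<epsilon>})"
    by (auto simp: space_pair_measure)
  also have "\<dots> \<in> sets post.PVG" by measurable
  finally show "far \<epsilon> \<in> sets post.Post"
    by (simp add: post.Post_def sets_scale_measure post.sets_U)
qed

lemma linf_prob_eq:
  "\<epsilon> > 0 \<Longrightarrow> posterior_linf_prob X \<gamma> a b c bhat s \<beta>0 \<epsilon> =
     measure post.Post (far \<epsilon>)"
  using X by (simp add: posterior_linf_prob_def posterior_eq linf_event)

lemma noise_in_sets: "post.noise \<epsilon> \<in> sets post.Post"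
  using post.noise_sets by (simp add: post.Post_def sets_scale_measure post.sets_U)

lemma g_event_in_sets: "Measurable.pred borel R \<Longrightarrow> post.event (\<lambda>x v g. R g) \<in> sets post.Post"
  using post.g_event_sets by (simp add: post.Post_def sets_scale_measure post.sets_U)

text \<open>The posterior lives on a space where g ranges over all reals; its density vanishes for g
  \<le> 0, where the formulas in u make no sense.\<close>

lemma prob_g_nonpos: "measure post.Post (post.event (\<lambda>x v g. \<not> g > 0)) = 0"
proof -
  have "emeasure post.U (post.event (\<lambda>x v g. \<not> g > 0)) \<le> ennreal k0 * D.C * post.integ (\<lambda>v g. 0)"
    by (rule post.emeasure_U_g_event_le) auto
  then have "emeasure post.U (post.event (\<lambda>x v g. \<not> g > 0)) = 0"
    by (simp add: post.integ_def case_prod_unfold)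
  then show ?thesis by (simp add: measure_def post.Post_def emeasure_scale_measure)
qed

text \<open>Splits y - \<beta>0 into posterior noise around \<open>mu g\<close>, the estimation
  error with weight 1 - u \<le> 1, and the bias u (\<gamma> - \<beta>0), which stays on the left so
  that the lemma serves upper and lower bounds alike.\<close>

lemma deviation_le:
  assumes g: "g > 0" and i: "i < p" and close: "\<bar>bhat $ i - \<beta>0 $ i\<bar> \<le> \<epsilon>"
  shows "\<bar>(y - \<beta>0 $ i) - u g * (\<gamma> $ i - \<beta>0 $ i)\<bar> \<le> \<bar>y - post.mu g i\<bar> + \<epsilon>"
proof -
  have u: "0 \<le> 1 - u g" "1 - u g \<le> 1" using g by (auto simp: field_simps)
  have "(y - \<beta>0 $ i) - u g * (\<gamma> $ i - \<beta>0 $ i) = (y - post.mu g i) + (1 - u g) * (bhat $ i - \<beta>0 $ i)"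
    unfolding mu_eq[OF g] by (simp add: algebra_simps)
  moreover have "\<bar>(1 - u g) * (bhat $ i - \<beta>0 $ i)\<bar> \<le> 1 * \<epsilon>"
    unfolding abs_mult using u close by (intro mult_mono) auto
  ultimately show ?thesis by linarith
qed

abbreviation "\<delta> \<equiv> linf_norm (\<gamma> - \<beta>0)"

lemma delta_ge: "i < p \<Longrightarrow> \<bar>\<gamma> $ i - \<beta>0 $ i\<bar> \<le> \<delta>"
  using linf_norm_ge[of i "\<gamma> - \<beta>0"] \<gamma> \<beta>0 by simp

text \<open>Noise, estimation error and bias each get a share of \<epsilon>/3.\<close>

lemma linf_prob_le_gen:
  assumes \<epsilon>: "\<epsilon> > 0" and close: "\<And>i. i < p \<Longrightarrow> \<bar>bhat $ i - \<beta>0 $ i\<bar> \<le> \<epsilon> / 3"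
  shows "posterior_linf_prob X \<gamma> a b c bhat s \<beta>0 \<epsilon> \<le>
    err (\<epsilon> / 3) + measure post.Post (post.event (\<lambda>x v g. u g * \<delta> > \<epsilon> / 3 \<and> g > 0))"
proof -
  interpret prob_space post.Post by (rule pp.proper)
  let ?A = "post.noise (\<epsilon> / 3)"
  let ?B = "post.event (\<lambda>x v g. u g * \<delta> > \<epsilon> / 3 \<and> g > 0)"
  let ?Z = "post.event (\<lambda>x v g. \<not> g > 0)"
  have B: "?B \<in> sets post.Post" by (rule g_event_in_sets) measurable
  have Z: "?Z \<in> sets post.Post" by (rule g_event_in_sets) measurable
  have sub: "far \<epsilon> \<subseteq> ?A \<union> (?B \<union> ?Z)"
  proof (rule subsetI, rule ccontr)
    fix w assume w: "w \<in> far \<epsilon>" "w \<notin> ?A \<union> (?B \<union> ?Z)"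
    obtain x v g where xvg: "w = (x, v, g)" by (cases w) auto
    obtain i where i: "i < p" "\<bar>x i - \<beta>0 $ i\<bar> > \<epsilon>" using w(1) xvg by auto
    have g: "g > 0" and ud: "u g * \<delta> \<le> \<epsilon> / 3" and "\<forall>i<p. \<not> \<bar>x i - post.mu g i\<bar> > \<epsilon> / 3"
      using w xvg by auto
    with i(1) have n: "\<bar>x i - post.mu g i\<bar> \<le> \<epsilon> / 3" by (meson not_less)
    have "\<bar>u g * (\<gamma> $ i - \<beta>0 $ i)\<bar> \<le> u g * \<delta>"
      unfolding abs_mult using g delta_ge[OF i(1)] by (intro mult_mono) auto
    then show False
      using deviation_le[OF g i(1) close[OF i(1)], of "x i"] ud i(2) n by linarith
  qed
  have "posterior_linf_prob X \<gamma> a b c bhat s \<beta>0 \<epsilon> \<le> prob (?A \<union> (?B \<union> ?Z))"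
    unfolding linf_prob_eq[OF \<epsilon>] by (rule finite_measure_mono[OF sub]) (intro sets.Un noise_in_sets B Z)
  also have "\<dots> \<le> prob ?A + prob (?B \<union> ?Z)"
    by (rule measure_Un_le) (intro sets.Un noise_in_sets B Z)+
  also have "prob (?B \<union> ?Z) \<le> prob ?B + prob ?Z"
    by (rule measure_Un_le[OF B Z])
  finally show ?thesis using err_bound[of "\<epsilon> / 3"] \<epsilon> prob_g_nonpos by simp
qed

lemma linf_prob_le_small:
  assumes \<epsilon>: "\<epsilon> > 0" and close: "\<And>i. i < p \<Longrightarrow> \<bar>bhat $ i - \<beta>0 $ i\<bar> \<le> \<epsilon> / 3" and \<delta>: "\<delta> \<le> \<epsilon> / 3"
  shows "posterior_linf_prob X \<gamma> a b c bhat s \<beta>0 \<epsilon> \<le> err (\<epsilon> / 3)"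
proof -
  have "\<not> u g * \<delta> > \<epsilon> / 3" if "g > 0" for g
  proof -
    have "u g * \<delta> \<le> 1 * \<delta>" by (rule mult_right_mono) (use that linf_norm_nonneg in auto)
    then show ?thesis using \<delta> by linarith
  qed
  then have "post.event (\<lambda>x v g. u g * \<delta> > \<epsilon> / 3 \<and> g > 0) = {}" by auto
  then have "measure post.Post (post.event (\<lambda>x v g. u g * \<delta> > \<epsilon> / 3 \<and> g > 0)) = 0"
    by (simp only: measure_empty)
  then show ?thesis using linf_prob_le_gen[OF \<epsilon> close] by linarith
qed

lemma linf_prob_le_large:
  assumes \<epsilon>: "\<epsilon> > 0" and close: "\<And>i. i < p \<Longrightarrow> \<bar>bhat $ i - \<beta>0 $ i\<bar> \<le> \<epsilon> / 3"
    and \<delta>: "\<delta> > 0" and T: "TT > 0"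
  shows "posterior_linf_prob X \<gamma> a b c bhat s \<beta>0 \<epsilon> \<le>
    err (\<epsilon> / 3) + 3 * \<delta> / (TT * \<epsilon>) * (qq * BB) / (real n + a - real p - c)"
proof -
  interpret prob_space post.Post by (rule pp.proper)
  \<comment> \<open>The value of T u at which u \<delta> reaches \<epsilon>/3, so that Markov's
    inequality for T u applies.\<close>
  define \<kappa> where "\<kappa> = TT * \<epsilon> / (3 * \<delta>)"
  have \<kappa>: "\<kappa> > 0" using T \<epsilon> \<delta> by (simp add: \<kappa>_def)
  have "prob (post.event (\<lambda>x v g. u g * \<delta> > \<epsilon> / 3 \<and> g > 0)) \<le> prob (post.event (\<lambda>x v g. TT / (g + 1) > \<kappa>))"
  proof (rule finite_measure_mono)
    show "post.event (\<lambda>x v g. TT / (g + 1) > \<kappa>) \<in> sets post.Post"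
      by (rule g_event_in_sets) measurable
    have "TT / (g + 1) > \<kappa>" if "u g * \<delta> > \<epsilon> / 3" for g
    proof -
      have "(TT / \<delta>) * (u g * \<delta>) > (TT / \<delta>) * (\<epsilon> / 3)" using that T \<delta> by (intro mult_strict_left_mono) auto
      then show ?thesis using \<delta> by (simp add: \<kappa>_def mult.commute)
    qed
    then show "post.event (\<lambda>x v g. u g * \<delta> > \<epsilon> / 3 \<and> g > 0) \<subseteq>
      post.event (\<lambda>x v g. TT / (g + 1) > \<kappa>)" by auto
  qed
  also have "\<dots> \<le> (1 / \<kappa>) * (qq * BB) / (Nn - qq - 2)"
    by (rule pp.prob_shrinkage_gt[OF _ \<kappa>]) (use gap in simp)
  also have "1 / \<kappa> = 3 * \<delta> / (TT * \<epsilon>)" by (simp add: \<kappa>_def)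
  also have "Nn - qq - 2 = real n + a - real p - c" by simp
  finally show ?thesis using linf_prob_le_gen[OF \<epsilon> close] by simp
qed

text \<open>At the coordinate where \<delta> is attained, u \<ge> \<kappa> forces a bias above 3
  \<epsilon>. Noise and estimation error remove at most \<epsilon> each, so the deviation from
  \<beta>0 still exceeds \<epsilon>.\<close>

lemma linf_prob_ge:
  assumes \<epsilon>: "\<epsilon> > 0" and close: "\<And>i. i < p \<Longrightarrow> \<bar>bhat $ i - \<beta>0 $ i\<bar> \<le> \<epsilon>"
    and \<kappa>: "\<kappa> > 0" "\<kappa> * \<delta> > 3 * \<epsilon>" and q: "qq > 2"
  shows "posterior_linf_prob X \<gamma> a b c bhat s \<beta>0 \<epsilon> \<ge> 1 - err \<epsilon> - \<kappa> * (TT * Nn / BB + qq) / (qq - 2)"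
proof -
  interpret prob_space post.Post by (rule pp.proper)
  let ?E = "far \<epsilon>"
  let ?A = "post.noise \<epsilon>"
  let ?B = "post.event (\<lambda>x v g. u g < \<kappa>)"
  let ?Z = "post.event (\<lambda>x v g. \<not> g > 0)"
  have sets: "?E \<in> events" "?A \<in> events" "?B \<in> events" "?Z \<in> events"
    using linf_event(2)[OF \<epsilon>] noise_in_sets g_event_in_sets[of "\<lambda>g. u g < \<kappa>"] g_event_in_sets[of "\<lambda>g. \<not> g > 0"] by auto
  have "\<delta> > 0" using \<kappa> \<epsilon> by (smt (verit) mult_nonneg_nonpos)
  then obtain i where i: "i < p" "\<bar>\<gamma> $ i - \<beta>0 $ i\<bar> = \<delta>"
    by (rule linf_norm_attained) (use \<gamma> \<beta>0 in auto)
  have "space post.Post \<subseteq> ?E \<union> (?A \<union> (?B \<union> ?Z))"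
  proof (rule subsetI, rule ccontr)
    fix w assume w: "w \<in> space post.Post" "w \<notin> ?E \<union> (?A \<union> (?B \<union> ?Z))"
    obtain x v g where xvg: "w = (x, v, g)" by (cases w) auto
    have "x \<in> space D.P" using w(1) xvg by (simp add: post.Post_def space_scale_measure post.space_U)
    then have nE: "\<forall>i<p. \<not> \<epsilon> < \<bar>x i - \<beta>0 $ i\<bar>" and nA: "\<forall>i<p. \<not> \<epsilon> < \<bar>x i - post.mu g i\<bar>"
      and nB: "\<not> u g < \<kappa>" and g: "0 < g"
      using w(2) xvg by auto
    have "\<bar>u g * (\<gamma> $ i - \<beta>0 $ i)\<bar> = u g * \<delta>" using g i by (simp add: abs_mult)
    moreover have "u g * \<delta> \<ge> \<kappa> * \<delta>" using nB \<open>\<delta> > 0\<close> by (intro mult_right_mono) auto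
    moreover have "\<bar>x i - \<beta>0 $ i\<bar> \<le> \<epsilon>" "\<bar>x i - post.mu g i\<bar> \<le> \<epsilon>" using nE nA i(1) by (auto simp: not_less)
    ultimately show False
      using deviation_le[OF g i(1) close[OF i(1)], of "x i"] \<kappa>(2) by linarith
  qed
  then have "1 \<le> prob (?E \<union> (?A \<union> (?B \<union> ?Z)))"
    using sets by (subst prob_space[symmetric]) (intro finite_measure_mono, auto)
  also have "\<dots> \<le> prob ?E + prob (?A \<union> (?B \<union> ?Z))" using sets by (intro measure_Un_le) auto
  also have "prob (?A \<union> (?B \<union> ?Z)) \<le> prob ?A + prob (?B \<union> ?Z)" using sets by (intro measure_Un_le) auto
  also have "prob (?B \<union> ?Z) \<le> prob ?B + prob ?Z" using sets by (intro measure_Un_le) auto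
  finally have "1 \<le> prob ?E + (prob ?A + (prob ?B + prob ?Z))" by simp
  moreover have "prob ?A \<le> err \<epsilon>" by (rule err_bound[OF \<epsilon>])
  moreover have "prob ?B \<le> \<kappa> * (TT * Nn / BB + qq) / (qq - 2)" by (rule pp.prob_shrinkage_less[OF q \<kappa>(1)])
  ultimately show ?thesis unfolding linf_prob_eq[OF \<epsilon>] using prob_g_nonpos by linarith
qed

end

subsection \<open>Almost sure behaviour of the data\<close>

context full_rank_design
begin

text \<open>Row j of the pseudoinverse of the design: coordinate j of the least squares estimate is
  its inner product with the observations.\<close>

definition weight :: "nat \<Rightarrow> nat \<Rightarrow> real" where
  "weight j = D.lin (\<lambda>k. Gi $$ (k, j))"

lemma beta_hat_weight:
  assumes j: "j < p"
  shows "D.beta_hat y j = (\<Sum>l<n. weight j l * y l)"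
proof -
  have sym: "Gi $$ (j, k) = Gi $$ (k, j)" if "k < p" for k
    using arg_cong[OF Gi_sym, of "\<lambda>M. M $$ (k, j)"] Gi that j by simp
  have "D.beta_hat y j = (\<Sum>k<p. \<Sum>l<n. X $$ (l, k) * Gi $$ (k, j) * y l)"
    unfolding D.beta_hat_def sum_distrib_left by (intro sum.cong refl) (auto simp: sym mult_ac)
  also have "\<dots> = (\<Sum>l<n. \<Sum>k<p. X $$ (l, k) * Gi $$ (k, j) * y l)" by (rule sum.swap)
  finally show ?thesis by (simp add: weight_def D.lin_def sum_distrib_right)
qed

lemma weight_lin: "j < p \<Longrightarrow> (\<Sum>l<n. weight j l * D.lin z l) = z j"
  unfolding weight_def using D.inner_V_column[of j z] by (simp add: mult.commute)

text \<open>The squared length is the diagonal entry of \<open>Gi\<close>, by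
  \<open>weight_lin\<close> at column j of \<open>Gi\<close>.\<close>

lemma weight_norm: "j < p \<Longrightarrow> (\<Sum>l<n. (weight j l)\<^sup>2) \<le> L / n"
  using weight_lin[of j "\<lambda>k. Gi $$ (k, j)"] Gi_diag[of j] by (simp add: weight_def power2_eq_square)

lemma beta_hat_shift: "j < p \<Longrightarrow> D.beta_hat (\<lambda>i. D.lin z i + y i) j = z j + D.beta_hat y j"
  by (simp add: beta_hat_weight distrib_left sum.distrib weight_lin)

lemma resid_shift: "D.resid (\<lambda>i. D.lin z i + y i) = D.resid y"
proof -
  have "D.lin (D.beta_hat (\<lambda>i. D.lin z i + y i)) i = D.lin z i + D.lin (D.beta_hat y) i" for i
  proof -
    have "D.lin (D.beta_hat (\<lambda>i. D.lin z i + y i)) i = D.lin (\<lambda>j. z j + D.beta_hat y j) i"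
      by (rule D.lin_cong) (rule beta_hat_shift)
    then show ?thesis by (simp add: D.lin_def distrib_left sum.distrib)
  qed
  then show ?thesis by (simp add: D.resid_def)
qed

text \<open>Pythagoras at the zero coefficient vector splits \<bar>y\<bar>^2 into residual and
  fitted parts, both nonnegative.\<close>

lemma qn_beta_hat_le: "D.qn (D.beta_hat y) \<le> (\<Sum>i<n. (y i)\<^sup>2)" and resid_le: "D.resid y \<le> (\<Sum>i<n. (y i)\<^sup>2)"
proof -
  have "(\<Sum>i<n. (y i)\<^sup>2) = D.resid y + D.qn (\<lambda>j. (- 1) * D.beta_hat y j)"
    using D.pythagoras[of y "\<lambda>_. 0"] by (simp add: D.lin_def)
  then have "(\<Sum>i<n. (y i)\<^sup>2) = D.resid y + D.qn (D.beta_hat y)" unfolding D.qn_scale by simp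
  moreover have "D.resid y \<ge> 0" by (simp add: D.resid_def sum_nonneg)
  ultimately show "D.qn (D.beta_hat y) \<le> (\<Sum>i<n. (y i)\<^sup>2)" "D.resid y \<le> (\<Sum>i<n. (y i)\<^sup>2)"
    using D.qn_nonneg[of "D.beta_hat y"] by auto
qed

text \<open>Residuals are orthogonal to \<open>D.lin z\<close>, so fitted values may be replaced by
  y itself in the cross term. With y the errors, that term becomes one linear form in them, as
  \<open>AE_cross_term\<close> requires.\<close>

lemma qn_add:
  "D.qn (\<lambda>j. z j + D.beta_hat y j) = D.qn z + 2 * (\<Sum>i<n. D.lin z i * y i) + D.qn (D.beta_hat y)"
proof -
  have "D.lin (\<lambda>j. z j + D.beta_hat y j) i = D.lin z i + D.lin (D.beta_hat y) i" for i
    by (simp add: D.lin_def distrib_left sum.distrib)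
  moreover have "(\<Sum>i<n. D.lin z i * y i) = (\<Sum>i<n. D.lin z i * D.lin (D.beta_hat y) i)"
    using D.inner_lin_resid[of z y] by (simp add: right_diff_distrib sum_subtractf)
  ultimately show ?thesis
    by (simp add: D.qn_def power2_sum sum.distrib sum_distrib_left mult.assoc)
qed

lemma qn_add_le: "D.qn (\<lambda>j. z j + D.beta_hat y j) \<le> 2 * D.qn z + 2 * (\<Sum>i<n. (y i)\<^sup>2)"
proof -
  have "D.lin (\<lambda>j. z j + D.beta_hat y j) i = D.lin z i + D.lin (D.beta_hat y) i" for i
    by (simp add: D.lin_def distrib_left sum.distrib)
  moreover have "(s + t)\<^sup>2 \<le> 2 * s\<^sup>2 + 2 * t\<^sup>2" for s t :: real
    using zero_le_power2[of "s - t"] by (simp add: power2_sum power2_diff)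
  ultimately have "D.qn (\<lambda>j. z j + D.beta_hat y j) \<le> (\<Sum>i<n. 2 * (D.lin z i)\<^sup>2 + 2 * (D.lin (D.beta_hat y) i)\<^sup>2)"
    unfolding D.qn_def by (intro sum_mono) simp
  also have "\<dots> = 2 * D.qn z + 2 * D.qn (D.beta_hat y)"
    by (simp add: D.qn_def sum.distrib sum_distrib_left)
  finally show ?thesis using qn_beta_hat_le[of y] by simp
qed

end

lemma summable_exp_neg: "h > 0 \<Longrightarrow> summable (\<lambda>n. exp (- h * real n))"
proof -
  assume "h > 0"
  then have "summable (\<lambda>n. (exp (- h)) ^ n)" by (intro summable_geometric) simp
  then show ?thesis by (simp add: exp_of_nat_mult[symmetric] mult.commute)
qed

lemma mvn_distributed_imp_iid_normal:
  assumes e: "mvn_distributed M e (0\<^sub>v n) (\<sigma>\<^sup>2 \<cdot>\<^sub>m 1\<^sub>m n)" and \<sigma>: "\<sigma> > 0"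
  shows "iid_normal M n \<sigma> (\<lambda>\<omega>. \<lambda>i\<in>{..<n}. e \<omega> $ i)"
proof -
  have "mat_inv (\<sigma>\<^sup>2 \<cdot>\<^sub>m 1\<^sub>m n) = (1 / \<sigma>\<^sup>2) \<cdot>\<^sub>m 1\<^sub>m n"
  proof (rule mat_inv_eqI[of _ n])
    have "(\<sigma>\<^sup>2 \<cdot>\<^sub>m 1\<^sub>m n) * ((1 / \<sigma>\<^sup>2) \<cdot>\<^sub>m 1\<^sub>m n) = \<sigma>\<^sup>2 \<cdot>\<^sub>m (1\<^sub>m n * ((1 / \<sigma>\<^sup>2) \<cdot>\<^sub>m 1\<^sub>m n))"
      by (rule mult_smult_assoc_mat[of _ n n _ n]) auto
    also have "\<dots> = 1\<^sub>m n" using \<sigma> by (intro eq_matI) auto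
    finally show "(\<sigma>\<^sup>2 \<cdot>\<^sub>m 1\<^sub>m n) * ((1 / \<sigma>\<^sup>2) \<cdot>\<^sub>m 1\<^sub>m n) = 1\<^sub>m n" .
  qed auto
  moreover have "vec n x - 0\<^sub>v n = vec n x" for x :: "nat \<Rightarrow> real" by auto
  moreover have "((1 / \<sigma>\<^sup>2) \<cdot>\<^sub>m 1\<^sub>m n) *\<^sub>v vec n x = (1 / \<sigma>\<^sup>2) \<cdot>\<^sub>v vec n x" for x
    by (subst smult_mat_mult_vec[of _ n n]) auto
  moreover have "vec n x \<bullet> ((1 / \<sigma>\<^sup>2) \<cdot>\<^sub>v vec n x) = (\<Sum>i<n. (x i)\<^sup>2) / \<sigma>\<^sup>2" for x
    by (simp add: scalar_prod_self_sum)
  ultimately have dens: "mvn_density (0\<^sub>v n) (\<sigma>\<^sup>2 \<cdot>\<^sub>m 1\<^sub>m n) (vec n x) =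
      exp (- ((\<Sum>i<n. (x i)\<^sup>2) / \<sigma>\<^sup>2) / 2) / sqrt ((2 * pi) ^ n * (\<sigma>\<^sup>2) ^ n)" for x
    by (simp add: mvn_density_def)
  have "mvn_density (0\<^sub>v n) (\<sigma>\<^sup>2 \<cdot>\<^sub>m 1\<^sub>m n) (vec n x) = (\<Prod>i<n. normal_density 0 \<sigma> (x i))" for x
  proof -
    have "(\<Prod>i<n. normal_density 0 \<sigma> (x i)) = (\<Prod>i<n. 1 / sqrt (2 * pi * \<sigma>\<^sup>2)) * (\<Prod>i<n. exp (- (x i)\<^sup>2 / (2 * \<sigma>\<^sup>2)))"
      unfolding prod.distrib[symmetric] by (simp add: normal_density_def)
    also have "(\<Prod>i<n. exp (- (x i)\<^sup>2 / (2 * \<sigma>\<^sup>2))) = exp (- ((\<Sum>i<n. (x i)\<^sup>2) / \<sigma>\<^sup>2) / 2)"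
      by (simp add: exp_sum[symmetric] sum_negf sum_divide_distrib mult.commute)
    also have "(\<Prod>i<n. 1 / sqrt (2 * pi * \<sigma>\<^sup>2)) = 1 / sqrt ((2 * pi) ^ n * (\<sigma>\<^sup>2) ^ n)"
      by (simp only: prod_constant card_lessThan power_one_over power_mult_distrib[symmetric] real_sqrt_power)
    finally show ?thesis unfolding dens by simp
  qed
  then have "(\<lambda>x. ennreal (mvn_density (0\<^sub>v n) (\<sigma>\<^sup>2 \<cdot>\<^sub>m 1\<^sub>m n) (vec n x))) = (\<lambda>z. \<Prod>i<n. ennreal (normal_density 0 \<sigma> (z i)))"
    by (simp add: prod_ennreal)
  then show ?thesis
    using e by (simp add: mvn_distributed_def iid_normal_def)
qed

locale hyper_g_model = prob_space M
  for M :: "'w measure" +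
  fixes p :: "nat \<Rightarrow> nat"
    and \<alpha> lmin L a b c \<sigma>0 :: real
    and X :: "nat \<Rightarrow> real mat"
    and \<gamma> \<beta>0 :: "nat \<Rightarrow> real vec"
    and e Y :: "nat \<Rightarrow> 'w \<Rightarrow> real vec"
  assumes p_less: "\<And>n. n \<ge> 1 \<Longrightarrow> p n < n"
    and p_lim: "(\<lambda>n. real (p n) / real n) \<longlonglongrightarrow> \<alpha>"
    and \<alpha>: "0 \<le> \<alpha>" "\<alpha> < 1"
    and X_dim: "\<And>n. n \<ge> 1 \<Longrightarrow> X n \<in> carrier_mat n (p n)"
    and X_rank: "\<And>n. n \<ge> 1 \<Longrightarrow> vec_space.rank n (X n) = p n"
    and lmin_pos: "0 < lmin" and L_pos: "0 < L"
    and eigenvalues: "\<And>n l. n \<ge> 1 \<Longrightarrow> eigenvalue (real n \<cdot>\<^sub>m mat_inv ((X n)\<^sup>T * X n)) l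
          \<Longrightarrow> lmin \<le> l \<and> l \<le> L"
    and \<gamma>_dim: "\<And>n. n \<ge> 1 \<Longrightarrow> \<gamma> n \<in> carrier_vec (p n)"
    and \<beta>0_dim: "\<And>n. n \<ge> 1 \<Longrightarrow> \<beta>0 n \<in> carrier_vec (p n)"
    and b: "b \<ge> 0"
    and \<sigma>0: "\<sigma>0 > 0"
    and e_distr: "\<And>n. n \<ge> 1 \<Longrightarrow> mvn_distributed M (e n) (0\<^sub>v n) (\<sigma>0\<^sup>2 \<cdot>\<^sub>m 1\<^sub>m n)"
    and Y_eq: "\<And>n \<omega>. n \<ge> 1 \<Longrightarrow> \<omega> \<in> space M \<Longrightarrow> Y n \<omega> = X n *\<^sub>v \<beta>0 n + e n \<omega>"
    and proper: "\<forall>\<^sub>F n in sequentially. AE \<omega> in M.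
          prob_space (posterior (X n) (\<gamma> n) a b c (ols (X n) (Y n \<omega>)) (rss (X n) (Y n \<omega>)))"
begin

text \<open>Restricted to indices below n because points of the product space are extensional
  functions.\<close>

definition x :: "nat \<Rightarrow> 'w \<Rightarrow> nat \<Rightarrow> real" where
  "x n \<omega> = (\<lambda>i\<in>{..<n}. e n \<omega> $ i)"

abbreviation "bh n \<omega> \<equiv> ols (X n) (Y n \<omega>)"
abbreviation "S n \<omega> \<equiv> rss (X n) (Y n \<omega>)"
abbreviation "Xf n \<equiv> \<lambda>i j. X n $$ (i, j)"
abbreviation "Vf n \<equiv> \<lambda>i j. mat_inv ((X n)\<^sup>T * X n) $$ (i, j)"
abbreviation "lin n \<equiv> design.lin (p n) (Xf n)"
abbreviation "qn n \<equiv> design.qn n (p n) (Xf n)"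
abbreviation "beta_hat n \<equiv> design.beta_hat n (p n) (Xf n) (Vf n)"
abbreviation "resid n \<equiv> design.resid n (p n) (Xf n) (Vf n)"
abbreviation "\<delta> n \<equiv> linf_norm (\<gamma> n - \<beta>0 n)"
abbreviation "DD n \<equiv> (l2_norm (\<gamma> n - \<beta>0 n))\<^sup>2"
abbreviation "ww n \<equiv> \<lambda>j. \<beta>0 n $ j - \<gamma> n $ j"

lemma design_n: "n \<ge> 1 \<Longrightarrow> full_rank_design n (p n) (X n) lmin L"
  using p_less[of n] X_dim[of n] X_rank[of n] lmin_pos L_pos eigenvalues[of n]
  by unfold_locales (auto intro: less_imp_le)

lemma iid: "n \<ge> 1 \<Longrightarrow> iid_normal M n \<sigma>0 (x n)"
  unfolding x_def using mvn_distributed_imp_iid_normal[OF e_distr \<sigma>0] by simp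

lemma x_meas: "n \<ge> 1 \<Longrightarrow> i < n \<Longrightarrow> (\<lambda>\<omega>. x n \<omega> i) \<in> borel_measurable M"
  by (rule iid_normal_component_measurable[OF iid])

lemma Y_index:
  assumes n: "n \<ge> 1" and \<omega>: "\<omega> \<in> space M"
  shows "Y n \<omega> \<in> carrier_vec n" and "i < n \<Longrightarrow> Y n \<omega> $ i = lin n (\<lambda>j. \<beta>0 n $ j) i + x n \<omega> i"
proof -
  have e: "e n \<omega> \<in> carrier_vec n" using e_distr[OF n] \<omega> by (simp add: mvn_distributed_def)
  show "Y n \<omega> \<in> carrier_vec n" using e X_dim[OF n] \<beta>0_dim[OF n] by (simp add: Y_eq[OF n \<omega>])
  show "Y n \<omega> $ i = lin n (\<lambda>j. \<beta>0 n $ j) i + x n \<omega> i" if "i < n"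
    using that e full_rank_design.lin_eq[OF design_n[OF n] \<beta>0_dim[OF n] that] X_dim[OF n]
    by (simp add: Y_eq[OF n \<omega>] x_def)
qed

lemma ols_minus:
  assumes n: "n \<ge> 1" and \<omega>: "\<omega> \<in> space M" and j: "j < p n"
  shows "bh n \<omega> $ j - \<beta>0 n $ j = beta_hat n (x n \<omega>) j"
proof -
  interpret full_rank_design n "p n" "X n" lmin L by (rule design_n[OF n])
  have "bh n \<omega> $ j = D.beta_hat (\<lambda>i. Y n \<omega> $ i) j" by (rule ols_index[OF Y_index(1)[OF n \<omega>] j])
  also have "\<dots> = D.beta_hat (\<lambda>i. D.lin (\<lambda>j. \<beta>0 n $ j) i + x n \<omega> i) j"
    unfolding beta_hat_weight[OF j] using Y_index(2)[OF n \<omega>] by simp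
  also have "\<dots> = \<beta>0 n $ j + D.beta_hat (x n \<omega>) j" by (rule beta_hat_shift[OF j])
  finally show ?thesis by simp
qed

lemma rss_eq_resid:
  assumes n: "n \<ge> 1" and \<omega>: "\<omega> \<in> space M"
  shows "S n \<omega> = resid n (x n \<omega>)"
proof -
  interpret full_rank_design n "p n" "X n" lmin L by (rule design_n[OF n])
  have "S n \<omega> = D.resid (\<lambda>i. Y n \<omega> $ i)" by (rule rss_eq[OF Y_index(1)[OF n \<omega>]])
  also have "\<dots> = D.resid (\<lambda>i. D.lin (\<lambda>j. \<beta>0 n $ j) i + x n \<omega> i)"
    unfolding D.resid_def D.beta_hat_def using Y_index(2)[OF n \<omega>] by simp
  finally show ?thesis unfolding resid_shift .
qed

lemma T_eq:
  assumes n: "n \<ge> 1" and \<omega>: "\<omega> \<in> space M"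
  shows "qn n (\<lambda>j. bh n \<omega> $ j - \<gamma> n $ j) = qn n (\<lambda>j. ww n j + beta_hat n (x n \<omega>) j)"
proof -
  interpret full_rank_design n "p n" "X n" lmin L by (rule design_n[OF n])
  show ?thesis by (rule D.qn_cong) (use ols_minus[OF n \<omega>] in force)
qed

text \<open>Chernoff and a union bound: at most n centred Gaussian forms exceed \<eta> sqrt n
  standard deviations (up to \<sigma>0) with probability at most 2 n exp(- h n). The bound is
  relative to the length of the weights, so it covers both the estimator, with short weights, and
  the cross term, with long ones.\<close>

lemma AE_linear_forms:
  fixes w :: "nat \<Rightarrow> nat \<Rightarrow> nat \<Rightarrow> real"
  assumes \<eta>: "\<eta> > 0" and m: "\<And>n. n \<ge> 1 \<Longrightarrow> m n \<le> n"
  shows "AE \<omega> in M. \<forall>\<^sub>F n in sequentially. \<forall>j<m n.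
    \<bar>\<Sum>l<n. w n j l * x n \<omega> l\<bar> \<le> \<eta> * sqrt n * sqrt (\<Sum>l<n. (w n j l)\<^sup>2)"
proof -
  define W where "W n j = (\<Sum>l<n. (w n j l)\<^sup>2)" for n j
  define d where "d n j \<omega> = (\<Sum>l<n. w n j l * x n \<omega> l)" for n j \<omega>
  \<comment> \<open>The optimal Chernoff parameter: the mean of the exponential is then exp(h n) and
    the threshold exp(2 h n). If all weights vanish, the quotient is 0 by convention and the form is
    0 too.\<close>
  define s where "s n j = \<eta> * sqrt n / (\<sigma>0\<^sup>2 * sqrt (W n j))" for n j
  define h where "h = \<eta>\<^sup>2 / (2 * \<sigma>0\<^sup>2)"
  have h: "h > 0" using \<eta> \<sigma>0 by (simp add: h_def)
  have Wn: "W n j \<ge> 0" for n j by (simp add: W_def sum_nonneg)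
  define f where "f n \<omega> = (\<Sum>j<m n. exp (s n j * d n j \<omega>) + exp (- s n j * d n j \<omega>))" for n \<omega>
  have "AE \<omega> in M. \<forall>\<^sub>F n in sequentially. f n \<omega> < exp (2 * h * real n)"
  proof (rule AE_eventually_less[where K = "\<lambda>n. 2 * real n * exp (h * real n)"])
    fix n :: nat assume n: "n \<ge> 1"
    have lin_exp: "exp (r * d n j \<omega>) = exp (\<Sum>l<n. (r * w n j l) * x n \<omega> l)" for r j \<omega>
      by (simp add: d_def sum_distrib_left mult.assoc)
    have meas: "(\<lambda>\<omega>. exp (r * d n j \<omega>)) \<in> borel_measurable M" for r j
      unfolding lin_exp using x_meas[OF n] by measurable
    have mgf: "(\<integral>\<^sup>+\<omega>. ennreal (exp (r * d n j \<omega>)) \<partial>M) \<le> ennreal (exp (h * real n))"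
      if r: "r\<^sup>2 = (s n j)\<^sup>2" for r j
    proof -
      have "(\<integral>\<^sup>+\<omega>. ennreal (exp (r * d n j \<omega>)) \<partial>M) = ennreal (exp (\<sigma>0\<^sup>2 * (\<Sum>l<n. (r * w n j l)\<^sup>2) / 2))"
        unfolding lin_exp by (rule iid_normal_linear_mgf[OF iid[OF n] \<sigma>0])
      also have "(\<Sum>l<n. (r * w n j l)\<^sup>2) = (s n j)\<^sup>2 * W n j"
        by (simp add: power_mult_distrib sum_distrib_left r W_def)
      also have "ennreal (exp (\<sigma>0\<^sup>2 * ((s n j)\<^sup>2 * W n j) / 2)) \<le> ennreal (exp (h * real n))"
      proof (cases "W n j = 0")
        case False
        then have "\<sigma>0\<^sup>2 * ((s n j)\<^sup>2 * W n j) / 2 = h * real n"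
          using Wn[of n j] \<sigma>0 by (simp add: s_def h_def power_divide power_mult_distrib divide_simps)
        then show ?thesis by simp
      qed (use h in simp)
      finally show ?thesis .
    qed
    show "f n \<in> borel_measurable M"
      unfolding f_def by (intro borel_measurable_sum borel_measurable_add meas)
    have ma: "(\<lambda>\<omega>. ennreal (exp (r * d n j \<omega>))) \<in> borel_measurable M" for r j
      by (rule measurable_compose[OF meas measurable_ennreal])
    have "(\<integral>\<^sup>+\<omega>. ennreal (f n \<omega>) \<partial>M) = (\<integral>\<^sup>+\<omega>. (\<Sum>j<m n. ennreal (exp (s n j * d n j \<omega>)) + ennreal (exp (- s n j * d n j \<omega>))) \<partial>M)"
      unfolding f_def ennreal_plus[symmetric, OF exp_ge_zero exp_ge_zero]
      by (intro nn_integral_cong sum_ennreal[symmetric]) (simp add: add_nonneg_nonneg)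
    also have "\<dots> = (\<Sum>j<m n. (\<integral>\<^sup>+\<omega>. ennreal (exp (s n j * d n j \<omega>)) \<partial>M) + (\<integral>\<^sup>+\<omega>. ennreal (exp (- s n j * d n j \<omega>)) \<partial>M))"
      by (subst nn_integral_sum, intro borel_measurable_add ma)
        (rule sum.cong[OF refl], rule nn_integral_add; rule ma)
    also have "\<dots> \<le> (\<Sum>j<m n. ennreal (exp (h * real n)) + ennreal (exp (h * real n)))"
      by (intro sum_mono add_mono mgf) auto
    also have "\<dots> = ennreal (\<Sum>j<m n. exp (h * real n) + exp (h * real n))"
      unfolding ennreal_plus[symmetric, OF exp_ge_zero exp_ge_zero] by (rule sum_ennreal) (simp add: add_nonneg_nonneg)
    also have "\<dots> \<le> ennreal (2 * real n * exp (h * real n))"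
      using m[OF n] by (intro ennreal_leI) (simp add: mult_right_mono)
    finally show "(\<integral>\<^sup>+\<omega>. ennreal (f n \<omega>) \<partial>M) \<le> ennreal (2 * real n * exp (h * real n))" .
  next
    \<comment> \<open>Half of the rate h is given up to absorb the factor n of the union
      bound.\<close>
    have "(\<lambda>n. 2 * real n * exp (h * real n) / exp (2 * h * real n)) \<in> O(\<lambda>n. exp (- (h / 2) * real n))"
      using h by real_asymp
    then show "summable (\<lambda>n. 2 * real n * exp (h * real n) / exp (2 * h * real n))"
      by (rule summable_comparison_test_bigo[rotated]) (use summable_exp_neg[of "h / 2"] h in simp)
  qed auto
  then show ?thesis
  proof eventually_elim
    case (elim \<omega>)
    from elim eventually_ge_at_top[of 1] show ?case
    proof eventually_elim
      case (elim n)
      show ?case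
      proof (intro allI impI)
        fix j assume j: "j < m n"
        have "\<bar>d n j \<omega>\<bar> \<le> \<eta> * sqrt n * sqrt (W n j)"
        proof (cases "W n j = 0")
          case True
          then have "w n j l = 0" if "l < n" for l
            using that by (simp add: W_def sum_nonneg_eq_0_iff)
          then show ?thesis using Wn[of n j] \<eta> by (simp add: d_def)
        next
          case False
          then have Wp: "W n j > 0" using Wn[of n j] by simp
          have "exp (s n j * d n j \<omega>) + exp (- s n j * d n j \<omega>) \<le> f n \<omega>"
            unfolding f_def using j by (intro member_le_sum[of j "{..<m n}"]) (auto intro: add_nonneg_nonneg)
          moreover have "exp (s n j * d n j \<omega>) > 0" "exp (- s n j * d n j \<omega>) > 0" by auto
          ultimately have "exp (s n j * d n j \<omega>) < exp (2 * h * real n)" "exp (- s n j * d n j \<omega>) < exp (2 * h * real n)"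
            using elim(1) by linarith+
          then have "s n j * d n j \<omega> < 2 * h * real n" "s n j * (- d n j \<omega>) < 2 * h * real n" by simp_all
          moreover have "2 * h * real n = s n j * (\<eta> * sqrt n * sqrt (W n j))"
            using Wp \<sigma>0 by (simp add: h_def s_def power2_eq_square)
          moreover have "s n j > 0" using elim(2) \<eta> \<sigma>0 Wp by (simp add: s_def)
          ultimately have "s n j * d n j \<omega> < s n j * (\<eta> * sqrt n * sqrt (W n j))"
            "s n j * (- d n j \<omega>) < s n j * (\<eta> * sqrt n * sqrt (W n j))" and sp: "s n j > 0" by linarith+
          then have "d n j \<omega> < \<eta> * sqrt n * sqrt (W n j)" "- d n j \<omega> < \<eta> * sqrt n * sqrt (W n j)"
            unfolding mult_less_cancel_left_pos[OF sp] by blast+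
          then show ?thesis by (simp add: abs_le_iff)
        qed
        then show "\<bar>\<Sum>l<n. w n j l * x n \<omega> l\<bar> \<le> \<eta> * sqrt n * sqrt (\<Sum>l<n. (w n j l)\<^sup>2)"
          by (simp add: d_def W_def)
      qed
    qed
  qed
qed

lemma AE_ols_close:
  assumes \<epsilon>: "\<epsilon> > 0"
  shows "AE \<omega> in M. \<forall>\<^sub>F n in sequentially. \<forall>j<p n. \<bar>bh n \<omega> $ j - \<beta>0 n $ j\<bar> \<le> \<epsilon>"
proof -
  \<comment> \<open>Chosen because the weights have length at most sqrt (L/n), so that the bound
    becomes exactly \<epsilon>.\<close>
  have "\<epsilon> / sqrt L > 0" using \<epsilon> L_pos by simp
  then have "AE \<omega> in M. \<forall>\<^sub>F n in sequentially. \<forall>j<p n. \<bar>\<Sum>l<n. lin n (\<lambda>k. Vf n k j) l * x n \<omega> l\<bar> \<le>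
      \<epsilon> / sqrt L * sqrt n * sqrt (\<Sum>l<n. (lin n (\<lambda>k. Vf n k j) l)\<^sup>2)"
    by (rule AE_linear_forms) (simp add: less_imp_le p_less)
  with AE_space show ?thesis
  proof eventually_elim
    case (elim \<omega>)
    from elim(2) eventually_ge_at_top[of 1] show ?case
    proof eventually_elim
      case (elim n)
      note n = elim(2)
      interpret full_rank_design n "p n" "X n" lmin L by (rule design_n[OF n])
      show ?case
      proof (intro allI impI)
        fix j assume j: "j < p n"
        have "\<bar>bh n \<omega> $ j - \<beta>0 n $ j\<bar> = \<bar>\<Sum>l<n. weight j l * x n \<omega> l\<bar>"
          unfolding ols_minus[OF n \<open>\<omega> \<in> space M\<close> j] beta_hat_weight[OF j] ..
        also have "\<dots> \<le> \<epsilon> / sqrt L * sqrt n * sqrt (\<Sum>l<n. (weight j l)\<^sup>2)"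
          using elim(1) j by (simp add: weight_def)
        also have "\<dots> \<le> \<epsilon> / sqrt L * sqrt n * sqrt (L / n)"
          using weight_norm[OF j] \<epsilon> L_pos by (intro mult_left_mono real_sqrt_le_mono) auto
        also have "\<dots> = \<epsilon>" using n L_pos by (simp add: real_sqrt_divide)
        finally show "\<bar>bh n \<omega> $ j - \<beta>0 n $ j\<bar> \<le> \<epsilon>" .
      qed
    qed
  qed
qed

text \<open>Any bound of order n serves. The factor 4 \<sigma>0^2 is the inverse rate in
  \<open>iid_normal_square_mgf\<close>; with threshold exp(n) the probabilities are summable since
  sqrt 2 < exp 1.\<close>

lemma AE_square_bound: "AE \<omega> in M. \<forall>\<^sub>F n in sequentially. (\<Sum>i<n. (x n \<omega> i)\<^sup>2) < 4 * \<sigma>0\<^sup>2 * real n"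
proof -
  have "AE \<omega> in M. \<forall>\<^sub>F n in sequentially. exp (\<Sum>i<n. (x n \<omega> i)\<^sup>2 / (4 * \<sigma>0\<^sup>2)) < exp 1 ^ n"
  proof (rule AE_eventually_less[where K = "\<lambda>n. sqrt 2 ^ n"])
    fix n :: nat assume n: "n \<ge> 1"
    show "(\<lambda>\<omega>. exp (\<Sum>i<n. (x n \<omega> i)\<^sup>2 / (4 * \<sigma>0\<^sup>2))) \<in> borel_measurable M"
      using x_meas[OF n] by measurable
    show "(\<integral>\<^sup>+\<omega>. ennreal (exp (\<Sum>i<n. (x n \<omega> i)\<^sup>2 / (4 * \<sigma>0\<^sup>2))) \<partial>M) \<le> ennreal (sqrt 2 ^ n)"
      by (simp add: iid_normal_square_mgf[OF iid[OF n] \<sigma>0])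
  next
    have "sqrt 2 < (2 :: real)" by (rule real_less_lsqrt) auto
    also have "2 \<le> exp (1 :: real)" using exp_ge_add_one_self[of 1] by simp
    finally have "norm (sqrt 2 / exp 1 :: real) < 1" by simp
    then show "summable (\<lambda>n. sqrt 2 ^ n / exp 1 ^ n :: real)"
      unfolding power_divide[symmetric] by (rule summable_geometric)
  qed auto
  then show ?thesis
  proof eventually_elim
    case (elim \<omega>)
    then show ?case
    proof eventually_elim
      case (elim n)
      then have "exp (\<Sum>i<n. (x n \<omega> i)\<^sup>2 / (4 * \<sigma>0\<^sup>2)) < exp (real n)"
        by (simp add: exp_of_nat_mult[symmetric])
      then have "(\<Sum>i<n. (x n \<omega> i)\<^sup>2) / (4 * \<sigma>0\<^sup>2) < real n" by (simp add: sum_divide_distrib)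
      then show ?case using \<sigma>0 by (simp add: field_simps)
    qed
  qed
qed

text \<open>The slope tends to 1 - \<alpha>; half of it leaves room for the constant shift
  r.\<close>

lemma eventually_gap: 
  "\<forall>\<^sub>F n in sequentially. real n - real (p n) + r \<ge> (1 - \<alpha>) / 2 * real n"
proof -
  have "(\<lambda>n. (1 - real (p n) / real n) + r / real n) \<longlonglongrightarrow> (1 - \<alpha>) + 0"
    by (intro tendsto_add tendsto_diff tendsto_const p_lim lim_const_over_n)
  then have "\<forall>\<^sub>F n in sequentially. (1 - real (p n) / real n) + r / real n > (1 - \<alpha>) / 2"
    by (rule order_tendstoD) (use \<alpha> in auto)
  then show ?thesis using eventually_gt_at_top[of 0]
    by eventually_elim (simp add: field_simps)
qed

text \<open>The moment generating function \<open>resid_mgf\<close> decays like \<open>exp (- (1 - \<alpha>) ln 2 n / 4)\<close> for large n;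
  the constant spends half of that rate.\<close>

definition c0 :: real where "c0 = \<sigma>0\<^sup>2 * (1 - \<alpha>) * ln 2 / 4"

lemma c0_pos: "c0 > 0"
  using \<sigma>0 \<alpha> by (simp add: c0_def)

text \<open>Makes the data regular (S > 0) and keeps T N / B of order n in the converse direction,
  even when b = 0.\<close>

lemma AE_rss_lower: "AE \<omega> in M. \<forall>\<^sub>F n in sequentially. S n \<omega> > c0 * real n"
proof -
  define h where "h = (1 - \<alpha>) * ln 2 / 8"
  have h: "h > 0" using \<alpha> by (simp add: h_def)
  have "AE \<omega> in M. \<forall>\<^sub>F n in sequentially. exp (- resid n (x n \<omega>) / (2 * \<sigma>0\<^sup>2)) < exp (- h * real n)"
  proof (rule AE_eventually_less[where K = "\<lambda>n. 2 powr (- (real n - real (p n)) / 2)"])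
    fix n :: nat assume n: "n \<ge> 1"
    interpret D: full_rank_design n "p n" "X n" lmin L by (rule design_n[OF n])
    have "(\<lambda>\<omega>. resid n (x n \<omega>)) \<in> borel_measurable M"
      by (rule measurable_compose[OF iid_normal_measurable[OF iid[OF n]] D.D.measurable_resid])
    then show "(\<lambda>\<omega>. exp (- resid n (x n \<omega>) / (2 * \<sigma>0\<^sup>2))) \<in> borel_measurable M" by measurable
    show "(\<integral>\<^sup>+\<omega>. ennreal (exp (- resid n (x n \<omega>) / (2 * \<sigma>0\<^sup>2))) \<partial>M) \<le> ennreal (2 powr (- (real n - real (p n)) / 2))"
      using D.D.resid_mgf[OF iid[OF n] \<sigma>0] by simp
  next
    show "summable (\<lambda>n. 2 powr (- (real n - real (p n)) / 2) / exp (- h * real n))"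
    proof (rule summable_comparison_test_ev[OF _ summable_exp_neg[OF h]])
      show "\<forall>\<^sub>F n in sequentially. norm (2 powr (- (real n - real (p n)) / 2) / exp (- h * real n)) \<le> exp (- h * real n)"
        using eventually_gap[of 0]
      proof eventually_elim
        case (elim n)
        have "- (real n - real (p n)) / 2 * ln 2 \<le> - ((1 - \<alpha>) / 2 * real n) / 2 * ln 2"
          using elim by (intro mult_right_mono divide_right_mono) auto
        also have "\<dots> = - h * real n + - h * real n" by (simp add: h_def)
        finally have "2 powr (- (real n - real (p n)) / 2) \<le> exp (- h * real n) * exp (- h * real n)"
          unfolding powr_def mult_exp_exp by simp
        then show ?case by (simp add: divide_le_eq)
      qed
    qed
  qed auto
  with AE_space show ?thesis
  proof eventually_elim
    case (elim \<omega>)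
    from elim(2) eventually_ge_at_top[of 1] show ?case
    proof eventually_elim
      case (elim n)
      have "2 * \<sigma>0\<^sup>2 * (h * real n) < resid n (x n \<omega>)"
        using elim(1) \<sigma>0 by (simp add: field_simps)
      moreover have "2 * \<sigma>0\<^sup>2 * (h * real n) = c0 * real n" by (simp add: h_def c0_def)
      ultimately show ?case using rss_eq_resid[OF elim(2) \<open>\<omega> \<in> space M\<close>] by simp
    qed
  qed
qed

lemma AE_cross_term:
  assumes \<eta>: "\<eta> > 0"
  shows "AE \<omega> in M. \<forall>\<^sub>F n in sequentially.
    \<bar>\<Sum>i<n. lin n (ww n) i * x n \<omega> i\<bar> \<le> \<eta> * sqrt n * sqrt (qn n (ww n))"
proof -
  have W: "(\<Sum>i<n. (lin n (ww n) i)\<^sup>2) = qn n (ww n)" if "n \<ge> 1" for n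
  proof -
    interpret D: full_rank_design n "p n" "X n" lmin L by (rule design_n[OF that])
    show ?thesis by (simp add: D.D.qn_def)
  qed
  have "AE \<omega> in M. \<forall>\<^sub>F n in sequentially. \<forall>j<(1 :: nat).
      \<bar>\<Sum>i<n. lin n (ww n) i * x n \<omega> i\<bar> \<le> \<eta> * sqrt n * sqrt (\<Sum>i<n. (lin n (ww n) i)\<^sup>2)"
    by (rule AE_linear_forms[OF \<eta>])
  then show ?thesis
  proof eventually_elim
    case (elim \<omega>)
    from elim eventually_ge_at_top[of 1] show ?case by eventually_elim (simp add: W)
  qed
qed

text \<open>Countably many null sets are united, which turns "eventually almost surely" into "almost
  surely eventually".\<close>

lemma AE_proper: "AE \<omega> in M. \<forall>\<^sub>F n in sequentially. prob_space (posterior (X n) (\<gamma> n) a b c (bh n \<omega>) (S n \<omega>))"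
proof -
  obtain n0 where n0: "\<And>n. n \<ge> n0 \<Longrightarrow> AE \<omega> in M. prob_space (posterior (X n) (\<gamma> n) a b c (bh n \<omega>) (S n \<omega>))"
    using proper by (auto simp: eventually_sequentially)
  have "AE \<omega> in M. \<forall>n. n \<ge> n0 \<longrightarrow> prob_space (posterior (X n) (\<gamma> n) a b c (bh n \<omega>) (S n \<omega>))"
    unfolding AE_all_countable using n0 by auto
  then show ?thesis
  proof eventually_elim
    case (elim \<omega>)
    then show ?case unfolding eventually_sequentially by blast
  qed
qed

end

subsection \<open>Consistency\<close>

context hyper_g_model
begin

definition gap :: "nat \<Rightarrow> real" where "gap n = real n + a - real (p n) - c"
definition qv :: "nat \<Rightarrow> real" where "qv n = real (p n) + c - 2"
definition er :: "nat \<Rightarrow> real \<Rightarrow> real \<Rightarrow> real" where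
  "er n s \<epsilon> = 8 * L / \<epsilon>\<^sup>2 / sqrt n * (b + s) / gap n"
abbreviation "plp n \<omega> \<epsilon> \<equiv> posterior_linf_prob (X n) (\<gamma> n) a b c (bh n \<omega>) (S n \<omega>) (\<beta>0 n) \<epsilon>"
abbreviation "close n \<omega> \<epsilon> \<equiv> \<forall>j<p n. \<bar>bh n \<omega> $ j - \<beta>0 n $ j\<bar> \<le> \<epsilon>"
abbreviation "regular n \<omega> \<equiv> S n \<omega> > 0 \<and> real n + a > 2 \<and> gap n > 0 \<and>
  prob_space (posterior (X n) (\<gamma> n) a b c (bh n \<omega>) (S n \<omega>))"

lemma setup_n:
  assumes "n \<ge> 1" "regular n \<omega>"
  shows "posterior_setup n (p n) (X n) lmin L (\<gamma> n) (bh n \<omega>) (\<beta>0 n) a b c (S n \<omega>)"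
proof -
  interpret full_rank_design n "p n" "X n" lmin L by (rule design_n[OF assms(1)])
  show ?thesis
    by (intro posterior_setup.intro posterior_setup_axioms.intro full_rank_design_axioms)
      (use assms p_less[of n] \<gamma>_dim[of n] \<beta>0_dim[of n] b ols_dim[of "Y n \<omega>"] in \<open>simp_all add: gap_def\<close>)
qed

lemma plp_le_small:
  assumes "n \<ge> 1" "regular n \<omega>" "\<epsilon> > 0" "close n \<omega> (\<epsilon> / 3)" "\<delta> n \<le> \<epsilon> / 3"
  shows "plp n \<omega> \<epsilon> \<le> er n (S n \<omega>) (\<epsilon> / 3)"
proof -
  interpret Q: posterior_setup n "p n" "X n" lmin L "\<gamma> n" "bh n \<omega>" "\<beta>0 n" a b c "S n \<omega>"
    by (rule setup_n[OF assms(1,2)])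
  show ?thesis using Q.linf_prob_le_small[OF assms(3) _ assms(5)] assms(4) by (simp add: Q.err_def er_def gap_def)
qed

lemma plp_le_large:
  assumes "n \<ge> 1" "regular n \<omega>" "\<epsilon> > 0" "close n \<omega> (\<epsilon> / 3)" "\<delta> n > 0"
    and T: "T = qn n (\<lambda>j. bh n \<omega> $ j - \<gamma> n $ j)" "T > 0"
  shows "plp n \<omega> \<epsilon> \<le> er n (S n \<omega>) (\<epsilon> / 3) + 3 * \<delta> n / (T * \<epsilon>) * (qv n * (b + S n \<omega>)) / gap n"
    and "qv n > 0"
proof -
  interpret Q: posterior_setup n "p n" "X n" lmin L "\<gamma> n" "bh n \<omega>" "\<beta>0 n" a b c "S n \<omega>"
    by (rule setup_n[OF assms(1,2)])
  show "plp n \<omega> \<epsilon> \<le> er n (S n \<omega>) (\<epsilon> / 3) + 3 * \<delta> n / (T * \<epsilon>) * (qv n * (b + S n \<omega>)) / gap n"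
    using Q.linf_prob_le_large[OF assms(3) _ assms(5)] assms(4) T by (simp add: Q.err_def er_def gap_def qv_def)
  show "qv n > 0" using Q.post.q_pos[OF Q.pp.Z_finite] by (simp add: qv_def)
qed

lemma plp_ge:
  assumes "n \<ge> 1" "regular n \<omega>" "\<epsilon> > 0" "close n \<omega> \<epsilon>" "\<kappa> > 0" "\<kappa> * \<delta> n > 3 * \<epsilon>" "qv n > 2"
  shows "plp n \<omega> \<epsilon> \<ge> 1 - er n (S n \<omega>) \<epsilon> -
    \<kappa> * (qn n (\<lambda>j. bh n \<omega> $ j - \<gamma> n $ j) * (real n + a) / (b + S n \<omega>) + qv n) / (qv n - 2)"
proof -
  interpret Q: posterior_setup n "p n" "X n" lmin L "\<gamma> n" "bh n \<omega>" "\<beta>0 n" a b c "S n \<omega>"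
    by (rule setup_n[OF assms(1,2)])
  show ?thesis
    using Q.linf_prob_ge[OF assms(3) _ assms(5,6)] assms(4,7) by (simp add: Q.err_def er_def gap_def qv_def)
qed

lemma DD_eq: "n \<ge> 1 \<Longrightarrow> DD n = (\<Sum>j<p n. (ww n j)\<^sup>2)"
  using \<gamma>_dim[of n] \<beta>0_dim[of n] by (simp add: l2_norm_sq scalar_prod_self_sum power2_commute)

lemma qn_ww_ge: "n \<ge> 1 \<Longrightarrow> real n * DD n \<le> L * qn n (ww n)"
proof -
  assume n: "n \<ge> 1"
  interpret full_rank_design n "p n" "X n" lmin L by (rule design_n[OF n])
  show ?thesis using D.norm_le[of "ww n"] by (simp add: DD_eq[OF n] D.qn_def D.lin_def)
qed

lemma qn_ww_le: "n \<ge> 1 \<Longrightarrow> lmin * qn n (ww n) \<le> real n * DD n"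
proof -
  assume n: "n \<ge> 1"
  interpret full_rank_design n "p n" "X n" lmin L by (rule design_n[OF n])
  have "qn n (ww n) = D.qn (\<lambda>j. (\<beta>0 n - \<gamma> n) $ j)"
    by (rule D.qn_cong) (use \<gamma>_dim[OF n] \<beta>0_dim[OF n] in simp)
  also have "\<dots> = (X n *\<^sub>v (\<beta>0 n - \<gamma> n)) \<bullet> (X n *\<^sub>v (\<beta>0 n - \<gamma> n))"
    using \<gamma>_dim[OF n] \<beta>0_dim[OF n] by (subst norm_X_sum) (auto simp: D.qn_def D.lin_def)
  finally show ?thesis
    using norm_X_le_norm[of "\<beta>0 n - \<gamma> n"] \<gamma>_dim[OF n] \<beta>0_dim[OF n]
    by (simp add: DD_eq[OF n] scalar_prod_self_sum)
qed

lemma S_le: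
  assumes "n \<ge> 1" "\<omega> \<in> space M"
  shows "S n \<omega> \<le> (\<Sum>i<n. (x n \<omega> i)\<^sup>2)"
proof -
  interpret full_rank_design n "p n" "X n" lmin L by (rule design_n[OF assms(1)])
  show ?thesis using resid_le[of "x n \<omega>"] rss_eq_resid[OF assms] by simp
qed

definition C1 :: real where "C1 = b + 4 * \<sigma>0\<^sup>2"

lemma C1_pos: "C1 > 0"
  using b \<sigma>0 by (simp add: C1_def add_nonneg_pos)

lemma b_plus_S_le:
  assumes n: "n \<ge> 1" and "\<omega> \<in> space M" "(\<Sum>i<n. (x n \<omega> i)\<^sup>2) < 4 * \<sigma>0\<^sup>2 * real n"
  shows "b + S n \<omega> \<le> C1 * real n"
proof -
  have "b * 1 \<le> b * real n" using n b by (intro mult_left_mono) auto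
  then show ?thesis using S_le[OF assms(1,2)] assms(3) by (simp add: C1_def algebra_simps)
qed

lemma eventually_gap_ge: "\<forall>\<^sub>F n in sequentially. gap n \<ge> (1 - \<alpha>) / 2 * real n"
  using eventually_gap[of "a - c"] by eventually_elim (simp add: gap_def)

lemma er_small:
  assumes \<omega>: "\<omega> \<in> space M" and ev: "\<forall>\<^sub>F n in sequentially. (\<Sum>i<n. (x n \<omega> i)\<^sup>2) < 4 * \<sigma>0\<^sup>2 * real n"
    and pos: "\<epsilon> > 0" "\<zeta> > 0"
  shows "\<forall>\<^sub>F n in sequentially. er n (S n \<omega>) \<epsilon> < \<zeta>"
proof -
  define E where "E = 8 * L / \<epsilon>\<^sup>2 * C1 / ((1 - \<alpha>) / 2)"
  have "(\<lambda>n. E / sqrt (real n)) \<longlonglongrightarrow> 0" by real_asymp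
  then have "\<forall>\<^sub>F n in sequentially. E / sqrt (real n) < \<zeta>" by (rule order_tendstoD) (rule pos)
  with ev eventually_gap_ge eventually_ge_at_top[of 1] show ?thesis
  proof eventually_elim
    case (elim n)
    have g: "(1 - \<alpha>) / 2 * real n > 0" using elim(3) \<alpha> by simp
    have "er n (S n \<omega>) \<epsilon> \<le> 8 * L / \<epsilon>\<^sup>2 / sqrt n * (C1 * real n) / ((1 - \<alpha>) / 2 * real n)"
      unfolding er_def
    proof (rule frac_le)
      show "8 * L / \<epsilon>\<^sup>2 / sqrt n * (b + S n \<omega>) \<le> 8 * L / \<epsilon>\<^sup>2 / sqrt n * (C1 * real n)"
        using b_plus_S_le[OF elim(3) \<omega> elim(1)] L_pos by (intro mult_left_mono) auto
    qed (use g elim L_pos C1_pos in auto)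
    also have "\<dots> = E / sqrt n" using elim(3) by (simp add: E_def)
    finally show ?case using elim(4) by simp
  qed
qed

lemma eventually_regular:
  assumes "\<forall>\<^sub>F n in sequentially. S n \<omega> > c0 * real n"
    and "\<forall>\<^sub>F n in sequentially. prob_space (posterior (X n) (\<gamma> n) a b c (bh n \<omega>) (S n \<omega>))"
  shows "\<forall>\<^sub>F n in sequentially. regular n \<omega>"
proof -
  have "\<forall>\<^sub>F n in sequentially. real n + a > 2" by real_asymp
  with assms eventually_gap_ge eventually_ge_at_top[of 1] show ?thesis
  proof eventually_elim
    case (elim n)
    have "(1 - \<alpha>) / 2 * real n > 0" using elim(4) \<alpha> by simp
    moreover have "c0 * real n > 0" using elim(4) c0_pos by simp
    ultimately show ?case using elim by auto
  qed
qed

text \<open>If \<delta> is small, the bias is small because u \<le> 1. Otherwise T is at least n D^2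
  / (2 L), and the Markov bound for the bias is a constant times (q / gap) / D. The assumption
  \<open>dich\<close> says that one of these always applies for large n, whatever the
  constants.\<close>

lemma consistent_if:
  assumes dich: "\<And>\<epsilon> K \<zeta>. \<epsilon> > 0 \<Longrightarrow> K > 0 \<Longrightarrow> \<zeta> > 0 \<Longrightarrow>
      \<forall>\<^sub>F n in sequentially. \<delta> n \<le> \<epsilon> \<or> K * (qv n / gap n) \<le> \<zeta> * sqrt (DD n)"
    and \<epsilon>: "\<epsilon> > 0"
  shows "AE \<omega> in M. (\<lambda>n. plp n \<omega> \<epsilon>) \<longlonglongrightarrow> 0"
proof -
  \<comment> \<open>For \<delta> > \<epsilon>/3 the noiseless value W of T is at least n
    (\<epsilon>/3)^2 / L, the square of 4 \<eta> sqrt n. Hence the cross term 2 d costs at most half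
    of W.\<close>
  define \<eta> where "\<eta> = \<epsilon> / (12 * sqrt L)"
  have \<eta>: "\<eta> > 0" using \<epsilon> L_pos by (simp add: \<eta>_def)
  have \<epsilon>3: "\<epsilon> / 3 > 0" using \<epsilon> by simp
  from AE_space AE_ols_close[OF \<epsilon>3] AE_square_bound AE_rss_lower AE_cross_term[OF \<eta>] AE_proper
  show ?thesis
  proof eventually_elim
    case (elim \<omega>)
    note \<omega> = elim(1)
    have "\<forall>\<^sub>F n in sequentially. plp n \<omega> \<epsilon> < \<zeta>" if \<zeta>: "\<zeta> > 0" for \<zeta>
    proof -
      \<comment> \<open>Collects the constants of the Markov bound after inserting T \<ge> n D^2 /
        (2 L) and b + S \<le> C1 n.\<close>
      define K where "K = 6 * L * C1 / \<epsilon>"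
      have K: "K > 0" using L_pos C1_pos \<epsilon> by (simp add: K_def)
      have \<zeta>4: "\<zeta> / 4 > 0" "\<zeta> / 2 > 0" using \<zeta> by auto
      from elim(2) elim(3) elim(5) eventually_regular[OF elim(4,6)]
        er_small[OF \<omega> elim(3) \<epsilon>3 \<zeta>4(2)] dich[OF \<epsilon>3 K \<zeta>4(1)] eventually_ge_at_top[of 1]
      show ?thesis
      proof eventually_elim
        case (elim n)
        note n = elim(7)
        show ?case
        proof (cases "\<delta> n \<le> \<epsilon> / 3")
          case True
          show ?thesis using plp_le_small[OF n elim(4) \<epsilon> elim(1) True] elim(5) \<zeta> by linarith
        next
          case False
          then have \<delta>: "\<delta> n > \<epsilon> / 3" and rho: "K * (qv n / gap n) \<le> \<zeta> / 4 * sqrt (DD n)" using elim(6) by auto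
          have \<delta>0: "\<delta> n > 0" using \<delta> \<epsilon> by linarith
          have \<delta>D: "\<delta> n \<le> sqrt (DD n)" using linf_norm_le_l2_norm[of "\<gamma> n - \<beta>0 n"] by (intro real_le_rsqrt)
          define sD where "sD = sqrt (DD n)"
          have sD: "sD > 0" "DD n = sD * sD" "\<delta> n \<le> sD"
            using \<delta>0 \<delta>D real_sqrt_pow2[of "DD n"] unfolding sD_def by (auto simp: power2_eq_square simp del: real_sqrt_abs)
          define W where "W = qn n (ww n)"
          have WD: "W \<ge> real n * DD n / L" using qn_ww_ge[OF n] L_pos by (simp add: W_def field_simps)
          define T where "T = qn n (\<lambda>j. bh n \<omega> $ j - \<gamma> n $ j)"
          have "T \<ge> W / 2"
          proof -
            interpret full_rank_design n "p n" "X n" lmin L by (rule design_n[OF n])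
            define d where "d = (\<Sum>i<n. lin n (ww n) i * x n \<omega> i)"
            have "T = W + 2 * d + D.qn (beta_hat n (x n \<omega>))"
              unfolding T_def T_eq[OF n \<omega>] qn_add W_def d_def ..
            \<comment> \<open>The quadratic noise term is of the same order n as W when \<alpha> >
              0, but it is nonnegative and may be dropped.\<close>
            then have T1: "T \<ge> W + 2 * d" using D.qn_nonneg[of "beta_hat n (x n \<omega>)"] by linarith
            have "\<epsilon> / 3 \<le> sD" using \<delta> sD(3) by linarith
            then have "(\<epsilon> / 3)\<^sup>2 \<le> sD\<^sup>2" using \<epsilon> by (intro power_mono) auto
            also have "sD\<^sup>2 = DD n" unfolding sD_def by (rule real_sqrt_pow2) simp
            finally have "(\<epsilon> / 3)\<^sup>2 \<le> DD n" .
            then have "real n * (\<epsilon> / 3)\<^sup>2 / L \<le> W" using L_pos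
              by (intro order_trans[OF _ WD] divide_right_mono mult_left_mono) auto
            moreover have "real n * (\<epsilon> / 3)\<^sup>2 / L = (4 * \<eta> * sqrt n)\<^sup>2"
              using L_pos by (simp add: \<eta>_def power_mult_distrib power_divide)
            ultimately have le: "4 * \<eta> * sqrt n \<le> sqrt W" by (intro real_le_rsqrt) simp
            have "\<bar>d\<bar> \<le> \<eta> * sqrt n * sqrt W" using elim(3) by (simp add: d_def W_def)
            also have "\<dots> \<le> sqrt W / 4 * sqrt W" using le D.qn_nonneg[of "ww n"] by (intro mult_right_mono) (auto simp: W_def)
            also have "\<dots> = W / 4" using D.qn_nonneg[of "ww n"] by (simp add: W_def)
            finally show ?thesis using T1 by linarith
          qed
          moreover have Wp: "real n * DD n / L > 0" using n sD L_pos by simp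
          ultimately have T0: "T > 0" using WD by linarith
          have "real n * (sD * sD) / (2 * L) = (real n * DD n / L) / 2" unfolding sD(2) by simp
          also have "\<dots> \<le> W / 2" using WD by (rule divide_right_mono) simp
          also have "\<dots> \<le> T" by fact
          finally have T: "T > 0" "T \<ge> real n * (sD * sD) / (2 * L)" using T0 by auto
          have q: "qv n > 0" by (rule plp_le_large(2)[OF n elim(4) \<epsilon> elim(1) \<delta>0 T_def T(1)])
          have gp: "gap n > 0" using elim(4) by simp
          have bS: "0 \<le> b + S n \<omega>" using b elim(4) by simp
          have "3 * \<delta> n / (T * \<epsilon>) * (qv n * (b + S n \<omega>)) / gap n \<le>
              3 * sD / (real n * (sD * sD) / (2 * L) * \<epsilon>) * (qv n * (C1 * real n)) / gap n"
          proof (intro divide_right_mono mult_mono)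
            show "3 * \<delta> n / (T * \<epsilon>) \<le> 3 * sD / (real n * (sD * sD) / (2 * L) * \<epsilon>)"
              using T sD \<delta>0 \<epsilon> n L_pos by (intro frac_le mult_mono) auto
            show "b + S n \<omega> \<le> C1 * real n" by (rule b_plus_S_le[OF n \<omega> elim(2)])
          qed (use q gp bS sD T \<epsilon> L_pos in auto)
          also have "\<dots> = K * (qv n / gap n) / sD"
            using sD(1) n \<epsilon> L_pos gp by (simp add: K_def field_simps)
          also have "\<dots> \<le> \<zeta> / 4" unfolding pos_divide_le_eq[OF sD(1)] using rho unfolding sD_def .
          finally have "3 * \<delta> n / (T * \<epsilon>) * (qv n * (b + S n \<omega>)) / gap n \<le> \<zeta> / 4" .
          with plp_le_large(1)[OF n elim(4) \<epsilon> elim(1) \<delta>0 T_def T(1)] elim(5) \<zeta> show ?thesis by linarith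
        qed
      qed
    qed
    then show ?case
      by (intro tendstoI) (simp add: posterior_linf_prob_def)
  qed
qed

lemma gap_ratio_lim: "(\<lambda>n. qv n / gap n) \<longlonglongrightarrow> \<alpha> / (1 - \<alpha>)"
proof -
  have "(\<lambda>n. (real (p n) / real n + (c - 2) / real n) / (1 - real (p n) / real n + (a - c) / real n)) \<longlonglongrightarrow> (\<alpha> + 0) / (1 - \<alpha> + 0)"
    using \<alpha> by (intro tendsto_divide tendsto_add tendsto_diff tendsto_const p_lim lim_const_over_n) auto
  moreover have "\<forall>\<^sub>F n in sequentially. (real (p n) / real n + (c - 2) / real n) / (1 - real (p n) / real n + (a - c) / real n) = qv n / gap n"
    using eventually_ge_at_top[of 1]
  proof eventually_elim
    case (elim n)
    have "real (p n) / real n + (c - 2) / real n = qv n / real n" by (simp add: qv_def add_divide_distrib diff_divide_distrib)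
    moreover have "1 - real (p n) / real n + (a - c) / real n = gap n / real n"
      using elim by (simp add: gap_def add_divide_distrib diff_divide_distrib)
    ultimately show ?case using elim by simp
  qed
  ultimately show ?thesis by (auto dest: Lim_transform_eventually)
qed

text \<open>For \<alpha> = 0 the ratio q / gap tends to 0, while \<delta> > \<epsilon> keeps D above
  \<epsilon>. For \<alpha> > 0 an index that violates both alternatives has \<epsilon> < \<delta>
  and D bounded above; infinitely many of them would, by compactness, give the excluded
  subsequence.\<close>

lemma dichotomy:
  assumes cond: "\<alpha> = 0 \<or> \<not> (\<exists>(k :: nat \<Rightarrow> nat) A. strict_mono k \<and> A > 0 \<and> (\<lambda>n. DD (k n)) \<longlonglongrightarrow> A \<and> \<not> (\<lambda>n. \<delta> (k n)) \<longlonglongrightarrow> 0)"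
    and pos: "\<epsilon> > 0" "K > 0" "\<zeta> > 0"
  shows "\<forall>\<^sub>F n in sequentially. \<delta> n \<le> \<epsilon> \<or> K * (qv n / gap n) \<le> \<zeta> * sqrt (DD n)"
proof -
  have \<delta>D: "\<delta> n \<le> sqrt (DD n)" for n using linf_norm_le_l2_norm[of "\<gamma> n - \<beta>0 n"] by (intro real_le_rsqrt)
  show ?thesis
  proof (cases "\<alpha> = 0")
    case True
    have "(\<lambda>n. K * (qv n / gap n)) \<longlonglongrightarrow> K * (\<alpha> / (1 - \<alpha>))" by (intro tendsto_mult tendsto_const gap_ratio_lim)
    then have "\<forall>\<^sub>F n in sequentially. K * (qv n / gap n) < \<zeta> * \<epsilon>"
      by (rule order_tendstoD) (use True pos in simp)
    then show ?thesis
    proof eventually_elim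
      case (elim n)
      show ?case
      proof (cases "\<delta> n \<le> \<epsilon>")
        case False
        then have "\<zeta> * \<epsilon> \<le> \<zeta> * sqrt (DD n)" using \<delta>D[of n] pos by (intro mult_left_mono) auto
        then show ?thesis using elim by linarith
      qed simp
    qed
  next
    case False
    define R where "R = \<alpha> / (1 - \<alpha>) + 1"
    have "\<forall>\<^sub>F n in sequentially. qv n / gap n < R"
      using gap_ratio_lim by (rule order_tendstoD) (simp add: R_def)
    then obtain n0 where n0: "\<And>n. n \<ge> n0 \<Longrightarrow> qv n / gap n < R" by (auto simp: eventually_sequentially)
    show ?thesis
    proof (rule ccontr)
      assume not: "\<not> ?thesis"
      have "\<not> (\<forall>\<^sub>F n in sequentially. (\<delta> n \<le> \<epsilon> \<or> K * (qv n / gap n) \<le> \<zeta> * sqrt (DD n)) \<or> \<not> n \<ge> n0)"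
      proof
        assume "\<forall>\<^sub>F n in sequentially. (\<delta> n \<le> \<epsilon> \<or> K * (qv n / gap n) \<le> \<zeta> * sqrt (DD n)) \<or> \<not> n \<ge> n0"
        then have "\<forall>\<^sub>F n in sequentially. \<delta> n \<le> \<epsilon> \<or> K * (qv n / gap n) \<le> \<zeta> * sqrt (DD n)"
          using eventually_ge_at_top[of n0] by eventually_elim auto
        with not show False by contradiction
      qed
      then obtain k :: "nat \<Rightarrow> nat" where k: "strict_mono k"
        "\<And>n. \<not> (\<delta> (k n) \<le> \<epsilon> \<or> K * (qv (k n) / gap (k n)) \<le> \<zeta> * sqrt (DD (k n))) \<and> k n \<ge> n0"
        by (blast dest: not_eventually_sequentiallyD)
      \<comment> \<open>The upper bound for D obtained from \<zeta> D < K (q / gap) and q / gap <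
        R.\<close>
      define H where "H = K * R / \<zeta>"
      have bounds: "DD (k n) \<in> {\<epsilon>\<^sup>2..H\<^sup>2}" for n
      proof -
        have 1: "\<delta> (k n) > \<epsilon>" "K * (qv (k n) / gap (k n)) > \<zeta> * sqrt (DD (k n))" using k(2)[of n] by auto
        have "K * (qv (k n) / gap (k n)) < K * R" using n0[of "k n"] k(2)[of n] pos by (intro mult_strict_left_mono) auto
        define z where "z = sqrt (DD (k n))"
        have "z < H" using 1 \<open>K * (qv (k n) / gap (k n)) < K * R\<close> pos by (simp only: H_def z_def[symmetric]) (simp add: field_simps)
        moreover have "\<epsilon> \<le> z" unfolding z_def using 1 \<delta>D[of "k n"] by linarith
        ultimately have "\<epsilon>\<^sup>2 \<le> z\<^sup>2" "z\<^sup>2 \<le> H\<^sup>2" using pos by (auto intro!: power_mono)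
        moreover have "z\<^sup>2 = DD (k n)" unfolding z_def by (rule real_sqrt_pow2) simp
        ultimately have "\<epsilon>\<^sup>2 \<le> DD (k n) \<and> DD (k n) \<le> H\<^sup>2" by simp
        then show ?thesis by simp
      qed
      have "compact {\<epsilon>\<^sup>2..H\<^sup>2}" by simp
      then obtain A r where A: "A \<in> {\<epsilon>\<^sup>2..H\<^sup>2}" and r: "strict_mono (r :: nat \<Rightarrow> nat)" "((\<lambda>n. DD (k n)) \<circ> r) \<longlonglongrightarrow> A"
        using bounds unfolding compact_def by meson
      have "\<not> (\<lambda>n. \<delta> ((k \<circ> r) n)) \<longlonglongrightarrow> 0"
      proof
        assume "(\<lambda>n. \<delta> ((k \<circ> r) n)) \<longlonglongrightarrow> 0"
        then have "\<forall>\<^sub>F n in sequentially. \<delta> ((k \<circ> r) n) < \<epsilon>" by (rule order_tendstoD) (rule pos)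
        then obtain n where "\<delta> ((k \<circ> r) n) < \<epsilon>" by (auto simp: eventually_sequentially)
        with k(2)[of "r n"] show False by auto
      qed
      moreover have "strict_mono (k \<circ> r)" by (rule strict_mono_o[OF k(1) r(1)])
      moreover have "A > 0" using A pos by (auto intro: less_le_trans[of 0 "\<epsilon>\<^sup>2"])
      moreover have "(\<lambda>n. DD ((k \<circ> r) n)) \<longlonglongrightarrow> A" using r(2) by (simp add: o_def)
      ultimately show False using cond False by blast
    qed
  qed
qed

text \<open>Bounded D makes T of order n, and \<alpha> > 0 makes q of order n, so E (1/u) is bounded
  and u \<ge> \<kappa> has posterior probability at least 3/4. Where \<delta> \<ge> \<epsilon>0 the
  bias then persists with probability above 1/2.\<close>

lemma not_consistent:
  assumes cons: "\<And>\<epsilon>. \<epsilon> > 0 \<Longrightarrow> AE \<omega> in M. (\<lambda>n. plp n \<omega> \<epsilon>) \<longlonglongrightarrow> 0"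
    and \<alpha>0: "\<alpha> \<noteq> 0" and k: "strict_mono (k :: nat \<Rightarrow> nat)" "(\<lambda>n. DD (k n)) \<longlonglongrightarrow> A"
    and nlim: "\<not> (\<lambda>n. \<delta> (k n)) \<longlonglongrightarrow> 0"
  shows False
proof -
  have \<alpha>p: "\<alpha> > 0" using \<alpha> \<alpha>0 by simp
  obtain \<epsilon>0 where \<epsilon>0: "\<epsilon>0 > 0" "\<not> (\<forall>\<^sub>F n in sequentially. \<delta> (k n) < \<epsilon>0)"
  proof -
    have "\<exists>\<epsilon>0>0. \<not> (\<forall>\<^sub>F n in sequentially. dist (\<delta> (k n)) 0 < \<epsilon>0)" using nlim unfolding tendsto_iff by blast
    then show ?thesis using that linf_norm_nonneg by (auto simp: dist_real_def)
  qed
  then obtain r :: "nat \<Rightarrow> nat" where r: "strict_mono r" "\<And>n. \<delta> (k (r n)) \<ge> \<epsilon>0"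
    using not_eventually_sequentiallyD[OF \<epsilon>0(2)] by (auto simp: not_less)
  define m where "m = k \<circ> r"
  have m: "strict_mono m" unfolding m_def by (rule strict_mono_o[OF k(1) r(1)])
  have mA: "(\<lambda>n. DD (m n)) \<longlonglongrightarrow> A"
    using LIMSEQ_subseq_LIMSEQ[OF k(2) r(1)] by (simp add: m_def o_def)
  have m\<delta>: "\<delta> (m n) \<ge> \<epsilon>0" for n using r(2) by (simp add: m_def)
  have A: "A \<ge> 0" by (rule LIMSEQ_le_const[OF mA]) auto
  \<comment> \<open>An eventual bound for T / n where D^2 \<le> A + 1: twice the noiseless part plus
    twice the squared errors.\<close>
  define C2 where "C2 = 2 * (A + 1) / lmin + 8 * \<sigma>0\<^sup>2"
  have C2: "C2 > 0" using A lmin_pos \<sigma>0 by (simp add: C2_def add_pos_pos)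
  \<comment> \<open>The resulting bound for (T N / B + q) / (q - 2), from N \<le> 2 n, B > c0 n, q
    \<le> 2 n and q - 2 \<ge> \<alpha> n / 2.\<close>
  define K3 where "K3 = (4 * C2 / c0 + 4) / \<alpha>"
  have K3: "K3 > 0" using C2 c0_pos \<alpha>p by (simp add: K3_def add_pos_pos)
  \<comment> \<open>Leaves posterior probability at most 1/4 to u < \<kappa>; together with a noise
    probability below 1/4 this contradicts \<open>plp\<close> < 1/2.\<close>
  define \<kappa> where "\<kappa> = 1 / (4 * K3)"
  have \<kappa>: "\<kappa> > 0" using K3 by (simp add: \<kappa>_def)
  \<comment> \<open>Small enough for 3 \<epsilon> < \<kappa> \<delta> whenever \<delta> \<ge>
    \<epsilon>0.\<close>
  define \<epsilon> where "\<epsilon> = \<kappa> * \<epsilon>0 / 4"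
  have \<epsilon>: "\<epsilon> > 0" using \<kappa> \<epsilon>0(1) by (simp add: \<epsilon>_def)
  have evp: "\<forall>\<^sub>F n in sequentially. \<alpha> / 2 * real n \<le> qv n - 2"
  proof -
    have "(\<lambda>n. real (p n) / real n + (c - 4) / real n) \<longlonglongrightarrow> \<alpha> + 0"
      by (intro tendsto_add p_lim lim_const_over_n)
    then have "\<forall>\<^sub>F n in sequentially. real (p n) / real n + (c - 4) / real n > \<alpha> / 2"
      by (rule order_tendstoD) (use \<alpha>p in simp)
    then show ?thesis using eventually_gt_at_top[of 0]
      by eventually_elim (simp add: field_simps qv_def)
  qed
  have evq: "\<forall>\<^sub>F n in sequentially. qv n \<le> 2 * real n"
  proof -
    have "\<forall>\<^sub>F n in sequentially. c - 2 \<le> real n" by real_asymp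
    then show ?thesis using eventually_ge_at_top[of 1]
    proof eventually_elim
      case (elim n)
      then show ?case using p_less[of n] by (simp add: qv_def)
    qed
  qed
  have evN: "\<forall>\<^sub>F n in sequentially. real n + a \<le> 2 * real n" by real_asymp
  have "AE \<omega> in M. False"
    using AE_space cons[OF \<epsilon>] AE_ols_close[OF \<epsilon>] AE_square_bound AE_rss_lower AE_proper
  proof eventually_elim
    case (elim \<omega>)
    note \<omega> = elim(1)
    have "\<forall>\<^sub>F n in sequentially. plp n \<omega> \<epsilon> < 1 / 2"
      using elim(2) by (rule order_tendstoD) simp
    moreover have "\<forall>\<^sub>F n in sequentially. er n (S n \<omega>) \<epsilon> < 1 / 4" by (rule er_small[OF \<omega> elim(4) \<epsilon>]) simp
    ultimately have "\<forall>\<^sub>F n in sequentially. \<not> (\<delta> n \<ge> \<epsilon>0 \<and> DD n \<le> A + 1)"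
      using elim(3) elim(4) elim(5) eventually_regular[OF elim(5,6)] evp evq evN eventually_ge_at_top[of 1]
    proof eventually_elim
      case (elim n)
      note n = elim(10)
      show ?case
      proof
        assume "\<delta> n \<ge> \<epsilon>0 \<and> DD n \<le> A + 1"
        then have \<delta>n: "\<delta> n \<ge> \<epsilon>0" and Dn: "DD n \<le> A + 1" by auto
        define T where "T = qn n (\<lambda>j. bh n \<omega> $ j - \<gamma> n $ j)"
        interpret full_rank_design n "p n" "X n" lmin L by (rule design_n[OF n])
        have T0: "T \<ge> 0" unfolding T_def by (rule D.qn_nonneg)
        have "qn n (ww n) \<le> real n * (A + 1) / lmin"
        proof -
          have "lmin * qn n (ww n) \<le> real n * (A + 1)"
            using qn_ww_le[OF n] Dn by (meson mult_left_mono of_nat_0_le_iff order_trans)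
          then show ?thesis using lmin_pos by (simp add: field_simps)
        qed
        moreover have "T \<le> 2 * qn n (ww n) + 2 * (\<Sum>i<n. (x n \<omega> i)\<^sup>2)"
          unfolding T_def T_eq[OF n \<omega>] by (rule qn_add_le)
        ultimately have "T \<le> 2 * (real n * (A + 1) / lmin) + 2 * (4 * \<sigma>0\<^sup>2 * real n)" using elim(4) by linarith
        also have "\<dots> = C2 * real n" by (simp add: C2_def algebra_simps)
        finally have T: "T \<le> C2 * real n" .
        have q2: "qv n - 2 > 0" by (rule less_le_trans[OF _ elim(7)]) (use \<alpha>p n in simp)
        have c0n: "c0 * real n > 0" using c0_pos n by simp
        have "(T * (real n + a) / (b + S n \<omega>) + qv n) / (qv n - 2) \<le> ((C2 * real n) * (2 * real n) / (c0 * real n) + 2 * real n) / (\<alpha> / 2 * real n)"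
        proof (rule frac_le)
          have "T * (real n + a) / (b + S n \<omega>) \<le> (C2 * real n) * (2 * real n) / (c0 * real n)"
          proof (rule frac_le)
            show "T * (real n + a) \<le> C2 * real n * (2 * real n)" using T T0 elim(6,9) C2 by (intro mult_mono) auto
          qed (use c0n elim(5) b C2 in auto)
          then show "T * (real n + a) / (b + S n \<omega>) + qv n \<le> (C2 * real n) * (2 * real n) / (c0 * real n) + 2 * real n"
            using elim(8) by linarith
        qed (use elim(7) \<alpha>p n c0_pos C2 in auto)
        also have "\<dots> = K3" using n c0_pos \<alpha>p by (simp add: K3_def field_simps)
        finally have ratio: "(T * (real n + a) / (b + S n \<omega>) + qv n) / (qv n - 2) \<le> K3" .
        have "\<kappa> * (T * (real n + a) / (b + S n \<omega>) + qv n) / (qv n - 2) \<le> \<kappa> * K3"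
          using mult_left_mono[OF ratio, of \<kappa>] \<kappa> by simp
        also have "\<dots> = 1 / 4" using K3 by (simp add: \<kappa>_def)
        finally have "\<kappa> * (T * (real n + a) / (b + S n \<omega>) + qv n) / (qv n - 2) \<le> 1 / 4" .
        moreover have "3 * \<epsilon> < \<kappa> * \<delta> n"
        proof -
          have "3 * \<epsilon> < \<kappa> * \<epsilon>0" using \<kappa> \<epsilon>0(1) by (simp add: \<epsilon>_def)
          also have "\<dots> \<le> \<kappa> * \<delta> n" using \<delta>n \<kappa> by (intro mult_left_mono) auto
          finally show ?thesis .
        qed
        ultimately show False
          using plp_ge[OF n elim(6) \<epsilon> elim(3) \<kappa>, folded T_def] q2 elim(1,2) by linarith
      qed
    qed
    \<comment> \<open>All estimates were made for every large n; the subsequence enters here, where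
      it supplies infinitely many n with the excluded combination.\<close>
    then have "\<forall>\<^sub>F n in sequentially. \<not> (\<delta> (m n) \<ge> \<epsilon>0 \<and> DD (m n) \<le> A + 1)"
      by (rule eventually_subseq[OF m])
    moreover have "\<forall>\<^sub>F n in sequentially. DD (m n) < A + 1" using mA by (rule order_tendstoD) simp
    ultimately have "\<forall>\<^sub>F n in sequentially. False"
      by eventually_elim (use m\<delta> in \<open>auto simp: less_imp_le\<close>)
    then show ?case by simp
  qed
  then show False by simp
qed

lemma consistent_iff:
  "(\<forall>\<epsilon>>0. AE \<omega> in M. (\<lambda>n. plp n \<omega> \<epsilon>) \<longlonglongrightarrow> 0) \<longleftrightarrow>
    (\<alpha> = 0 \<or> \<not> (\<exists>(k :: nat \<Rightarrow> nat) A. strict_mono k \<and> A > 0 \<and> (\<lambda>n. DD (k n)) \<longlonglongrightarrow> A \<and> \<not> (\<lambda>n. \<delta> (k n)) \<longlonglongrightarrow> 0))"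
  using consistent_if dichotomy not_consistent by blast

end

theorem theorem3:
  fixes M :: "'w measure"
    and p :: "nat \<Rightarrow> nat"
    and \<alpha> lmin lmax a b c \<sigma>0 :: real
    and X :: "nat \<Rightarrow> real mat"
    and \<gamma> \<beta>0 :: "nat \<Rightarrow> real vec"
    and e Y :: "nat \<Rightarrow> 'w \<Rightarrow> real vec"
  assumes p_mono: "mono_on {1..} p"
    and p_less: "\<And>n. n \<ge> 1 \<Longrightarrow> p n < n"
    and p_lim: "(\<lambda>n. real (p n) / real n) \<longlonglongrightarrow> \<alpha>"
    and \<alpha>: "0 \<le> \<alpha>" "\<alpha> < 1"
    and X_dim: "\<And>n. n \<ge> 1 \<Longrightarrow> X n \<in> carrier_mat n (p n)"
    and X_rank: "\<And>n. n \<ge> 1 \<Longrightarrow> vec_space.rank n (X n) = p n"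
    and lmin_pos: "0 < lmin"
    and eigenvalues: "\<And>n l. n \<ge> 1 \<Longrightarrow> eigenvalue (real n \<cdot>\<^sub>m mat_inv ((X n)\<^sup>T * X n)) l
          \<Longrightarrow> lmin \<le> l \<and> l \<le> lmax"
    and \<gamma>_dim: "\<And>n. n \<ge> 1 \<Longrightarrow> \<gamma> n \<in> carrier_vec (p n)"
    and \<beta>0_dim: "\<And>n. n \<ge> 1 \<Longrightarrow> \<beta>0 n \<in> carrier_vec (p n)"
    and a: "a \<ge> -2"
    and b: "b \<ge> 0"
    and \<sigma>0: "\<sigma>0 > 0"
    and M: "prob_space M"
    and e_distr: "\<And>n. n \<ge> 1 \<Longrightarrow> mvn_distributed M (e n) (0\<^sub>v n) (\<sigma>0\<^sup>2 \<cdot>\<^sub>m 1\<^sub>m n)"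
    and Y_eq: "\<And>n \<omega>. n \<ge> 1 \<Longrightarrow> \<omega> \<in> space M \<Longrightarrow> Y n \<omega> = X n *\<^sub>v \<beta>0 n + e n \<omega>"
    and proper: "\<forall>\<^sub>F n in sequentially. AE \<omega> in M.
          prob_space (posterior (X n) (\<gamma> n) a b c (ols (X n) (Y n \<omega>)) (rss (X n) (Y n \<omega>)))"
  shows "(\<forall>\<epsilon>>0. AE \<omega> in M.
            (\<lambda>n. posterior_linf_prob (X n) (\<gamma> n) a b c
                   (ols (X n) (Y n \<omega>)) (rss (X n) (Y n \<omega>)) (\<beta>0 n) \<epsilon>) \<longlonglongrightarrow> 0)
    \<longleftrightarrow>
      (\<alpha> = 0 \<or>
       \<not> (\<exists>(k :: nat \<Rightarrow> nat) A. strict_mono k \<and> A > 0 \<and>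
             (\<lambda>n. (l2_norm (\<gamma> (k n) - \<beta>0 (k n)))\<^sup>2) \<longlonglongrightarrow> A \<and>
             \<not> (\<lambda>n. linf_norm (\<gamma> (k n) - \<beta>0 (k n))) \<longlonglongrightarrow> 0))"
proof -
  \<comment> \<open>If every p n is 0 there are no eigenvalues and \<open>lmax\<close> may fail to
    be positive; enlarging it to \<open>max 1 lmax\<close> preserves the bounds and is always
    positive.\<close>
  interpret H: hyper_g_model M p \<alpha> lmin "max 1 lmax" a b c \<sigma>0 X \<gamma> \<beta>0 e Y
  proof (intro hyper_g_model.intro M hyper_g_model_axioms.intro)
    show "lmin \<le> l \<and> l \<le> max 1 lmax"
      if "n \<ge> 1" "eigenvalue (real n \<cdot>\<^sub>m mat_inv ((X n)\<^sup>T * X n)) l" for n l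
      using eigenvalues[OF that] by auto
  qed (fact p_less p_lim \<alpha> X_dim X_rank lmin_pos \<gamma>_dim \<beta>0_dim b \<sigma>0 e_distr Y_eq proper | simp)+
  show ?thesis by (rule H.consistent_iff)
qed

end
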